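(* Let $C>0$ be arbitrary. For all integers $N \geq 3$ and all integers $1 \le b \le c$ with $b \le (\log N)^C$, we have \[ \frac{1}{\varphi (N)} \sum_{a \in \mathbb{Z}_N^*} L_{[b,c]} \left( \frac{a}{N} \right) = \mu_{[b,c]} \log N +O \left( \frac{(\log \log N)^3}{b} \right) , \] and \[ \frac{1}{\varphi (N)} \sum_{a \in \mathbb{Z}_N^*} \left( L_{[b,c]} \left( \frac{a}{N} \right) - \mu_{[b,c]} \log N \right)^2 \ll \frac{(\log N)^2}{b^4} + \frac{\log N \log \log N}{b}, \] where $\mu_{[b,c]}=\frac{12}{\pi^2} \sum_{m=b}^c \log \left( 1+\frac{1}{m(m+2)} \right)$, and the implied constants depend only on $C$.
   Context: For an integer $N\ge 2$, $\mathbb{Z}_N^*$ denotes the set of integers $1\le a\le N$ coprime to $N$, and $\varphi$ is Euler's totient function. For $a\in\mathbb{Z}_N^*$, $a/N=[0;a_1,\ldots,a_r]$ is the canonical continued fraction expansion (with $a_r>1$). For integers $1\le b\le c$, $L_{[b,c]}(a/N)=\sum_{i=1}^r \mathds{1}_{\{b\le a_i\le c\}}$ is the number of partial quotients of $a/N$ lying in $[b,c]$. *)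

theory Defs
  imports "HOL-Analysis.Analysis" "HOL-Number_Theory.Totient"
begin

(* The list [a_1, ..., a_r] stands for the continued fraction [0; a_1, ..., a_r];
   the integer part a_0 = 0 is left implicit. *)
fun cfrac_value :: "nat list \<Rightarrow> real" where
  "cfrac_value [] = 0"
| "cfrac_value (a # as) = 1 / (real a + cfrac_value as)"

definition canonical_cfrac :: "nat list \<Rightarrow> bool" where
  "canonical_cfrac as \<longleftrightarrow> (\<forall>a\<in>set as. a \<ge> 1) \<and> (as \<noteq> [] \<longrightarrow> last as > 1)"

(* Meaningful for rational x in [0, 1), where the expansion exists and is unique
   (canonical_cfrac_ex1, partial_quotients_eqI). *)
definition partial_quotients :: "real \<Rightarrow> nat list" where
  "partial_quotients x = (THE as. canonical_cfrac as \<and> cfrac_value as = x)"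

definition count_quotients :: "nat \<Rightarrow> nat \<Rightarrow> real \<Rightarrow> nat" where
  "count_quotients b c x =
     (let as = partial_quotients x in card {i. i < length as \<and> b \<le> as ! i \<and> as ! i \<le> c})"

definition cfrac_mu :: "nat \<Rightarrow> nat \<Rightarrow> real" where
  "cfrac_mu b c = 12 / pi\<^sup>2 * (\<Sum>m=b..c. ln (1 + 1 / (real m * (real m + 2))))"

lemma canonical_cfrac_Cons:
  "canonical_cfrac (a # as) \<longleftrightarrow> a \<ge> 1 \<and> canonical_cfrac as \<and> (as = [] \<longrightarrow> a > 1)"
  by (auto simp: canonical_cfrac_def)

lemma cfrac_value_bounds:
  assumes "canonical_cfrac as"
  shows "0 \<le> cfrac_value as" "cfrac_value as < 1" "cfrac_value as = 0 \<longleftrightarrow> as = []"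
proof -
  have "0 \<le> cfrac_value as \<and> cfrac_value as < 1 \<and> (cfrac_value as = 0 \<longleftrightarrow> as = [])"
    using assms
  proof (induction as)
    case Nil
    then show ?case by simp
  next
    case (Cons a as)
    from Cons.prems have a: "a \<ge> 1" "canonical_cfrac as" "as = [] \<longrightarrow> a > 1"
      by (auto simp: canonical_cfrac_Cons)
    with Cons.IH have IH: "0 \<le> cfrac_value as" "cfrac_value as = 0 \<longleftrightarrow> as = []"
      by auto
    have "real a + cfrac_value as > 1"
    proof (cases "as = []")
      case True
      then show ?thesis using a by simp
    next
      case False
      then have "cfrac_value as > 0" using IH by linarith
      then show ?thesis using a by linarith
    qed
    then show ?case by simp
  qed
  then show "0 \<le> cfrac_value as" "cfrac_value as < 1" "cfrac_value as = 0 \<longleftrightarrow> as = []"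
    by auto
qed

lemma canonical_cfrac_unique:
  assumes "canonical_cfrac as" "canonical_cfrac bs" "cfrac_value as = cfrac_value bs"
  shows "as = bs"
  using assms
proof (induction as arbitrary: bs)
  case Nil
  then show ?case using cfrac_value_bounds(3)[of bs] by simp
next
  case (Cons a as)
  from Cons.prems have "cfrac_value bs \<noteq> 0"
    using cfrac_value_bounds(3)[of "a # as"] by simp
  then obtain b cs where bs: "bs = b # cs" by (cases bs) auto
  have can: "canonical_cfrac as" "canonical_cfrac cs"
    using Cons.prems bs by (auto simp: canonical_cfrac_Cons)
  have eq: "real a + cfrac_value as = real b + cfrac_value cs"
    using Cons.prems(3) bs by simp
  note bnd = cfrac_value_bounds[OF can(1)] cfrac_value_bounds[OF can(2)]
  have "a = b" using eq bnd by linarith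
  moreover from this have "as = cs" using Cons.IH[OF can] eq by simp
  ultimately show ?case using bs by simp
qed

lemma canonical_cfrac_exists:
  assumes "a < (N::nat)"
  shows "\<exists>as. canonical_cfrac as \<and> cfrac_value as = real a / real N"
  using assms
proof (induction a arbitrary: N rule: less_induct)
  case (less a)
  show ?case
  proof (cases "a = 0")
    case True
    then show ?thesis by (intro exI[of _ "[]"]) (simp add: canonical_cfrac_def)
  next
    case False
    then have "N mod a < a" by simp
    from less.IH[OF this this] obtain as where
      as: "canonical_cfrac as" "cfrac_value as = real (N mod a) / real a" by blast
    have N: "real N = real (N div a) * real a + real (N mod a)"
      by (metis div_mult_mod_eq of_nat_add of_nat_mult)
    have q: "N div a \<ge> 1" using less.prems False by (simp add: Suc_leI div_greater_zero_iff)
    have last: "N div a > 1" if "as = []"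
    proof -
      have "N mod a = 0" using as(2) that False by simp
      then have "N = (N div a) * a" by (metis add_0_right div_mult_mod_eq)
      then have "N div a \<noteq> 1" using less.prems by auto
      then show ?thesis using q by linarith
    qed
    have "cfrac_value (N div a # as) = real a / real N"
      unfolding cfrac_value.simps as(2) using False by (subst N) (simp add: field_simps)
    moreover have "canonical_cfrac (N div a # as)"
      using q last as(1) by (simp add: canonical_cfrac_Cons)
    ultimately show ?thesis by blast
  qed
qed

lemma canonical_cfrac_ex1:
  assumes "a < (N::nat)"
  shows "\<exists>!as. canonical_cfrac as \<and> cfrac_value as = real a / real N"
  using canonical_cfrac_exists[OF assms] canonical_cfrac_unique by metis

lemma partial_quotients_eqI:
  assumes "canonical_cfrac as" "cfrac_value as = x"
  shows "partial_quotients x = as"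
  unfolding partial_quotients_def
  using assms canonical_cfrac_unique by (intro the_equality) auto

end

theory Submission
  imports Defs "HOL-Number_Theory.Cong" "HOL-Computational_Algebra.Squarefree" "HOL-Real_Asymp.Real_Asymp"
begin

text \<open>
  A position of the partial quotient \<open>m\<close> in \<open>a/N\<close> is a splitting of the list of partial quotients as
  \<open>u, m, v\<close>. With \<open>q = K(u)\<close>, \<open>p = K(butlast u)\<close> and \<open>(R, r) = (K(m, v), K(v))\<close>, where \<open>K\<close> denotes the
  continuant, such positions correspond to coprime solutions of \<open>q R + p r = N\<close> with \<open>R / r\<close> in
  \<open>[b, c + 1)\<close>. For fixed \<open>(q, p)\<close> the solutions that need not be coprime form an arithmetic progression
  modulo \<open>q\<close>, so Moebius inversion over the divisors \<open>d\<close> of \<open>N\<close> evaluates the number of positions with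
  \<open>q \<le> Q = sqrt N / D\<close>; the divisors \<open>d > D = exp (A (log log N)^2)\<close> are treated with Rankin's trick.
  Reversal of the list exchanges \<open>u\<close> and \<open>v\<close>, so the positions with \<open>K(v) \<le> Q\<close> behave in the same way, and
  only \<open>O((log log N)^2)\<close> positions per fraction remain in the middle.

  For the second moment the contributions of the two halves are centred separately, so that only pairs of
  positions in the same half matter, and no joint equidistribution of \<open>a\<close> and its inverse is needed.
  Counting pairs is the same problem with each \<open>u\<close> weighted by its own number of partial quotients in
  \<open>[b, c]\<close>, and the first moment over all denominators up to \<open>Q\<close> evaluates the weighted main term. The error
  \<open>1/b^4\<close> arises because the two expansions of one rational number give the values \<open>x\<close> and \<open>1 - x\<close> of
  \<open>p/q\<close>: the density \<open>1/(b + x) - 1/(c + 1 + x)\<close>, symmetrized in \<open>x\<close>, is constant up to \<open>O(1/b^3)\<close>.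
\<close>

section \<open>Continuants and continued fraction lists\<close>

text \<open>The size of D is a compromise. For each divisor d of N the count on an arithmetic
  progression has total error O(Q^2) up to the weight, with Q^2 about N / D^2, so the d <= D
  together cost O(N / D), while the d > D cost a Rankin tail. Both must beat N by an arbitrary power
  of log N, which log D of order (log log N)^2 achieves. The price is the gap log (sqrt N / Q),
  about log D, which is the size of the middle. The cube in the first moment is this square times
  one more log log N, coming from N / phi(N). Both expansions of every fraction are counted because
  reversal does not preserve the canonical ones. Returning to the canonical ones costs O(N / b) in
  the first moment, since the two expansions of a fraction differ only at the end, and nothing in
  the second, whose summands are nonnegative.\<close>

fun cont :: "nat list \<Rightarrow> nat" and cont_tl :: "nat list \<Rightarrow> nat" where
  "cont [] = 1"
| "cont (a # v) = a * cont v + cont_tl v"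
| "cont_tl [] = 0"
| "cont_tl (a # v) = cont v"

text \<open>\<open>cont_tl\<close> and \<open>cont_bl\<close> delete the first and the last entry. Both are 0 on the empty list, the value for
  which \<open>cont_append\<close> holds without exception.\<close>

definition cont_bl :: "nat list \<Rightarrow> nat" where
  "cont_bl u = cont_tl (rev u)"

definition poslist :: "nat list \<Rightarrow> bool" where
  "poslist w \<longleftrightarrow> (\<forall>a\<in>set w. 1 \<le> a)"

lemma poslist_simps [simp]:
  "poslist []" "poslist (a # v) \<longleftrightarrow> 1 \<le> a \<and> poslist v"
  "poslist (u @ v) \<longleftrightarrow> poslist u \<and> poslist v" "poslist (rev u) \<longleftrightarrow> poslist u"
  by (auto simp: poslist_def)

text \<open>Appending an entry on the right turns \<open>cont_bl\<close> into the continuant of a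
  reversed prefix, so the concatenation rule and the invariance under reversal have to be proved in
  one induction.\<close>

lemma cont_append_rev:
  "cont (u @ v) = cont u * cont v + cont_bl u * cont_tl v \<and> cont (rev u) = cont u"
proof (induction u arbitrary: v rule: rev_induct)
  case Nil
  show ?case by (simp add: cont_bl_def)
next
  case (snoc a u)
  have bl: "cont_bl (u @ [a]) = cont u" using snoc by (simp add: cont_bl_def)
  have c: "cont (u @ [a]) = a * cont u + cont_bl u" using snoc[of "[a]"] by simp
  have "cont ((u @ [a]) @ v) = cont u * cont (a # v) + cont_bl u * cont_tl (a # v)"
    using snoc[of "a # v"] by simp
  then show ?case using bl c snoc by (simp add: cont_bl_def algebra_simps)
qed

lemma cont_append: "cont (u @ v) = cont u * cont v + cont_bl u * cont_tl v"
  and cont_rev [simp]: "cont (rev u) = cont u"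
  using cont_append_rev by blast+

lemma cont_bl_Nil [simp]: "cont_bl [] = 0"
  and cont_bl_snoc [simp]: "cont_bl (u @ [a]) = cont u"
  and cont_snoc: "cont (u @ [a]) = a * cont u + cont_bl u"
  by (auto simp: cont_bl_def cont_append)

lemma cont_bl_rev [simp]: "cont_bl (rev u) = cont_tl u"
  by (simp add: cont_bl_def)

lemma cont_pos: "poslist w \<Longrightarrow> 1 \<le> cont w"
  by (induction w) (auto simp: Suc_le_eq)

lemma cont_tl_le: "poslist w \<Longrightarrow> cont_tl w \<le> cont w"
  by (induction w) (auto intro: trans_le_add1)

lemma cont_bl_le: "poslist w \<Longrightarrow> cont_bl w \<le> cont w"
  using cont_tl_le[of "rev w"] by (simp add: cont_bl_def)

lemma coprime_cont_tl: "coprime (cont_tl w) (cont w)"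
proof (induction w)
  case (Cons a v)
  have "gcd (cont v) (a * cont v + cont_tl v) = gcd (cont v) (cont_tl v)"
    by (rule gcd_add_mult)
  then show ?case using Cons by (simp add: coprime_iff_gcd_eq_1 gcd.commute)
qed auto

lemma coprime_cont_bl: "coprime (cont_bl w) (cont w)"
  using coprime_cont_tl[of "rev w"] by (simp add: cont_bl_def)

lemma cont_ge_mult: "cont u * cont v \<le> cont (u @ v)"
  by (simp add: cont_append)

lemma cont_ge_elem: "poslist w \<Longrightarrow> a \<in> set w \<Longrightarrow> a \<le> cont w"
proof (induction w)
  case (Cons b v)
  have "b \<le> b * cont v" "cont v \<le> b * cont v"
    using cont_pos[of v] Cons.prems by auto
  then have "b \<le> cont (b # v)" "cont v \<le> cont (b # v)" by (auto intro: trans_le_add1)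
  then show ?case using Cons by (auto simp del: cont.simps intro: order_trans)
qed auto

text \<open>Prepending two entries at least doubles the continuant; hence the halved length in the
  exponent.\<close>

lemma cont_ge_power: "poslist w \<Longrightarrow> 2 ^ (length w div 2) \<le> cont w"
proof (induction w rule: length_induct)
  case (1 w)
  show ?case
  proof (cases "length w < 2")
    case True
    then show ?thesis using cont_pos[OF 1(2)] by simp
  next
    case False
    then obtain a b v where w: "w = a # b # v"
      by (cases w; cases "tl w") auto
    have p: "poslist v" "1 \<le> a" "1 \<le> b" using 1(2) w by auto
    have "2 ^ (length v div 2) \<le> cont v" using 1(1) p w by auto
    moreover have "cont v \<le> a * (b * cont v)"
      using mult_le_mono[OF p(2) mult_le_mono[OF p(3) order_refl[of "cont v"]]] by simp
    moreover have "a * (b * cont v) + cont v \<le> cont w" unfolding w by (simp add: algebra_simps)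
    ultimately have "2 * 2 ^ (length v div 2) \<le> cont w" by linarith
    then show ?thesis unfolding w by simp
  qed
qed

text \<open>Both expansions of a rational number are admitted here: unlike the canonical lists, this set is closed
  under reversal.\<close>

definition cf_lists :: "nat \<Rightarrow> nat list set" where
  "cf_lists n = {w. poslist w \<and> cont w = n}"

definition canon_lists :: "nat \<Rightarrow> nat list set" where
  "canon_lists n = {w \<in> cf_lists n. canonical_cfrac w}"

definition noncanon_lists :: "nat \<Rightarrow> nat list set" where
  "noncanon_lists n = {w \<in> cf_lists n. \<not> canonical_cfrac w}"

lemma canonical_iff: "canonical_cfrac w \<longleftrightarrow> poslist w \<and> (w \<noteq> [] \<longrightarrow> last w > 1)"
  by (simp add: canonical_cfrac_def poslist_def)

lemma finite_cf_lists [simp]: "finite (cf_lists n)"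
proof (rule finite_subset)
  show "cf_lists n \<subseteq> {xs. set xs \<subseteq> {..n} \<and> length xs \<le> 2 * n + 1}"
  proof
    fix w assume "w \<in> cf_lists n"
    then have w: "poslist w" "cont w = n" by (auto simp: cf_lists_def)
    have "length w div 2 < 2 ^ (length w div 2)" by simp
    also have "\<dots> \<le> n" using cont_ge_power[OF w(1)] w by simp
    finally have "length w \<le> 2 * n + 1" by linarith
    then show "w \<in> {xs. set xs \<subseteq> {..n} \<and> length xs \<le> 2 * n + 1}" using cont_ge_elem w by auto
  qed
  show "finite {xs. set xs \<subseteq> {..n} \<and> length xs \<le> 2 * n + 1}"
    by (intro finite_lists_length_le) auto
qed

lemma cf_lists_split: "cf_lists n = canon_lists n \<union> noncanon_lists n" "canon_lists n \<inter> noncanon_lists n = {}"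
  by (auto simp: canon_lists_def noncanon_lists_def)

lemma finite_canon_lists [simp]: "finite (canon_lists n)" and finite_noncanon_lists [simp]: "finite (noncanon_lists n)"
  by (auto simp: canon_lists_def noncanon_lists_def)

lemma cf_lists_rev: "rev ` cf_lists n = cf_lists n"
proof -
  have "rev ` cf_lists n \<subseteq> cf_lists n" for n by (auto simp: cf_lists_def)
  moreover have "cf_lists n = rev ` rev ` cf_lists n" by (simp add: image_image)
  ultimately show ?thesis by blast
qed

lemma sum_cf_lists_rev: "(\<Sum>w\<in>cf_lists n. g (rev w)) = (\<Sum>w\<in>cf_lists n. g w)"
  by (rule sum.reindex_bij_betw[of rev]) (auto simp: bij_betw_def cf_lists_rev)

lemma sum_cf_lists_split: "(\<Sum>w\<in>cf_lists n. g w) = (\<Sum>w\<in>canon_lists n. g w) + (\<Sum>w\<in>noncanon_lists n. g w)"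
  unfolding cf_lists_split(1) by (rule sum.union_disjoint) (use cf_lists_split in auto)

section \<open>Continued fraction lists and reduced fractions\<close>

lemma cfrac_value_eq:
  "poslist w \<Longrightarrow> cfrac_value w = real (cont_tl w) / real (cont w)"
proof (induction w)
  case (Cons a v)
  have "real (cont v) > 0" using cont_pos[of v] Cons.prems by simp
  moreover have "cfrac_value v = real (cont_tl v) / real (cont v)" using Cons by simp
  ultimately have "real (cont (a # v)) = real (cont v) * (real a + cfrac_value v)"
    by (simp add: field_simps)
  then show ?case using \<open>real (cont v) > 0\<close> by simp
qed auto

text \<open>\<open>cont_tl w / cont w\<close> is the value of \<open>w\<close> in lowest terms, so
  the canonical lists of continuant \<open>n\<close> are the expansions of the reduced fractions in
  [0, 1) with denominator \<open>n\<close>. The numerator 0 occurs only for \<open>n = 1\<close>,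
  with the empty list.\<close>

lemma bij_betw_canon_lists:
  assumes "n \<ge> 1"
  shows "bij_betw cont_tl (canon_lists n) {r. r < n \<and> coprime r n}"
  unfolding bij_betw_def
proof
  show "inj_on cont_tl (canon_lists n)"
  proof
    fix v w assume vw: "v \<in> canon_lists n" "w \<in> canon_lists n" "cont_tl v = cont_tl w"
    then have "cfrac_value v = cfrac_value w" by (auto simp: canon_lists_def cf_lists_def cfrac_value_eq)
    then show "v = w" using canonical_cfrac_unique vw by (auto simp: canon_lists_def)
  qed
  show "cont_tl ` canon_lists n = {r. r < n \<and> coprime r n}"
  proof (intro equalityI subsetI)
    fix r assume "r \<in> cont_tl ` canon_lists n"
    then obtain w where w: "poslist w" "canonical_cfrac w" "cont w = n" "r = cont_tl w"
      by (auto simp: canon_lists_def cf_lists_def)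
    have "real r / real n < 1" using cfrac_value_bounds(2)[OF w(2)] cfrac_value_eq[OF w(1)] w by simp
    then show "r \<in> {r. r < n \<and> coprime r n}" using assms coprime_cont_tl[of w] w by simp
  next
    fix r assume "r \<in> {r. r < n \<and> coprime r n}"
    then have r: "r < n" "coprime r n" by auto
    obtain w where w: "canonical_cfrac w" "cfrac_value w = real r / real n"
      using canonical_cfrac_exists[OF r(1)] by blast
    have p: "poslist w" using w by (simp add: canonical_iff)
    have "real (cont_tl w) / real (cont w) = real r / real n" using cfrac_value_eq[OF p] w by simp
    then have "real (cont_tl w * n) = real (r * cont w)"
      using assms cont_pos[OF p] by (simp add: field_simps)
    then have e: "cont_tl w * n = r * cont w" by linarith
    have "n dvd cont w" using e r(2) by (metis coprime_commute coprime_dvd_mult_right_iff dvd_triv_right)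
    moreover have "cont w dvd n" using e coprime_cont_tl[of w]
      by (metis coprime_commute coprime_dvd_mult_right_iff dvd_triv_right)
    ultimately have "cont w = n" by (rule dvd_antisym[symmetric])
    then have "cont_tl w = r" using e assms by simp
    then show "r \<in> cont_tl ` canon_lists n" using w p \<open>cont w = n\<close> by (auto simp: canon_lists_def cf_lists_def)
  qed
qed

text \<open>The other expansion of the same rational number, obtained from a canonical list whose
  last entry is at least 2.\<close>

definition twin :: "nat list \<Rightarrow> nat list" where
  "twin w = butlast w @ [last w - 1, 1]"

lemma twin_snoc: "twin (x @ [a]) = x @ [a - 1, 1]"
  by (simp add: twin_def)

lemma cont_tl_snoc_cases: "cont_tl (x @ v) = (if x = [] then cont_tl v else cont (tl x @ v))"
  by (cases x) auto

lemma bij_betw_twin: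
  assumes "n \<ge> 2"
  shows "bij_betw twin (canon_lists n) (noncanon_lists n)"
proof (rule bij_betw_byWitness[where f' = "\<lambda>w. butlast (butlast w) @ [last (butlast w) + 1]"])
  have V: "\<exists>x a. w = x @ [a] \<and> a \<ge> 2 \<and> poslist x \<and> cont w = n" if "w \<in> canon_lists n" for w
    using that assms by (cases w rule: rev_exhaust) (auto simp: canon_lists_def cf_lists_def canonical_iff)
  have X: "\<exists>x a. w = x @ [a, 1] \<and> a \<ge> 1 \<and> poslist x \<and> cont w = n" if w: "w \<in> noncanon_lists n" for w
  proof -
    obtain y b where y: "w = y @ [b]" "b = 1" using w
      by (cases w rule: rev_exhaust) (auto simp: noncanon_lists_def cf_lists_def canonical_iff)
    have "y \<noteq> []" using w assms y by (auto simp: noncanon_lists_def cf_lists_def)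
    then obtain x a where "y = x @ [a]" by (cases y rule: rev_exhaust) auto
    then show ?thesis using w y by (auto simp: noncanon_lists_def cf_lists_def)
  qed
  have e: "cont (x @ [a, 1]) = cont (x @ [a + 1])" for x a
    by (simp add: cont_append algebra_simps)
  show "\<forall>w\<in>canon_lists n. butlast (butlast (twin w)) @ [last (butlast (twin w)) + 1] = w"
  proof
    fix w assume "w \<in> canon_lists n"
    then obtain x a where "w = x @ [a]" "a \<ge> 2" using V by blast
    then show "butlast (butlast (twin w)) @ [last (butlast (twin w)) + 1] = w"
      by (simp add: twin_snoc butlast_append)
  qed
  show "\<forall>w\<in>noncanon_lists n. twin (butlast (butlast w) @ [last (butlast w) + 1]) = w"
  proof
    fix w assume "w \<in> noncanon_lists n"
    then obtain x a where "w = x @ [a, 1]" using X by blast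
    then show "twin (butlast (butlast w) @ [last (butlast w) + 1]) = w"
      by (simp add: twin_snoc butlast_append)
  qed
  show "twin ` canon_lists n \<subseteq> noncanon_lists n"
  proof safe
    fix w assume "w \<in> canon_lists n"
    then obtain x a where w: "w = x @ [a]" "a \<ge> 2" "poslist x" "cont w = n" using V by blast
    have "cont (twin w) = n" using e[of x "a - 1"] w by (simp add: twin_snoc)
    then show "twin w \<in> noncanon_lists n" using w by (auto simp: noncanon_lists_def cf_lists_def canonical_iff twin_snoc)
  qed
  show "(\<lambda>w. butlast (butlast w) @ [last (butlast w) + 1]) ` noncanon_lists n \<subseteq> canon_lists n"
  proof safe
    fix w assume "w \<in> noncanon_lists n"
    then obtain x a where w: "w = x @ [a, 1]" "a \<ge> 1" "poslist x" "cont w = n" using X by blast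
    then show "butlast (butlast w) @ [last (butlast w) + 1] \<in> canon_lists n"
      using e[of x a] by (auto simp: canon_lists_def cf_lists_def canonical_iff butlast_append)
  qed
qed

text \<open>For \<open>n = 1\<close> the correspondence \<open>twin\<close> breaks down, since the
  empty list has no last entry to split; the noncanonical list is \<open>[1]\<close>, of value
  1.\<close>

lemma noncanon_lists_1: "noncanon_lists 1 = {[1]}" and canon_lists_1: "canon_lists 1 = {[]}"
proof -
  have c: "w = [] \<or> w = [1]" if "w \<in> cf_lists 1" for w
  proof -
    have w: "poslist w" "cont w = 1" using that by (auto simp: cf_lists_def)
    have "2 ^ (length w div 2) \<le> (1::nat)" using cont_ge_power[OF w(1)] w by simp
    moreover have "length w div 2 < 2 ^ (length w div 2)" by simp
    ultimately have "length w div 2 = 0" by linarith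
    then have "length w < 2" by simp
    then consider "w = []" | a where "w = [a]" by (cases w) auto
    then show ?thesis using w by cases auto
  qed
  have "[] \<in> cf_lists 1" "[1] \<in> cf_lists 1" by (auto simp: cf_lists_def)
  then have C: "cf_lists 1 = {[], [1]}" using c by blast
  show "noncanon_lists 1 = {[1]}" "canon_lists 1 = {[]}"
    unfolding noncanon_lists_def canon_lists_def C by (auto simp: canonical_iff)
qed

lemma cont_tl_twin:
  assumes "w \<in> canon_lists n" "n \<ge> 2"
  shows "cont_tl (twin w) = cont_tl w"
proof -
  obtain x a where w: "w = x @ [a]" "a \<ge> 2"
    using assms by (cases w rule: rev_exhaust) (auto simp: canon_lists_def cf_lists_def canonical_iff)
  obtain a' where a': "a = Suc a'" using w(2) by (cases a) auto
  have "cont (y @ [a - 1, 1]) = cont (y @ [a])" for y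
    unfolding a' by (simp add: cont_append algebra_simps)
  then show ?thesis using w by (simp add: twin_snoc cont_tl_snoc_cases)
qed

text \<open>Passing to the other expansion keeps \<open>cont_tl\<close> but replaces
  \<open>cont_bl w / n\<close> by its complement to 1. This is the symmetry exploited by
  \<open>gap_fun_symmetrized_le\<close>.\<close>

lemma cont_bl_twin:
  assumes "w \<in> canon_lists n" "n \<ge> 2"
  shows "cont_bl (twin w) + cont_bl w = n"
proof -
  obtain x a where w: "w = x @ [a]" "a \<ge> 2" "cont w = n"
    using assms by (cases w rule: rev_exhaust) (auto simp: canon_lists_def cf_lists_def canonical_iff)
  obtain a' where a': "a = Suc a'" using w(2) by (cases a) auto
  have "cont_bl (twin w) = cont (x @ [a'])"
    unfolding w(1) twin_snoc using cont_bl_snoc[of "x @ [a - 1]" 1] a' by simp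
  then show ?thesis using w a' by (simp add: cont_snoc)
qed

text \<open>For \<open>n >= 2\<close> this is the same set of residues as for the canonical lists.
  The ranges differ only at \<open>n = 1\<close>, where \<open>[1]\<close> yields 1 and the empty
  list yields 0.\<close>

lemma bij_betw_noncanon_lists:
  assumes "n \<ge> 1"
  shows "bij_betw cont_tl (noncanon_lists n) {r. 0 < r \<and> r \<le> n \<and> coprime r n}"
proof (cases "n = 1")
  case True
  then show ?thesis unfolding True noncanon_lists_1 by (auto simp: bij_betw_def)
next
  case False
  then have n: "n \<ge> 2" using assms by simp
  have "bij_betw (cont_tl \<circ> twin) (canon_lists n) {r. r < n \<and> coprime r n}"
    using bij_betw_canon_lists[OF assms] cont_tl_twin n by (subst bij_betw_cong[of _ _ cont_tl]) auto
  then have "bij_betw cont_tl (noncanon_lists n) {r. r < n \<and> coprime r n}"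
    using bij_betw_comp_iff[OF bij_betw_twin[OF n]] by blast
  moreover have "{r. r < n \<and> coprime r n} = {r. 0 < r \<and> r \<le> n \<and> coprime r n}"
    using n by (auto simp: le_less intro: gr0I)
  ultimately show ?thesis by simp
qed

lemma noncanon_lists_totatives: "{r. 0 < r \<and> r \<le> n \<and> coprime r n} = totatives n"
  by (auto simp: totatives_def)

lemma card_noncanon_lists: "n \<ge> 1 \<Longrightarrow> card (noncanon_lists n) = totient n"
  using bij_betw_same_card[OF bij_betw_noncanon_lists[of n]] by (simp add: noncanon_lists_totatives totient_def)

lemma card_canon_lists: "n \<ge> 1 \<Longrightarrow> card (canon_lists n) = totient n"
proof (cases "n = 1")
  case False
  assume "n \<ge> 1"
  then show ?thesis using bij_betw_same_card[OF bij_betw_twin[of n]] False card_noncanon_lists[of n] by simp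
qed (simp add: canon_lists_1[simplified])

lemma card_cf_lists: "n \<ge> 1 \<Longrightarrow> card (cf_lists n) = 2 * totient n"
  using sum_cf_lists_split[of "\<lambda>_. 1::nat" n] by (simp add: card_noncanon_lists card_canon_lists)

lemma sum_totatives_canon_lists:
  assumes "n \<ge> 2"
  shows "(\<Sum>a\<in>totatives n. g (partial_quotients (real a / real n))) = (\<Sum>w\<in>canon_lists n. g w)"
proof -
  have "bij_betw cont_tl (canon_lists n) (totatives n)"
  proof -
    have "{r. r < n \<and> coprime r n} = totatives n"
      using assms by (auto simp: totatives_def le_less intro: gr0I)
    then show ?thesis using bij_betw_canon_lists[of n] assms by simp
  qed
  then have "(\<Sum>a\<in>totatives n. g (partial_quotients (real a / real n)))
     = (\<Sum>w\<in>canon_lists n. g (partial_quotients (real (cont_tl w) / real n)))"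
    by (rule sum.reindex_bij_betw[symmetric])
  also have "\<dots> = (\<Sum>w\<in>canon_lists n. g w)"
  proof (rule sum.cong)
    fix w assume "w \<in> canon_lists n"
    then have w: "canonical_cfrac w" "poslist w" "cont w = n" by (auto simp: canon_lists_def cf_lists_def)
    then have "partial_quotients (real (cont_tl w) / real n) = w"
      by (intro partial_quotients_eqI) (auto simp: cfrac_value_eq)
    then show "g (partial_quotients (real (cont_tl w) / real n)) = g w" by simp
  qed auto
  finally show ?thesis .
qed

section \<open>Moebius inversion and estimates of Mertens type\<close>

definition moebius :: "nat \<Rightarrow> real" where
  "moebius n = (if squarefree n then (-1) ^ card (prime_factors n) else 0)"

lemma abs_moebius: "\<bar>moebius n\<bar> = (if squarefree n then 1 else 0)"
  by (simp add: moebius_def power_abs)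

lemma abs_moebius_le: "\<bar>moebius n\<bar> \<le> 1"
  by (simp add: abs_moebius)

lemma prime_factors_prod_primes:
  assumes "finite P" "\<And>p. p \<in> P \<Longrightarrow> prime (p::nat)"
  shows "prime_factors (\<Prod>P) = P"
  using assms
proof (induction P)
  case (insert p P)
  have "0 \<notin> P" using insert.prems[of 0] by auto
  then have "\<Prod>P \<noteq> 0" using insert by simp
  moreover have "p \<noteq> 0" using insert.prems[of p] by auto
  ultimately show ?case using insert by (simp add: prime_factors_product prime_prime_factors)
qed auto

lemma squarefree_prod_primes:
  assumes "finite P" "\<And>p. p \<in> P \<Longrightarrow> prime (p::nat)"
  shows "squarefree (\<Prod>P)"
  using assms by (intro squarefree_prod_coprime) (auto intro: primes_coprime squarefree_prime)

lemma prod_prime_factors_squarefree: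
  assumes "squarefree (n::nat)"
  shows "\<Prod>(prime_factors n) = n"
proof -
  have n: "n \<noteq> 0" using assms not_squarefree_0 by metis
  have "multiplicity p n = 1" if "p \<in> prime_factors n" for p
    using assms that n by (subst (asm) squarefree_factorial_semiring') auto
  then have "(\<Prod>p\<in>prime_factors n. p ^ multiplicity p n) = \<Prod>(prime_factors n)"
    by (intro prod.cong) auto
  then show ?thesis using prime_factorization_nat[of n] n by simp
qed

lemma bij_betw_squarefree_divisors:
  assumes "n > 0"
  shows "bij_betw (\<lambda>P. \<Prod>P) (Pow (prime_factors n)) {d. d dvd n \<and> squarefree (d::nat)}"
proof (rule bij_betw_byWitness[where f' = prime_factors])
  have fin: "finite P \<and> (\<forall>p\<in>P. prime p)" if "P \<subseteq> prime_factors n" for P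
    using that by (auto intro: finite_subset)
  show "\<forall>P\<in>Pow (prime_factors n). prime_factors (\<Prod>P) = P"
    using fin by (auto intro!: prime_factors_prod_primes)
  show "\<forall>d\<in>{d. d dvd n \<and> squarefree d}. \<Prod>(prime_factors d) = d"
    by (auto intro!: prod_prime_factors_squarefree)
  show "Prod ` Pow (prime_factors n) \<subseteq> {d. d dvd n \<and> squarefree d}"
  proof safe
    fix P assume P: "P \<subseteq> prime_factors n"
    have "\<Prod>P dvd \<Prod>(prime_factors n)" using P by (intro prod_dvd_prod_subset) auto
    also have "\<dots> dvd (\<Prod>p\<in>prime_factors n. p ^ multiplicity p n)"
      by (intro prod_dvd_prod dvd_power) (auto simp: prime_factors_multiplicity)
    also have "\<dots> = n" using prime_factorization_nat[of n] assms by simp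
    finally show "\<Prod>P dvd n" .
    show "squarefree (\<Prod>P)" using fin[OF P] by (intro squarefree_prod_primes) auto
  qed
  show "prime_factors ` {d. d dvd n \<and> squarefree d} \<subseteq> Pow (prime_factors n)"
    using assms by (auto dest: dvd_prime_factors[of n] intro: dvd_trans simp: in_prime_factors_iff)
qed

lemma sum_squarefree_divisors:
  fixes g :: "nat \<Rightarrow> real"
  assumes "n > 0"
  shows "(\<Sum>d | d dvd n \<and> squarefree d. \<Prod>p\<in>prime_factors d. g p) = (\<Prod>p\<in>prime_factors n. 1 + g p)"
proof -
  have "(\<Sum>d | d dvd n \<and> squarefree d. \<Prod>p\<in>prime_factors d. g p)
      = (\<Sum>P\<in>Pow (prime_factors n). \<Prod>p\<in>prime_factors (\<Prod>P). g p)"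
    by (rule sum.reindex_bij_betw[OF bij_betw_squarefree_divisors[OF assms], symmetric])
  also have "\<dots> = (\<Sum>P\<in>Pow (prime_factors n). prod g P * prod (\<lambda>_. 1) (prime_factors n - P))"
    by (intro sum.cong refl) (subst prime_factors_prod_primes, auto intro: finite_subset)
  also have "\<dots> = (\<Prod>p\<in>prime_factors n. g p + 1)" by (rule prod_add[symmetric]) auto
  finally show ?thesis by (simp add: add.commute)
qed

lemma sum_moebius_prod:
  fixes g :: "nat \<Rightarrow> real"
  assumes "n > 0"
  shows "(\<Sum>d | d dvd n. moebius d * (\<Prod>p\<in>prime_factors d. g p)) = (\<Prod>p\<in>prime_factors n. 1 - g p)"
proof -
  have "(\<Sum>d | d dvd n. moebius d * (\<Prod>p\<in>prime_factors d. g p))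
      = (\<Sum>d | d dvd n \<and> squarefree d. \<Prod>p\<in>prime_factors d. - g p)"
    using assms by (intro sum.mono_neutral_cong_right)
      (auto simp: moebius_def prod.distrib[symmetric] prod_uminus)
  then show ?thesis using sum_squarefree_divisors[OF assms, of "\<lambda>p. - g p"] by simp
qed

lemma sum_moebius_divisors:
  assumes "n > 0"
  shows "(\<Sum>d | d dvd n. moebius d) = (if n = 1 then 1 else 0)"
proof -
  have "(\<Sum>d | d dvd n. moebius d) = (\<Prod>p\<in>prime_factors n. 0)"
    using sum_moebius_prod[OF assms, of "\<lambda>_. 1"] by simp
  also have "\<dots> = (if n = 1 then 1 else 0)"
  proof (cases "n = 1")
    case False
    then have "prime_factors n \<noteq> {}" using assms by (simp add: prime_factorization_empty_iff)
    then have "card (prime_factors n) > 0" by (simp add: card_gt_0_iff)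
    then show ?thesis using False by simp
  qed auto
  finally show ?thesis .
qed

lemma prod_real_prime_factors:
  assumes "squarefree (d::nat)"
  shows "(\<Prod>p\<in>prime_factors d. real p) = real d"
  using arg_cong[OF prod_prime_factors_squarefree[OF assms], of real] by (simp only: of_nat_prod)

lemma totient_moebius:
  assumes "n > 0"
  shows "real (totient n) = (\<Sum>d | d dvd n. moebius d * (real n / real d))"
proof -
  have "(\<Sum>d | d dvd n. moebius d * (real n / real d))
      = real n * (\<Sum>d | d dvd n. moebius d * (\<Prod>p\<in>prime_factors d. 1 / real p))"
    unfolding sum_distrib_left
    by (intro sum.cong refl) (auto simp: moebius_def prod_dividef prod_real_prime_factors)
  also have "\<dots> = real n * (\<Prod>p\<in>prime_factors n. 1 - 1 / real p)"
    by (subst sum_moebius_prod[OF assms]) simp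
  finally show ?thesis by (simp add: totient_formula2)
qed

lemma card_prime_factors_le:
  assumes "n > 0"
  shows "2 ^ card (prime_factors n) \<le> (n::nat)"
proof -
  have "(\<Prod>p\<in>prime_factors n. 2) \<le> (\<Prod>p\<in>prime_factors n. p ^ multiplicity p n)"
  proof (intro prod_mono)
    fix p assume p: "p \<in> prime_factors n"
    then have "2 \<le> p" "multiplicity p n \<ge> 1"
      by (auto simp: prime_factors_multiplicity prime_ge_2_nat in_prime_factors_iff Suc_le_eq)
    then show "0 \<le> (2::nat) \<and> 2 \<le> p ^ multiplicity p n"
      using self_le_power[of p "multiplicity p n"] by auto
  qed
  then show ?thesis using prime_factorization_nat[of n] assms by simp
qed

text \<open>The substitution \<open>n = d * k\<close>, by which the summatory function of a
  Dirichlet convolution is computed one factor at a time.\<close>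

lemma sum_divisors_swap:
  fixes g :: "nat \<Rightarrow> nat \<Rightarrow> real"
  shows "(\<Sum>n=1..Q. \<Sum>d | d dvd n. g d (n div d)) = (\<Sum>d=1..Q. \<Sum>k=1..Q div d. g d k)"
proof -
  have fin: "finite {d. d dvd n}" if "n \<in> {1..Q}" for n using that by auto
  have "(\<Sum>n=1..Q. \<Sum>d | d dvd n. g d (n div d))
      = (\<Sum>(n,d)\<in>(SIGMA n:{1..Q}. {d. d dvd n}). g d (n div d))"
    using fin by (subst sum.Sigma) auto
  also have "\<dots> = (\<Sum>(d,k)\<in>(SIGMA d:{1..Q}. {1..Q div d}). g d k)"
  proof (rule sum.reindex_bij_witness[where i = "\<lambda>(d,k). (d * k, d)" and j = "\<lambda>(n,d). (d, n div d)"])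
    fix x assume "x \<in> (SIGMA d:{1..Q}. {1..Q div d})"
    then obtain d k where x: "x = (d,k)" "1 \<le> d" "d \<le> Q" "1 \<le> k" "k \<le> Q div d" by auto
    have "d * k \<le> Q" using x(2,5) by (simp add: less_eq_div_iff_mult_less_eq mult.commute)
    moreover have "1 \<le> d * k" using x by simp
    ultimately show "(case x of (d, k) \<Rightarrow> (d * k, d)) \<in> (SIGMA n:{1..Q}. {d. d dvd n})" using x by auto
  next
    fix x assume "x \<in> (SIGMA n:{1..Q}. {d. d dvd n})"
    then obtain n d where x: "x = (n,d)" "1 \<le> n" "n \<le> Q" "d dvd n" by auto
    then have "1 \<le> d" "d \<le> n" by (auto intro: dvd_imp_le simp: Suc_le_eq dvd_pos_nat)
    moreover have "1 \<le> n div d" using x calculation by (simp add: Suc_le_eq div_greater_zero_iff)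
    ultimately show "(case x of (n, d) \<Rightarrow> (d, n div d)) \<in> (SIGMA d:{1..Q}. {1..Q div d})"
      using x by (auto intro: div_le_mono)
  qed auto
  also have "\<dots> = (\<Sum>d=1..Q. \<Sum>k=1..Q div d. g d k)" by (subst sum.Sigma) auto
  finally show ?thesis .
qed

section \<open>Products over primes, the order of the totient function, and Rankin's trick\<close>

lemma powr_minus_diff_ge:
  fixes t x :: real
  assumes "t > 0" "x > 0"
  shows "(x + 1) powr (-1 - t) \<le> (x powr (-t) - (x + 1) powr (-t)) / t"
proof -
  have l: "ln x + 1 / (x + 1) \<le> ln (x + 1)"
  proof -
    have "ln (x / (x + 1)) \<le> x / (x + 1) - 1" using assms by (intro ln_le_minus_one) auto
    also have "\<dots> = - (1 / (x + 1))" using assms by (simp add: field_simps)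
    finally show ?thesis using assms by (simp add: ln_div)
  qed
  have "1 + t / (x + 1) \<le> exp (t / (x + 1))" by (rule exp_ge_add_one_self)
  also have "\<dots> \<le> exp (t * (ln (x + 1) - ln x))"
    using mult_left_mono[of "1 / (x + 1)" "ln (x + 1) - ln x" t] l assms by simp
  also have "\<dots> = x powr (-t) / (x + 1) powr (-t)"
    using assms by (simp add: powr_def exp_diff[symmetric] algebra_simps)
  finally have "(1 + t / (x + 1)) * (x + 1) powr (-t) \<le> x powr (-t)"
    using assms by (simp add: pos_le_divide_eq)
  moreover have "(x + 1) powr (-1 - t) = (x + 1) powr (-t) / (x + 1)"
    using assms powr_add[of "x + 1" "-1" "-t"] by (simp add: powr_minus field_simps)
  ultimately have "t * (x + 1) powr (-1 - t) \<le> x powr (-t) - (x + 1) powr (-t)"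
    by (simp add: ring_distribs)
  then show ?thesis using assms by (simp add: pos_le_divide_eq mult.commute)
qed

text \<open>Comparison with an integral: the bound of \<open>powr_minus_diff_ge\<close> is the
  integral of the power over one unit interval, and these bounds telescope.\<close>

lemma sum_powr_minus_le:
  fixes t :: real
  assumes "t > 0"
  shows "(\<Sum>m=1..M. real m powr (-1 - t)) \<le> 1 + 1 / t"
proof -
  have "(\<Sum>m=1..M. real m powr (-1 - t)) \<le> 1 + (1 - real M powr (-t)) / t" if "M \<ge> 1" for M
    using that
  proof (induction M rule: dec_induct)
    case (step M)
    then show ?case using powr_minus_diff_ge[OF assms, of "real M"] assms
      by (simp add: diff_divide_distrib add.commute)
  qed auto
  moreover have "(1 - real M powr (-t)) / t \<le> 1 / t" using assms by (intro divide_right_mono) auto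
  ultimately show ?thesis using assms by (cases "M \<ge> 1") (fastforce, auto)
qed

text \<open>A weak form of Legendre's formula: every block of \<open>p\<close> consecutive factors
  of the factorial contributes at least one \<open>p\<close>.\<close>

lemma prime_power_div_dvd_fact:
  assumes "prime (p::nat)"
  shows "p ^ (n div p) dvd fact n"
proof -
  have "p ^ k dvd (fact (k * p) :: nat)" for k
  proof (induction k)
    case (Suc k)
    have "p dvd (fact p :: nat)" using assms by (simp add: prime_dvd_fact_iff prime_gt_0_nat)
    then have "p * p ^ k dvd fact p * (fact (k * p) :: nat)" using Suc by (rule mult_dvd_mono)
    also have "\<dots> dvd fact (p + k * p)" by (rule fact_fact_dvd_fact)
    finally show ?case by simp
  qed auto
  moreover have "fact (n div p * p) dvd (fact n :: nat)" by (rule fact_dvd) simp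
  ultimately show ?thesis by (blast intro: dvd_trans)
qed

lemma prod_dvd_pairwise_coprime:
  fixes f :: "'a \<Rightarrow> nat"
  assumes "finite A" "\<And>x. x \<in> A \<Longrightarrow> f x dvd n"
    "\<And>x y. x \<in> A \<Longrightarrow> y \<in> A \<Longrightarrow> x \<noteq> y \<Longrightarrow> coprime (f x) (f y)"
  shows "prod f A dvd n"
  using assms
proof (induction A)
  case (insert x A)
  have "coprime (f x) (prod f A)" by (rule prod_coprime_right) (use insert in auto)
  moreover have "f x dvd n" "prod f A dvd n" using insert by auto
  ultimately show ?case using insert by (simp add: divides_mult)
qed auto

text \<open>Chebyshev's argument: the product of the powers \<open>p ^ (n div p)\<close> divides
  \<open>fact n\<close>, which is at most \<open>n ^ n\<close>. The factor 2 comes from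
  \<open>n div p >= n / (2 * p)\<close> for \<open>p <= n\<close>.\<close>

lemma sum_ln_prime_over_prime:
  assumes "n \<ge> 1"
  shows "(\<Sum>p | prime p \<and> p \<le> n. ln (real p) / real p) \<le> 2 * ln (real n)"
proof -
  let ?P = "{p::nat. prime p \<and> p \<le> n}"
  have fin: "finite ?P" by (rule finite_subset[of _ "{..n}"]) auto
  have "(\<Prod>p\<in>?P. p ^ (n div p)) dvd (fact n :: nat)"
    by (rule prod_dvd_pairwise_coprime[OF fin]) (auto simp: prime_power_div_dvd_fact intro: primes_coprime)
  then have "(\<Prod>p\<in>?P. p ^ (n div p)) \<le> (fact n :: nat)" by (rule dvd_imp_le) simp
  also have "\<dots> \<le> n ^ n" using fact_le_power[of n, where ?'a = nat] by simp
  finally have "real (\<Prod>p\<in>?P. p ^ (n div p)) \<le> real (n ^ n)" by (rule of_nat_mono)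
  then have le: "(\<Prod>p\<in>?P. real p ^ (n div p)) \<le> real n ^ n" by simp
  have pos: "real p ^ (n div p) > 0" if "p \<in> ?P" for p using that by (auto simp: prime_gt_0_nat)
  have "(\<Sum>p\<in>?P. real (n div p) * ln (real p)) = ln (\<Prod>p\<in>?P. real p ^ (n div p))"
    using pos by (subst ln_prod[OF fin]) (auto simp: ln_realpow prime_gt_0_nat)
  also have "\<dots> \<le> ln (real n ^ n)" using le pos assms by (subst ln_le_cancel_iff) (auto intro!: prod_pos)
  also have "\<dots> = real n * ln (real n)" using assms by (simp add: ln_realpow)
  finally have A: "(\<Sum>p\<in>?P. real (n div p) * ln (real p)) \<le> real n * ln (real n)" .
  have "real n / 2 * (\<Sum>p\<in>?P. ln (real p) / real p) \<le> (\<Sum>p\<in>?P. real (n div p) * ln (real p))"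
    unfolding sum_distrib_left
  proof (rule sum_mono)
    fix p assume p: "p \<in> ?P"
    then have p1: "p \<ge> 1" "p \<le> n" using prime_gt_0_nat[of p] by auto
    have "n < (n div p + 1) * p" using p1 by (simp add: dividend_less_div_times)
    also have "\<dots> \<le> (2 * (n div p)) * p" using p1 by (intro mult_le_mono1) (simp add: div_greater_zero_iff Suc_le_eq mult_2)
    finally have "real n \<le> real (2 * (n div p) * p)" by linarith
    then have "real n / (2 * real p) \<le> real (n div p)" using p1 by (simp add: field_simps)
    then have "real n / (2 * real p) * ln (real p) \<le> real (n div p) * ln (real p)"
      using p1 by (intro mult_right_mono) auto
    then show "real n / 2 * (ln (real p) / real p) \<le> real (n div p) * ln (real p)"
      by (simp add: field_simps)
  qed
  with A have "real n * (\<Sum>p\<in>?P. ln (real p) / real p) \<le> real n * (2 * ln (real n))" by simp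
  then show ?thesis using assms by (subst (asm) mult_le_cancel_left_pos) auto
qed

text \<open>Expanding the product gives one term for each subset of \<open>P\<close>. The products
  of these subsets are distinct integers, so the terms form part of the sum bounded in
  \<open>sum_powr_minus_le\<close>.\<close>

lemma prod_primes_powr_le:
  assumes "t > 0" "finite P" "\<And>p. p \<in> P \<Longrightarrow> prime (p::nat)"
  shows "(\<Prod>p\<in>P. 1 + real p powr (-1 - t)) \<le> 1 + 1 / t"
proof -
  have fin: "finite X \<and> (\<forall>p\<in>X. prime p)" if "X \<in> Pow P" for X
    using assms(2,3) that finite_subset by blast
  have "(\<Prod>p\<in>P. real p powr (-1 - t) + 1)
      = (\<Sum>X\<in>Pow P. (\<Prod>p\<in>X. real p powr (-1 - t)) * (\<Prod>p\<in>P - X. 1))"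
    using assms(2) by (rule prod_add)
  also have "\<dots> = (\<Sum>X\<in>Pow P. real (\<Prod>X) powr (-1 - t))"
    by (intro sum.cong refl) (simp add: prod_powr_distrib)
  also have "\<dots> = (\<Sum>m\<in>Prod ` Pow P. real m powr (-1 - t))"
  proof (subst sum.reindex)
    show "inj_on Prod (Pow P)"
      by (rule inj_on_inverseI[where g = prime_factors]) (use fin in \<open>auto intro!: prime_factors_prod_primes\<close>)
  qed simp
  also have "\<dots> \<le> (\<Sum>m=1..\<Prod>P. real m powr (-1 - t))"
  proof (rule sum_mono2)
    show "Prod ` Pow P \<subseteq> {1..\<Prod>P}"
    proof safe
      fix X assume X: "X \<subseteq> P"
      have pos: "\<Prod>P > 0" "\<Prod>X > 0"
        using assms(3) X by (auto intro!: prod_pos simp: prime_gt_0_nat subset_eq)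
      have "\<Prod>X dvd \<Prod>P" using assms(2) X by (intro prod_dvd_prod_subset) auto
      then show "\<Prod>X \<in> {1..\<Prod>P}" using pos by (auto intro: dvd_imp_le simp: Suc_le_eq)
    qed
  qed auto
  also have "\<dots> \<le> 1 + 1 / t" using assms(1) by (rule sum_powr_minus_le)
  finally show ?thesis by (simp add: add.commute)
qed

text \<open>The product with exponent \<open>1 + 1 / ln n\<close> is at most the zeta function there; the change of exponent costs only
  a constant factor because the sum of \<open>ln p / p\<close> over \<open>p \<le> n\<close> is \<open>O(ln n)\<close>.\<close>

lemma mertens_prod_le:
  assumes "n \<ge> 2"
  shows "(\<Prod>p | prime p \<and> p \<le> n. 1 + 1 / real p) \<le> exp 2 * (1 + ln (real n))"
proof -
  let ?P = "{p::nat. prime p \<and> p \<le> n}"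
  have fin: "finite ?P" by (rule finite_subset[of _ "{..n}"]) auto
  define t where "t = 1 / ln (real n)"
  have t: "t > 0" using assms by (simp add: t_def)
  have "(\<Prod>p\<in>?P. 1 + 1 / real p) \<le> (\<Prod>p\<in>?P. (1 + real p powr (-1 - t)) * exp (t * (ln (real p) / real p)))"
  proof (intro prod_mono conjI)
    fix p assume p: "p \<in> ?P"
    then have p0: "real p > 0" by (simp add: prime_gt_0_nat)
    have e: "real p powr (-1 - t) = exp (- (t * ln (real p))) / real p"
      using p0 by (simp add: powr_def exp_diff exp_minus field_simps)
    have "1 - t * ln (real p) \<le> exp (- (t * ln (real p)))"
      using exp_ge_add_one_self[of "- (t * ln (real p))"] by simp
    then have d: "1 / real p - t * (ln (real p) / real p) \<le> real p powr (-1 - t)"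
      unfolding e using p0 divide_right_mono[of "1 - t * ln (real p)" _ "real p"]
      by (simp add: diff_divide_distrib)
    have "real p \<ge> 1" using p prime_ge_1_nat by auto
    then have d0: "t * (ln (real p) / real p) \<ge> 0" using t by simp
    define x where "x = t * (ln (real p) / real p)"
    define y where "y = real p powr (-1 - t)"
    have "1 + 1 / real p \<le> 1 + y + x" using d by (simp add: x_def y_def)
    also have "\<dots> \<le> (1 + y) * (1 + x)"
    proof -
      have "0 \<le> y * x" by (intro mult_nonneg_nonneg) (use d0 in \<open>auto simp: x_def y_def\<close>)
      then show ?thesis by (simp add: algebra_simps)
    qed
    also have "\<dots> \<le> (1 + y) * exp x"
      by (intro mult_left_mono) (auto simp: y_def)
    finally show "1 + 1 / real p \<le> (1 + real p powr (-1 - t)) * exp (t * (ln (real p) / real p))"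
      by (simp add: x_def y_def)
  qed auto
  also have "\<dots> = (\<Prod>p\<in>?P. 1 + real p powr (-1 - t)) * exp (t * (\<Sum>p\<in>?P. ln (real p) / real p))"
    using fin by (simp add: prod.distrib exp_sum sum_distrib_left)
  also have "\<dots> \<le> (1 + 1 / t) * exp 2"
  proof (intro mult_mono)
    show "(\<Prod>p\<in>?P. 1 + real p powr (-1 - t)) \<le> 1 + 1 / t"
      using t fin by (intro prod_primes_powr_le) auto
    have "t * (\<Sum>p\<in>?P. ln (real p) / real p) \<le> t * (2 * ln (real n))"
      using t assms by (intro mult_left_mono sum_ln_prime_over_prime) auto
    also have "\<dots> = 2" using assms by (simp add: t_def)
    finally show "exp (t * (\<Sum>p\<in>?P. ln (real p) / real p)) \<le> exp 2" by simp
  qed (use t in auto)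
  finally show ?thesis by (simp add: t_def mult.commute)
qed

text \<open>\<open>N\<close> has at most \<open>2 * ln N\<close> prime factors, because
  \<open>2 ^ card (prime_factors N) <= N\<close> and \<open>ln 2 >= 1/2\<close>. Factors of size
  \<open>1 + c / ln N\<close> therefore multiply to a bounded number.\<close>

lemma prod_large_prime_factors_le:
  assumes N: "N \<ge> 3" and c: "c \<ge> 0"
  shows "(\<Prod>p\<in>{p\<in>prime_factors N. real p > ln (real N)}. 1 + c / ln (real N)) \<le> exp (2 * c)"
proof -
  let ?B = "{p\<in>prime_factors N. real p > ln (real N)}"
  have l: "ln (real N) > 0" using N by simp
  have "card ?B \<le> card (prime_factors N)" by (intro card_mono) auto
  then have "2 ^ card ?B \<le> (2::nat) ^ card (prime_factors N)" by (intro power_increasing) auto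
  also have "\<dots> \<le> N" using N by (intro card_prime_factors_le) auto
  finally have "real (2 ^ card ?B) \<le> real N" by (rule of_nat_mono)
  then have "ln (2 ^ card ?B) \<le> ln (real N)" by (subst ln_le_cancel_iff) (use N in auto)
  then have k: "real (card ?B) * ln 2 \<le> ln (real N)" by (simp add: ln_realpow)
  have "ln (2::real) \<ge> 1 / 2" using ln_2_less_1 ln_ge_iff[of 2 "1/2"] exp_bound_half[of "1/2::real"] by simp
  then have "real (card ?B) * (1 / 2) \<le> real (card ?B) * ln 2" by (intro mult_left_mono) auto
  with k have k2: "real (card ?B) \<le> 2 * ln (real N)" by linarith
  have "(\<Prod>p\<in>?B. 1 + c / ln (real N)) \<le> (\<Prod>p\<in>?B. exp (c / ln (real N)))"
    using l c by (intro prod_mono) auto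
  also have "\<dots> = exp (real (card ?B) * (c / ln (real N)))" by (simp only: exp_of_nat_mult prod_constant)
  also have "\<dots> \<le> exp (2 * ln (real N) * (c / ln (real N)))"
    using k2 l c by (subst exp_le_cancel_iff, intro mult_right_mono) auto
  also have "\<dots> = exp (2 * c)" using l by simp
  finally show ?thesis .
qed

lemma prod_prime_factors_split:
  fixes f :: "nat \<Rightarrow> real"
  shows "(\<Prod>p\<in>prime_factors N. f p) = (\<Prod>p\<in>{p\<in>prime_factors N. real p \<le> y}. f p) *
    (\<Prod>p\<in>{p\<in>prime_factors N. real p > y}. f p)"
proof -
  have "prime_factors N = {p\<in>prime_factors N. real p \<le> y} \<union> {p\<in>prime_factors N. real p > y}" by auto
  then show ?thesis by (subst (1) \<open>prime_factors N = _\<close>, intro prod.union_disjoint) auto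
qed

lemma prod_small_prime_factors_le:
  assumes N: "ln (ln (real N)) \<ge> 1" and N3: "N \<ge> 3"
  shows "(\<Prod>p\<in>{p\<in>prime_factors N. real p \<le> ln (real N)}. 1 + 1 / real p) \<le> 2 * exp 2 * ln (ln (real N))"
proof -
  have l0: "ln (real N) > 0" using N3 by simp
  have "exp 1 \<le> ln (real N)" using N l0 by (simp add: ln_ge_iff)
  then have l: "ln (real N) \<ge> 2" using exp_ge_add_one_self[of 1] by simp
  define n where "n = nat \<lfloor>ln (real N)\<rfloor>"
  have n: "n \<ge> 2" "real n \<le> ln (real N)" using l by (auto simp: n_def le_nat_floor)
  have "(\<Prod>p\<in>{p\<in>prime_factors N. real p \<le> ln (real N)}. 1 + 1 / real p)
      \<le> (\<Prod>p | prime p \<and> p \<le> n. 1 + 1 / real p)"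
  proof (rule prod_mono2)
    show "finite {p. prime p \<and> p \<le> n}" by (rule finite_subset[of _ "{..n}"]) auto
    show "{p \<in> prime_factors N. real p \<le> ln (real N)} \<subseteq> {p. prime p \<and> p \<le> n}"
      by (auto simp: n_def le_nat_floor)
  qed auto
  also have "\<dots> \<le> exp 2 * (1 + ln (real n))" using n(1) by (rule mertens_prod_le)
  also have "ln (real n) \<le> ln (ln (real N))" using n by (subst ln_le_cancel_iff) (use l0 in auto)
  also have "1 + ln (ln (real N)) \<le> 2 * ln (ln (real N))" using N by simp
  finally show ?thesis by (simp add: algebra_simps)
qed

text \<open>Over all integers from 2 to \<open>M\<close> the product telescopes to
  \<open>(M + 1) / (2 * M)\<close>, and leaving out factors below 1 only increases it.\<close>

lemma prod_one_minus_inverse_squares: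
  assumes "finite P" "\<And>p. p \<in> P \<Longrightarrow> p \<ge> (2::nat)"
  shows "(\<Prod>p\<in>P. 1 - 1 / real p ^ 2) \<ge> 1 / 2"
proof -
  obtain M where M: "M \<ge> 1" "P \<subseteq> {2..M}"
  proof
    show "Max (insert 1 P) \<ge> 1" using assms by auto
    show "P \<subseteq> {2..Max (insert 1 P)}" using assms by auto
  qed
  have eq: "(\<Prod>p=2..M. 1 - 1 / real p ^ 2) = (real M + 1) / (2 * real M)"
    using M(1)
  proof (induction M rule: dec_induct)
    case (step M)
    have "{2..Suc M} = insert (Suc M) {2..M}" using step by auto
    then have "(\<Prod>p=2..Suc M. 1 - 1 / real p ^ 2) = (1 - 1 / (real M + 1) ^ 2) * ((real M + 1) / (2 * real M))"
      using step by (simp add: add.commute)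
    also have "\<dots> = (real (Suc M) + 1) / (2 * real (Suc M))"
    proof -
      have "(1 - 1 / (real M + 1) ^ 2) = real M * (real M + 2) / (real M + 1) ^ 2"
        by (simp add: divide_simps) (simp add: power2_eq_square algebra_simps)
      then show ?thesis using step by (simp add: divide_simps) (simp add: power2_eq_square algebra_simps)
    qed
    finally show ?case .
  qed auto
  have f: "0 \<le> 1 - 1 / real p ^ 2" "1 - 1 / real p ^ 2 \<le> 1" if "p \<ge> 2" for p
  proof -
    have "1 \<le> real p ^ 2" using that by (intro one_le_power) auto
    then have "1 / real p ^ 2 \<le> 1 / 1" using that by (intro divide_left_mono) auto
    then show "0 \<le> 1 - 1 / real p ^ 2" "1 - 1 / real p ^ 2 \<le> 1" by auto
  qed
  have "(\<Prod>p=2..M. 1 - 1 / real p ^ 2) = (\<Prod>p\<in>{2..M} - P. 1 - 1 / real p ^ 2) * (\<Prod>p\<in>P. 1 - 1 / real p ^ 2)"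
    using M(2) by (rule prod.subset_diff) auto
  also have "\<dots> \<le> 1 * (\<Prod>p\<in>P. 1 - 1 / real p ^ 2)"
  proof (rule mult_right_mono)
    show "(\<Prod>p\<in>{2..M} - P. 1 - 1 / real p ^ 2) \<le> 1" by (rule prod_le_1) (use f in force)
    show "(\<Prod>p\<in>P. 1 - 1 / real p ^ 2) \<ge> 0" using f assms(2) by (intro prod_nonneg) blast
  qed
  finally have "(real M + 1) / (2 * real M) \<le> (\<Prod>p\<in>P. 1 - 1 / real p ^ 2)" using eq by simp
  moreover have "1 / 2 \<le> (real M + 1) / (2 * real M)" using M(1) by (simp add: field_simps)
  ultimately show ?thesis by linarith
qed

lemma prod_prime_factors_one_plus_le:
  assumes N: "ln (ln (real N)) \<ge> 1" "N \<ge> 3"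
  shows "(\<Prod>p\<in>prime_factors N. 1 + 1 / real p) \<le> 2 * exp 4 * ln (ln (real N))"
proof -
  have l: "ln (real N) > 0" using N by simp
  have "ln (ln (real N)) > 0" using N by linarith
  then have l1: "ln (real N) > 1" using l by (simp only: ln_gt_zero_iff)
  have "(\<Prod>p\<in>{p\<in>prime_factors N. real p > ln (real N)}. 1 + 1 / real p)
      \<le> (\<Prod>p\<in>{p\<in>prime_factors N. real p > ln (real N)}. 1 + 1 / ln (real N))"
    using l by (intro prod_mono) (auto intro!: divide_left_mono mult_pos_pos)
  also have "\<dots> \<le> exp 2" using prod_large_prime_factors_le[of N 1] N by simp
  finally have large: "(\<Prod>p\<in>{p\<in>prime_factors N. real p > ln (real N)}. 1 + 1 / real p) \<le> exp 2" .
  have "(\<Prod>p\<in>prime_factors N. 1 + 1 / real p) \<le> (2 * exp 2 * ln (ln (real N))) * exp 2"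
    unfolding prod_prime_factors_split[of _ N "ln (real N)"]
    using N l1 by (intro mult_mono large prod_small_prime_factors_le prod_nonneg mult_nonneg_nonneg) auto
  also have "\<dots> = 2 * (exp 2 * exp 2) * ln (ln (real N))" by simp
  also have "exp 2 * exp 2 = exp (4::real)" by (simp add: exp_add[symmetric])
  finally show ?thesis by simp
qed

text \<open>The factors of \<open>totient N / N\<close> satisfy (1 - 1/p) (1 + 1/p) = 1 - 1/p^2, and
  the product of the right sides is at least 1/2. An upper bound for the product of 1 + 1/p,
  available from Mertens' estimate, thus becomes a lower bound for the totient.\<close>

lemma totient_lower_bound:
  assumes N: "ln (ln (real N)) \<ge> 1" "N \<ge> 3"
  shows "real N \<le> 4 * exp 4 * ln (ln (real N)) * real (totient N)"
proof -
  let ?P = "prime_factors N"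
  have p2: "p \<ge> 2" if "p \<in> ?P" for p using that by (auto simp: prime_ge_2_nat in_prime_factors_iff)
  have "(\<Prod>p\<in>?P. 1 - 1 / real p ^ 2) = (\<Prod>p\<in>?P. (1 - 1 / real p) * (1 + 1 / real p))"
    by (intro prod.cong refl) (simp add: algebra_simps power2_eq_square)
  then have "1 / 2 \<le> (\<Prod>p\<in>?P. 1 - 1 / real p) * (\<Prod>p\<in>?P. 1 + 1 / real p)"
    using prod_one_minus_inverse_squares[of ?P] p2 by (simp add: prod.distrib)
  also have "\<dots> \<le> (\<Prod>p\<in>?P. 1 - 1 / real p) * (2 * exp 4 * ln (ln (real N)))"
  proof (intro mult_left_mono prod_nonneg prod_prime_factors_one_plus_le N)
    fix p assume "p \<in> ?P"
    then show "0 \<le> 1 - 1 / real p" using p2[of p] by simp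
  qed
  finally have "real N * (1 / 2) \<le> real N * ((\<Prod>p\<in>?P. 1 - 1 / real p) * (2 * exp 4 * ln (ln (real N))))"
    by (intro mult_left_mono) auto
  then show ?thesis unfolding totient_formula2[of N] by (simp add: field_simps)
qed

text \<open>Each term is multiplied by \<open>(d / D) powr s >= 1\<close> with
  \<open>s = 1 / l\<close>, after which the sum over all divisors is an Euler product. This
  \<open>s\<close> keeps \<open>p powr s\<close> below \<open>exp 1\<close> for
  \<open>p <= ln N\<close>, so a small prime contributes at most
  \<open>1 + 3 / p <= (1 + 1 / p) ^ 3\<close>, whence \<open>l ^ 3\<close>; the large primes
  contribute a bounded factor. The constant \<open>8 * exp 18\<close> is
  \<open>(2 * exp 2) ^ 3 * exp 6 ^ 2\<close>.\<close>

lemma rankin_tail: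
  assumes N: "ln (ln (real N)) \<ge> 1" "N \<ge> 3" and D: "D > 0"
  shows "(\<Sum>d | d dvd N \<and> real d > D. \<bar>moebius d\<bar> / real d)
    \<le> 8 * exp 18 * ln (ln (real N)) ^ 3 * D powr (- 1 / ln (ln (real N)))"
proof -
  define l where "l = ln (ln (real N))"
  define s where "s = 1 / l"
  have l: "l \<ge> 1" "ln (real N) > 0" using N by (auto simp: l_def)
  have s: "0 < s" "s \<le> 1" using l by (auto simp: s_def)
  have eN: "exp l = ln (real N)" using l by (simp add: l_def)
  have e3: "exp 1 \<le> (3::real)" using exp_le by simp
  have fin: "finite {d. d dvd N}" using N by auto
  have dpos: "d > 0" if "d dvd N" for d using that N by (auto intro!: Nat.gr0I)
  have "(\<Sum>d | d dvd N \<and> real d > D. \<bar>moebius d\<bar> / real d)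
      \<le> (\<Sum>d | d dvd N \<and> real d > D. D powr (-s) * (\<bar>moebius d\<bar> * real d powr (s - 1)))"
  proof (rule sum_mono)
    fix d assume d: "d \<in> {d. d dvd N \<and> real d > D}"
    have d0: "real d > 0" using d D by auto
    have "1 \<le> (real d / D) powr s" using d D s by (intro ge_one_powr_ge_zero) auto
    also have "\<dots> = D powr (-s) * real d powr s" using d D by (simp add: powr_divide powr_minus field_simps)
    finally have "1 * (\<bar>moebius d\<bar> / real d) \<le> D powr (-s) * real d powr s * (\<bar>moebius d\<bar> / real d)"
      by (intro mult_right_mono) auto
    also have "\<dots> = D powr (-s) * (\<bar>moebius d\<bar> * real d powr (s - 1))"
      using d0 by (simp add: powr_diff)
    finally show "\<bar>moebius d\<bar> / real d \<le> D powr (-s) * (\<bar>moebius d\<bar> * real d powr (s - 1))" by simp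
  qed
  also have "\<dots> = D powr (-s) * (\<Sum>d | d dvd N \<and> real d > D. \<bar>moebius d\<bar> * real d powr (s - 1))"
    by (simp add: sum_distrib_left)
  also have "\<dots> \<le> D powr (-s) * (\<Sum>d | d dvd N. \<bar>moebius d\<bar> * real d powr (s - 1))"
    using fin by (intro mult_left_mono sum_mono2) auto
  finally have tail: "(\<Sum>d | d dvd N \<and> real d > D. \<bar>moebius d\<bar> / real d)
      \<le> D powr (-s) * (\<Sum>d | d dvd N. \<bar>moebius d\<bar> * real d powr (s - 1))" .
  have "(\<Sum>d | d dvd N. \<bar>moebius d\<bar> * real d powr (s - 1))
      = (\<Sum>d | d dvd N \<and> squarefree d. \<Prod>p\<in>prime_factors d. real p powr (s - 1))"
    using fin by (intro sum.mono_neutral_cong_right)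
      (auto simp: abs_moebius prod_powr_distrib[symmetric] prod_real_prime_factors)
  also have "\<dots> = (\<Prod>p\<in>prime_factors N. 1 + real p powr (s - 1))"
    using N by (intro sum_squarefree_divisors) auto
  also have "\<dots> \<le> (2 * exp 2 * l) ^ 3 * exp 6 ^ 2"
  proof -
    have p1: "real p \<ge> 2" if "p \<in> prime_factors N" for p
      using that prime_ge_2_nat[of p] by (auto simp: in_prime_factors_iff)
    have small: "1 + real p powr (s - 1) \<le> (1 + 1 / real p) ^ 3"
      if p: "p \<in> {p\<in>prime_factors N. real p \<le> ln (real N)}" for p
    proof -
      have p0: "real p > 0" using p p1[of p] by auto
      have "ln (real p) \<le> l" unfolding l_def using p p0 l by (subst ln_le_cancel_iff) auto
      then have "s * ln (real p) \<le> 1" using l by (simp add: s_def field_simps)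
      then have "real p powr s \<le> exp 1" using p0 by (simp add: powr_def)
      then have "real p powr (s - 1) \<le> 3 / real p"
        using e3 p0 by (simp add: powr_diff divide_right_mono)
      moreover have "1 + 3 * (1 / real p) \<le> (1 + 1 / real p) ^ 3"
      proof -
        define u where "u = 1 / real p"
        have "0 \<le> u * u" "0 \<le> u * u * u" using p0 by (auto simp: u_def)
        then show ?thesis unfolding u_def[symmetric] by (simp add: power3_eq_cube algebra_simps)
      qed
      ultimately show ?thesis by simp
    qed
    have A: "(\<Prod>p\<in>{p\<in>prime_factors N. real p \<le> ln (real N)}. 1 + real p powr (s - 1)) \<le> (2 * exp 2 * l) ^ 3"
    proof -
      have "(\<Prod>p\<in>{p\<in>prime_factors N. real p \<le> ln (real N)}. 1 + real p powr (s - 1))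
         \<le> (\<Prod>p\<in>{p\<in>prime_factors N. real p \<le> ln (real N)}. (1 + 1 / real p) ^ 3)"
        using small by (intro prod_mono) auto
      also have "\<dots> = (\<Prod>p\<in>{p\<in>prime_factors N. real p \<le> ln (real N)}. 1 + 1 / real p) ^ 3"
        by (rule prod_power_distrib[symmetric])
      also have "\<dots> \<le> (2 * exp 2 * l) ^ 3"
        unfolding l_def using N by (intro power_mono prod_small_prime_factors_le prod_nonneg) auto
      finally show ?thesis .
    qed
    have large: "1 + real p powr (s - 1) \<le> 1 + 3 / ln (real N)"
      if p: "p \<in> {p\<in>prime_factors N. real p > ln (real N)}" for p
    proof -
      have "real p powr (s - 1) \<le> ln (real N) powr (s - 1)"
        using p l s by (intro powr_mono2') auto
      also have "\<dots> = ln (real N) powr s / ln (real N)" using l by (simp add: powr_diff)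
      also have "ln (real N) powr s = exp 1" using l by (simp add: powr_def s_def flip: l_def)
      also have "exp 1 / ln (real N) \<le> 3 / ln (real N)" using e3 l by (intro divide_right_mono) auto
      finally show ?thesis by simp
    qed
    have B: "(\<Prod>p\<in>{p\<in>prime_factors N. real p > ln (real N)}. 1 + real p powr (s - 1)) \<le> exp 6 ^ 2"
    proof -
      have "(\<Prod>p\<in>{p\<in>prime_factors N. real p > ln (real N)}. 1 + real p powr (s - 1))
         \<le> (\<Prod>p\<in>{p\<in>prime_factors N. real p > ln (real N)}. 1 + 3 / ln (real N))"
        using large by (intro prod_mono) auto
      also have "\<dots> \<le> exp (2 * 3)" using N by (intro prod_large_prime_factors_le) auto
      also have "\<dots> \<le> exp 6 ^ 2" by (simp add: power2_eq_square)
      finally show ?thesis .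
    qed
    show ?thesis unfolding prod_prime_factors_split[of _ N "ln (real N)"]
      using A B l by (intro mult_mono prod_nonneg) auto
  qed
  also have "(2 * exp 2 * l) ^ 3 * exp 6 ^ 2 = 8 * exp 18 * l ^ 3"
    by (simp add: power_mult_distrib exp_of_nat_mult[symmetric] exp_add[symmetric])
  finally have "D powr (-s) * (\<Sum>d | d dvd N. \<bar>moebius d\<bar> * real d powr (s - 1))
      \<le> D powr (-s) * (8 * exp 18 * l ^ 3)" by (intro mult_left_mono) auto
  with tail show ?thesis by (simp add: l_def s_def mult_ac)
qed

section \<open>Partial sums of the Moebius and totient functions\<close>

lemma harm_bounds:
  assumes "m \<ge> 1"
  shows "ln (real m + 1) \<le> (harm m :: real)" "harm m \<le> 1 + ln (real m)"
proof -
  show "ln (real m + 1) \<le> (harm m :: real)" by (rule ln_le_harm)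
  show "harm m \<le> 1 + ln (real m)" using assms
  proof (induction m rule: dec_induct)
    case base
    show ?case by (simp add: harm_def)
  next
    case (step m)
    have "ln (real m / real (Suc m)) \<le> real m / real (Suc m) - 1" using step by (intro ln_le_minus_one) auto
    also have "\<dots> = - (1 / real (Suc m))" by (simp add: field_simps)
    finally have "1 / real (Suc m) \<le> ln (real (Suc m)) - ln (real m)" using step by (simp add: ln_div)
    then show ?case using step by (simp add: harm_Suc inverse_eq_divide)
  qed
qed

lemma ln_le_2_sqrt: "x > 0 \<Longrightarrow> ln x \<le> 2 * sqrt x"
  using ln_le_minus_one[of "sqrt x"] by (simp add: ln_sqrt)

lemma sum_inverse_squares_le: "(\<Sum>d=1..Q. 1 / real d ^ 2) \<le> 2"
proof -
  have "(\<Sum>d=1..Q. 1 / real d ^ 2) = (\<Sum>d=1..Q. real d powr (-1 - 1))"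
    by (intro sum.cong refl) (simp add: powr_minus inverse_eq_divide)
  also have "\<dots> \<le> 2" using sum_powr_minus_le[of 1 Q] by simp
  finally show ?thesis .
qed

text \<open>The tail is compared with the telescoping series of \<open>1 / (M * (M + 1))\<close>.
  The case \<open>m = 1\<close> of the first bound also serves as the source of pi^2 >= 6.\<close>

lemma zeta2_partial:
  assumes "m \<ge> 1"
  shows "(\<Sum>k=1..m. 1 / real k ^ 2) \<le> pi\<^sup>2 / 6" "pi\<^sup>2 / 6 \<le> (\<Sum>k=1..m. 1 / real k ^ 2) + 1 / real m"
proof -
  have S: "(\<lambda>n. 1 / real (n + 1) ^ 2) sums (pi\<^sup>2 / 6)" using inverse_squares_sums by simp
  have e: "(\<Sum>k=1..m. 1 / real k ^ 2) = (\<Sum>k<m. 1 / real (k + 1) ^ 2)" for m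
    by (rule sum.reindex_bij_witness[of _ Suc "\<lambda>k. k - 1"]) auto
  have lim: "(\<lambda>m. \<Sum>k=1..m. 1 / real k ^ 2) \<longlonglongrightarrow> pi\<^sup>2 / 6"
    unfolding e using S by (simp add: sums_def)
  have mono: "(\<Sum>k=1..m. 1 / real k ^ 2) \<le> (\<Sum>k=1..M. 1 / real k ^ 2)" if "m \<le> M" for m M
    using that by (intro sum_mono2) auto
  show "(\<Sum>k=1..m. 1 / real k ^ 2) \<le> pi\<^sup>2 / 6"
    by (rule Lim_bounded2[OF lim, of m]) (use mono in auto)
  have "(\<Sum>k=1..M. 1 / real k ^ 2) \<le> (\<Sum>k=1..m. 1 / real k ^ 2) + 1 / real m - 1 / real M" if "M \<ge> m" for M
    using that
  proof (induction M rule: dec_induct)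
    case (step M)
    have M: "real M > 0" using step assms by simp
    have "1 / real (Suc M) ^ 2 \<le> 1 / (real M * real (Suc M))"
      using M by (intro divide_left_mono) (auto simp: power2_eq_square)
    also have "\<dots> = 1 / real M - 1 / real (Suc M)" using M by (simp add: field_simps)
    finally show ?case using step by simp
  qed auto
  then have "(\<Sum>k=1..M. 1 / real k ^ 2) \<le> (\<Sum>k=1..m. 1 / real k ^ 2) + 1 / real m" if "M \<ge> m" for M
    using that by (smt (verit) divide_nonneg_nonneg of_nat_0_le_iff)
  then show "pi\<^sup>2 / 6 \<le> (\<Sum>k=1..m. 1 / real k ^ 2) + 1 / real m"
    by (intro Lim_bounded[OF lim, of m]) auto
qed

lemma div_real_bounds:
  assumes "1 \<le> d" "d \<le> Q"
  shows "1 \<le> Q div d" "real (Q div d) \<le> real Q / real d" "real Q / real d < real (Q div d) + 1"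
    "real Q / (2 * real d) \<le> real (Q div d)"
proof -
  show 1: "1 \<le> Q div d" using assms by (simp add: Suc_le_eq div_greater_zero_iff)
  show "real (Q div d) \<le> real Q / real d" by (rule of_nat_div_le_of_nat)
  have "Q < (Q div d + 1) * d" using assms by (simp add: dividend_less_div_times)
  then have "real Q < real ((Q div d + 1) * d)" by linarith
  then show 2: "real Q / real d < real (Q div d) + 1" using assms by (simp add: field_simps)
  have "real Q / real d \<le> 2 * real (Q div d)" using 1 2 by linarith
  then show "real Q / (2 * real d) \<le> real (Q div d)" using assms by (simp add: field_simps)
qed

text \<open>The convolution of \<open>moebius d / d ^ 2\<close> with \<open>1 / k ^ 2\<close> is
  supported at 1, so its partial sum up to \<open>Q\<close> is exactly 1. Replacing each inner sum
  over \<open>k <= Q div d\<close> by pi^2 / 6 costs at most \<open>2 * d / Q\<close>, and these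
  costs add up to a harmonic sum.\<close>

lemma sum_moebius_over_squares:
  assumes "Q \<ge> 1"
  shows "\<bar>(\<Sum>d=1..Q. moebius d / real d ^ 2) - 6 / pi\<^sup>2\<bar> \<le> 2 * (1 + ln (real Q)) / real Q"
proof -
  define Z where "Z m = (\<Sum>k=1..m. 1 / real k ^ 2)" for m
  have "(\<Sum>n=1..Q. \<Sum>d | d dvd n. moebius d / real d ^ 2 * (1 / real (n div d) ^ 2))
      = (\<Sum>n=1..Q. if n = 1 then 1 else 0)"
  proof (rule sum.cong)
    fix n assume n: "n \<in> {1..Q}"
    have "(\<Sum>d | d dvd n. moebius d / real d ^ 2 * (1 / real (n div d) ^ 2))
        = (\<Sum>d | d dvd n. moebius d / real n ^ 2)"
      using n by (intro sum.cong refl) (auto simp: real_of_nat_div field_simps)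
    also have "\<dots> = (if n = 1 then 1 else 0)"
      using sum_moebius_divisors[of n] n by (simp flip: sum_divide_distrib)
    finally show "(\<Sum>d | d dvd n. moebius d / real d ^ 2 * (1 / real (n div d) ^ 2)) = (if n = 1 then 1 else 0)" .
  qed auto
  also have "\<dots> = 1" using assms by simp
  finally have one: "(\<Sum>d=1..Q. moebius d / real d ^ 2 * Z (Q div d)) = 1"
    unfolding sum_divisors_swap[of "\<lambda>d k. moebius d / real d ^ 2 * (1 / real k ^ 2)"]
    by (simp add: Z_def sum_distrib_left)
  have z: "\<bar>pi\<^sup>2 / 6 - Z (Q div d)\<bar> \<le> 2 * real d / real Q" if d: "d \<in> {1..Q}" for d
  proof -
    have b: "1 \<le> Q div d" "real Q / (2 * real d) \<le> real (Q div d)" using div_real_bounds d by auto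
    have "1 / real (Q div d) \<le> 1 / (real Q / (2 * real d))" using b assms d by (intro divide_left_mono) auto
    also have "\<dots> = 2 * real d / real Q" by simp
    finally show ?thesis using zeta2_partial[OF b(1)] unfolding Z_def[symmetric] by linarith
  qed
  have "\<bar>(\<Sum>d=1..Q. moebius d / real d ^ 2) * (pi\<^sup>2 / 6) - 1\<bar>
      = \<bar>\<Sum>d=1..Q. moebius d / real d ^ 2 * (pi\<^sup>2 / 6 - Z (Q div d))\<bar>"
    by (simp only: right_diff_distrib sum_subtractf one sum_distrib_right[symmetric])
  also have "\<dots> \<le> (\<Sum>d=1..Q. 1 / real d ^ 2 * (2 * real d / real Q))"
  proof (intro order.trans[OF sum_abs] sum_mono)
    fix d assume d: "d \<in> {1..Q}"
    show "\<bar>moebius d / real d ^ 2 * (pi\<^sup>2 / 6 - Z (Q div d))\<bar> \<le> 1 / real d ^ 2 * (2 * real d / real Q)"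
      unfolding abs_mult abs_divide using z[OF d]
      by (intro mult_mono) (auto intro!: divide_right_mono abs_moebius_le)
  qed
  also have "\<dots> = 2 / real Q * harm Q"
    unfolding harm_def sum_distrib_left
    by (intro sum.cong refl) (auto simp: power2_eq_square field_simps)
  also have "\<dots> \<le> 2 / real Q * (1 + ln (real Q))"
    using harm_bounds[OF assms] by (intro mult_left_mono) auto
  finally have A: "\<bar>(\<Sum>d=1..Q. moebius d / real d ^ 2) * (pi\<^sup>2 / 6) - 1\<bar> \<le> 2 * (1 + ln (real Q)) / real Q"
    by simp
  have pi: "pi\<^sup>2 / 6 \<ge> 1" using zeta2_partial(1)[of 1] by simp
  define s where "s = (\<Sum>d=1..Q. moebius d / real d ^ 2)"
  have "s - 6 / pi\<^sup>2 = (s * (pi\<^sup>2 / 6) - 1) / (pi\<^sup>2 / 6)" by (simp add: field_simps)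
  then have "\<bar>s - 6 / pi\<^sup>2\<bar> = \<bar>s * (pi\<^sup>2 / 6) - 1\<bar> / (pi\<^sup>2 / 6)"
    using pi by (simp only: abs_divide)
  also have "\<dots> \<le> \<bar>s * (pi\<^sup>2 / 6) - 1\<bar> / 1" using pi by (intro divide_left_mono) auto
  finally show ?thesis using A by (simp add: s_def)
qed

text \<open>The summand is the convolution of \<open>moebius d / d ^ 2\<close> with
  \<open>1 / k\<close>, so the sum is a Moebius sum of harmonic numbers, each equal to ln Q - ln d
  up to 1.\<close>

lemma sum_totient_over_squares:
  assumes "Q \<ge> 1"
  shows "\<bar>(\<Sum>n=1..Q. real (totient n) / real n ^ 2) - 6 / pi\<^sup>2 * ln (real Q)\<bar> \<le> 20"
proof -
  have "(\<Sum>n=1..Q. real (totient n) / real n ^ 2)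
      = (\<Sum>n=1..Q. \<Sum>d | d dvd n. moebius d / real d ^ 2 * (1 / real (n div d)))"
  proof (rule sum.cong)
    fix n assume n: "n \<in> {1..Q}"
    show "real (totient n) / real n ^ 2 = (\<Sum>d | d dvd n. moebius d / real d ^ 2 * (1 / real (n div d)))"
      unfolding totient_moebius[of n, OF less_le_trans[OF zero_less_one]] using n
      by (subst totient_moebius) (auto simp: sum_divide_distrib real_of_nat_div power2_eq_square intro!: sum.cong)
  qed auto
  also have "\<dots> = (\<Sum>d=1..Q. moebius d / real d ^ 2 * harm (Q div d))"
    unfolding sum_divisors_swap[of "\<lambda>d k. moebius d / real d ^ 2 * (1 / real k)"]
    by (simp add: sum_distrib_left harm_def inverse_eq_divide)
  finally have F: "(\<Sum>n=1..Q. real (totient n) / real n ^ 2) = (\<Sum>d=1..Q. moebius d / real d ^ 2 * harm (Q div d))" .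
  have h: "\<bar>harm (Q div d) - (ln (real Q) - ln (real d))\<bar> \<le> 1" if d: "d \<in> {1..Q}" for d
  proof -
    have d1: "1 \<le> d" "d \<le> Q" using d by auto
    note b = div_real_bounds[OF d1]
    have e: "ln (real Q) - ln (real d) = ln (real Q / real d)" using d1 by (simp add: ln_div)
    have "ln (real (Q div d)) \<le> ln (real Q / real d)" using b d1 by (subst ln_le_cancel_iff) auto
    moreover have "ln (real Q / real d) \<le> ln (real (Q div d) + 1)" using b d1 by (subst ln_le_cancel_iff) auto
    ultimately show ?thesis using harm_bounds[OF b(1)] unfolding e by linarith
  qed
  define M where "M = (\<Sum>d=1..Q. moebius d / real d ^ 2)"
  define M1 where "M1 = (\<Sum>d=1..Q. moebius d / real d ^ 2 * ln (real d))"
  have "\<bar>(\<Sum>d=1..Q. moebius d / real d ^ 2 * harm (Q div d)) - (M * ln (real Q) - M1)\<bar>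
      = \<bar>\<Sum>d=1..Q. moebius d / real d ^ 2 * (harm (Q div d) - (ln (real Q) - ln (real d)))\<bar>"
    by (simp only: M_def M1_def right_diff_distrib sum_subtractf sum_distrib_right[symmetric])
  also have "\<dots> \<le> (\<Sum>d=1..Q. 1 / real d ^ 2 * 1)"
  proof (intro order.trans[OF sum_abs] sum_mono)
    fix d assume d: "d \<in> {1..Q}"
    show "\<bar>moebius d / real d ^ 2 * (harm (Q div d) - (ln (real Q) - ln (real d)))\<bar> \<le> 1 / real d ^ 2 * 1"
      unfolding abs_mult abs_divide using h[OF d]
      by (intro mult_mono) (auto intro!: divide_right_mono abs_moebius_le)
  qed
  also have "\<dots> \<le> 2" using sum_inverse_squares_le by simp
  finally have 1: "\<bar>(\<Sum>n=1..Q. real (totient n) / real n ^ 2) - (M * ln (real Q) - M1)\<bar> \<le> 2"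
    unfolding F .
  have "\<bar>M1\<bar> \<le> (\<Sum>d=1..Q. 2 * real d powr (-1 - 1/2))"
    unfolding M1_def
  proof (intro order.trans[OF sum_abs] sum_mono)
    fix d assume d: "d \<in> {1..Q}"
    have "\<bar>moebius d / real d ^ 2 * ln (real d)\<bar> \<le> 1 / real d ^ 2 * (2 * sqrt (real d))"
      unfolding abs_mult abs_divide using ln_le_2_sqrt[of "real d"] d
      by (intro mult_mono) (auto intro!: divide_right_mono abs_moebius_le)
    also have "\<dots> = 2 * real d powr (-1 - 1/2)"
    proof -
      have "real d powr (-1 - 1/2) = real d powr (1/2 - 2)" by simp
      also have "\<dots> = sqrt (real d) / real d ^ 2" using d by (subst powr_diff) (simp add: powr_half_sqrt)
      finally show ?thesis by simp
    qed
    finally show "\<bar>moebius d / real d ^ 2 * ln (real d)\<bar> \<le> 2 * real d powr (-1 - 1/2)" .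
  qed
  also have "\<dots> \<le> 2 * 3" using sum_powr_minus_le[of "1/2" Q] by (simp flip: sum_distrib_left)
  finally have 2: "\<bar>M1\<bar> \<le> 6" by simp
  have l0: "ln (real Q) \<ge> 0" "real Q > 0" using assms by auto
  have lq: "ln (real Q) \<le> real Q" using ln_le_minus_one[of "real Q"] l0 by simp
  have "ln (real Q) ^ 2 \<le> (2 * sqrt (real Q)) ^ 2" using ln_le_2_sqrt[of "real Q"] l0 by (intro power_mono) auto
  then have sq: "ln (real Q) * ln (real Q) \<le> 4 * real Q" by (simp add: power2_eq_square)
  have "\<bar>M * ln (real Q) - 6 / pi\<^sup>2 * ln (real Q)\<bar> = \<bar>M - 6 / pi\<^sup>2\<bar> * ln (real Q)"
    unfolding left_diff_distrib[symmetric] abs_mult using l0 by simp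
  also have "\<dots> \<le> 2 * (1 + ln (real Q)) / real Q * ln (real Q)"
    unfolding M_def using sum_moebius_over_squares[OF assms] l0 by (intro mult_right_mono) auto
  also have "\<dots> = 2 * (ln (real Q) + ln (real Q) * ln (real Q)) / real Q" by (simp add: algebra_simps)
  also have "\<dots> \<le> 2 * (real Q + 4 * real Q) / real Q"
    using lq sq by (intro divide_right_mono mult_left_mono add_mono) auto
  also have "\<dots> = 10" using l0 by simp
  finally have 3: "\<bar>M * ln (real Q) - 6 / pi\<^sup>2 * ln (real Q)\<bar> \<le> 10" .
  \<comment> \<open>The three errors are 2 (harmonic numbers), 6 (the sum weighted by
    \<open>ln d\<close>) and 10 (replacing \<open>M\<close> by 6 / pi^2), together below 20.\<close>
  show ?thesis using 1 2 3 by linarith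
qed

section \<open>Splitting a continued fraction at a partial quotient\<close>

definition mv_set :: "nat \<Rightarrow> nat \<Rightarrow> nat list \<Rightarrow> nat \<Rightarrow> (nat \<times> nat list) set" where
  "mv_set b c u M = {(m, v). b \<le> m \<and> m \<le> c \<and> poslist v \<and> cont (u @ m # v) = M}"

lemma finite_mv_set:
  assumes "poslist u" "b \<ge> 1"
  shows "finite (mv_set b c u M)"
proof -
  have "(\<lambda>(m, v). u @ m # v) ` mv_set b c u M \<subseteq> cf_lists M"
    using assms by (auto simp: mv_set_def cf_lists_def)
  moreover have "inj_on (\<lambda>(m, v). u @ m # v) (mv_set b c u M)" by (auto simp: inj_on_def)
  ultimately show ?thesis by (metis finite_cf_lists finite_imageD finite_subset)
qed

text \<open>The pair \<open>(w, j)\<close> corresponds to \<open>(cont u, u, m, v)\<close> with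
  \<open>w = u @ m # v\<close> and \<open>j = length u\<close>. The weight sees only the prefix
  \<open>u\<close>, so what remains for each \<open>u\<close> is the number of completions
  \<open>(m, v)\<close>.\<close>

lemma sum_splits:
  fixes wt :: "nat list \<Rightarrow> real"
  assumes A: "finite A" and b: "b \<ge> 1"
  shows "(\<Sum>w\<in>cf_lists M. \<Sum>j | j < length w \<and> b \<le> w ! j \<and> w ! j \<le> c \<and> cont (take j w) \<in> A. wt (take j w))
       = (\<Sum>q\<in>A. \<Sum>u\<in>cf_lists q. wt u * real (card (mv_set b c u M)))"
proof -
  let ?J = "\<lambda>w. {j. j < length w \<and> b \<le> w ! j \<and> w ! j \<le> c \<and> cont (take j w) \<in> A}"
  let ?L = "SIGMA w:cf_lists M. ?J w"
  let ?R = "SIGMA q:A. SIGMA u:cf_lists q. mv_set b c u M"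
  have fin: "finite (mv_set b c u M)" if "u \<in> cf_lists q" for u q
    using that b by (intro finite_mv_set) (auto simp: cf_lists_def)
  have pt: "poslist (take j w)" "poslist (drop j w)" if "poslist w" for j w
    using that by (auto simp: poslist_def dest: in_set_takeD in_set_dropD)
  have "(\<Sum>w\<in>cf_lists M. \<Sum>j\<in>?J w. wt (take j w)) = (\<Sum>(w,j)\<in>?L. wt (take j w))"
    by (rule sum.Sigma) auto
  also have "\<dots> = (\<Sum>(q,u,m,v)\<in>?R. wt u)"
  proof (rule sum.reindex_bij_witness[where
        j = "\<lambda>(w,j). (cont (take j w), take j w, w ! j, drop (Suc j) w)" and
        i = "\<lambda>(q,u,m,v). (u @ m # v, length u)"])
    fix x assume "x \<in> ?L"
    then obtain w j where x: "x = (w,j)" "poslist w" "cont w = M" "j \<in> ?J w" by (auto simp: cf_lists_def)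
    have w: "take j w @ w ! j # drop (Suc j) w = w" using x(4) by (auto simp: id_take_nth_drop[symmetric])
    then show "(case case x of (w,j) \<Rightarrow> (cont (take j w), take j w, w ! j, drop (Suc j) w) of
        (q,u,m,v) \<Rightarrow> (u @ m # v, length u)) = x" using x by auto
    show "(case x of (w,j) \<Rightarrow> (cont (take j w), take j w, w ! j, drop (Suc j) w)) \<in> ?R"
      using x w pt[OF x(2)] by (auto simp: mv_set_def cf_lists_def)
  next
    fix x assume "x \<in> ?R"
    then show "(case case x of (q,u,m,v) \<Rightarrow> (u @ m # v, length u) of
        (w,j) \<Rightarrow> (cont (take j w), take j w, w ! j, drop (Suc j) w)) = x"
      "(case x of (q,u,m,v) \<Rightarrow> (u @ m # v, length u)) \<in> ?L"
      using b by (auto simp: mv_set_def cf_lists_def nth_append)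
  qed auto
  also have "\<dots> = (\<Sum>q\<in>A. \<Sum>(u,m,v)\<in>(SIGMA u:cf_lists q. mv_set b c u M). wt u)"
    using fin by (intro sum.Sigma[OF A, symmetric] ballI finite_SigmaI) auto
  also have "\<dots> = (\<Sum>q\<in>A. \<Sum>u\<in>cf_lists q. \<Sum>(m,v)\<in>mv_set b c u M. wt u)"
    using fin by (intro sum.cong refl sum.Sigma[symmetric]) auto
  also have "\<dots> = (\<Sum>q\<in>A. \<Sum>u\<in>cf_lists q. wt u * real (card (mv_set b c u M)))"
    by (intro sum.cong refl) (simp add: case_prod_unfold mult.commute)
  finally show ?thesis .
qed

section \<open>Linear equations in a homogeneous cone and their primitive solutions\<close>

definition lin_sols :: "(nat \<Rightarrow> nat \<Rightarrow> bool) \<Rightarrow> nat \<Rightarrow> nat \<Rightarrow> nat \<Rightarrow> (nat \<times> nat) set" where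
  "lin_sols P q p M = {(R, r). P R r \<and> q * R + p * r = M}"

definition prim_sols :: "(nat \<Rightarrow> nat \<Rightarrow> bool) \<Rightarrow> nat \<Rightarrow> nat \<Rightarrow> nat \<Rightarrow> (nat \<times> nat) set" where
  "prim_sols P q p M = {(R, r). P R r \<and> q * R + p * r = M \<and> coprime R r}"

text \<open>Homogeneity allows a common divisor to be cancelled from a solution;
  \<open>1 <= r <= R\<close> makes the gcd positive and, together with \<open>q >= 1\<close>, the
  solution set finite.\<close>

definition cone :: "(nat \<Rightarrow> nat \<Rightarrow> bool) \<Rightarrow> bool" where
  "cone P \<longleftrightarrow> (\<forall>R r. P R r \<longrightarrow> 1 \<le> r \<and> r \<le> R) \<and> (\<forall>d R r. d \<ge> 1 \<longrightarrow> P (d * R) (d * r) = P R r)"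

lemma finite_lin_sols:
  assumes "cone P" "q \<ge> 1"
  shows "finite (lin_sols P q p M)"
proof (rule finite_subset)
  show "lin_sols P q p M \<subseteq> {..M} \<times> {..M}"
  proof
    fix x assume "x \<in> lin_sols P q p M"
    then obtain R r where x: "x = (R,r)" "P R r" "q * R + p * r = M" by (auto simp: lin_sols_def)
    have "r \<le> R" using x assms(1) by (auto simp: cone_def)
    moreover have "R \<le> q * R" using assms(2) by simp
    ultimately have "R \<le> M" "r \<le> M" using x(3) by linarith+
    then show "x \<in> {..M} \<times> {..M}" using x(1) by simp
  qed
qed auto

text \<open>The predicate \<open>Q\<close> on the gcd lets one bijection serve both inversions: it
  is constantly true in \<open>card_prim_sols_moebius\<close> and prescribes the gcd in
  \<open>card_lin_sols_sum\<close>.\<close>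

lemma card_lin_sols_scale:
  assumes P: "cone P" and d: "d dvd M" "M \<ge> 1"
  shows "card {(R,r). P R r \<and> q * R + p * r = M \<and> Q (gcd R r) \<and> d dvd R \<and> d dvd r}
       = card {(R,r). P R r \<and> q * R + p * r = M div d \<and> Q (d * gcd R r)}"
proof (rule bij_betw_same_card[symmetric], rule bij_betw_byWitness[where f' = "\<lambda>(R,r). (R div d, r div d)"])
  have d1: "d \<ge> 1" using d by (auto simp: Suc_le_eq intro!: Nat.gr0I)
  obtain M' where M: "M = d * M'" using d by auto
  have P': "P (d * R) (d * r) = P R r" for R r using P d1 by (auto simp: cone_def)
  show "\<forall>a\<in>{(R,r). P R r \<and> q * R + p * r = M div d \<and> Q (d * gcd R r)}.
      (case (case a of (R,r) \<Rightarrow> (d * R, d * r)) of (R,r) \<Rightarrow> (R div d, r div d)) = a"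
    using d1 by auto
  show "\<forall>a\<in>{(R,r). P R r \<and> q * R + p * r = M \<and> Q (gcd R r) \<and> d dvd R \<and> d dvd r}.
      (case (case a of (R,r) \<Rightarrow> (R div d, r div d)) of (R,r) \<Rightarrow> (d * R, d * r)) = a"
    by auto
  have e': "q * (d * R) + p * (d * r) = d * (q * R + p * r)" for R r by (simp add: algebra_simps)
  have e: "q * (d * R) + p * (d * r) = d * M' \<longleftrightarrow> q * R + p * r = M'" for R r
    unfolding e' using d1 by simp
  show "(\<lambda>(R,r). (d * R, d * r)) ` {(R,r). P R r \<and> q * R + p * r = M div d \<and> Q (d * gcd R r)}
      \<subseteq> {(R,r). P R r \<and> q * R + p * r = M \<and> Q (gcd R r) \<and> d dvd R \<and> d dvd r}"
    using d1 by (auto simp: M P' e' gcd_mult_distrib_nat[symmetric])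
  show "(\<lambda>(R,r). (R div d, r div d)) ` {(R,r). P R r \<and> q * R + p * r = M \<and> Q (gcd R r) \<and> d dvd R \<and> d dvd r}
      \<subseteq> {(R,r). P R r \<and> q * R + p * r = M div d \<and> Q (d * gcd R r)}"
  proof
    fix x assume "x \<in> (\<lambda>(R,r). (R div d, r div d)) ` {(R,r). P R r \<and> q * R + p * r = M \<and> Q (gcd R r) \<and> d dvd R \<and> d dvd r}"
    then obtain R r where x: "x = (R, r)" "P (d * R) (d * r)" "q * (d * R) + p * (d * r) = M" "Q (gcd (d * R) (d * r))"
      using d1 by (auto elim!: dvdE)
    then show "x \<in> {(R,r). P R r \<and> q * R + p * r = M div d \<and> Q (d * gcd R r)}"
      using d1 by (auto simp: M P' e gcd_mult_distrib_nat[symmetric])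
  qed
qed

lemma card_prim_sols_moebius:
  assumes P: "cone P" and q: "q \<ge> 1" and M: "M \<ge> 1"
  shows "real (card (prim_sols P q p M)) = (\<Sum>d | d dvd M. moebius d * real (card (lin_sols P q p (M div d))))"
proof -
  let ?S = "lin_sols P q p M"
  have fin: "finite ?S" using P q by (rule finite_lin_sols)
  have finM: "finite {d. d dvd M}" using M by auto
  have g: "gcd R r \<ge> 1 \<and> gcd R r dvd M" if "(R,r) \<in> ?S" for R r
  proof -
    have "r \<ge> 1" using that P by (auto simp: cone_def lin_sols_def)
    then have "gcd R r \<ge> 1" by (simp add: Suc_le_eq gcd_pos_nat)
    moreover have "gcd R r dvd q * R + p * r" by simp
    ultimately show ?thesis using that by (auto simp: lin_sols_def)
  qed
  have "real (card (prim_sols P q p M)) = (\<Sum>x\<in>prim_sols P q p M. 1)" by simp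
  also have "\<dots> = (\<Sum>(R,r)\<in>?S. if gcd R r = 1 then 1 else 0)"
    using fin by (intro sum.mono_neutral_cong_left) (auto simp: lin_sols_def prim_sols_def coprime_iff_gcd_eq_1 split: if_splits)
  also have "\<dots> = (\<Sum>(R,r)\<in>?S. \<Sum>d | d dvd gcd R r. moebius d)"
  proof (intro sum.cong refl, clarify)
    fix R r assume "(R,r) \<in> ?S"
    then have "gcd R r > 0" using g[of R r] by linarith
    then show "(if gcd R r = 1 then 1 else 0) = (\<Sum>d | d dvd gcd R r. moebius d)"
      by (rule sum_moebius_divisors[symmetric])
  qed
  also have "\<dots> = (\<Sum>(R,r)\<in>?S. \<Sum>d | d dvd M. if d dvd R \<and> d dvd r then moebius d else 0)"
  proof (intro sum.cong refl, clarify)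
    fix R r assume "(R,r) \<in> ?S"
    then have "gcd R r dvd M" using g by blast
    then show "(\<Sum>d | d dvd gcd R r. moebius d) = (\<Sum>d | d dvd M. if d dvd R \<and> d dvd r then moebius d else 0)"
      using finM by (intro sum.mono_neutral_cong_left) (auto dest: dvd_trans[of _ "gcd R r" M])
  qed
  also have "\<dots> = (\<Sum>d | d dvd M. \<Sum>x\<in>?S. if d dvd fst x \<and> d dvd snd x then moebius d else 0)"
    unfolding case_prod_unfold by (rule sum.swap)
  also have "\<dots> = (\<Sum>d | d dvd M. moebius d * real (card (lin_sols P q p (M div d))))"
  proof (intro sum.cong refl)
    fix d assume d: "d \<in> {d. d dvd M}"
    have "(\<Sum>x\<in>?S. if d dvd fst x \<and> d dvd snd x then moebius d else 0)
        = moebius d * real (card {x\<in>?S. d dvd fst x \<and> d dvd snd x})"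
      using fin by (simp add: sum.If_cases Int_def)
    also have "{x\<in>?S. d dvd fst x \<and> d dvd snd x}
        = {(R,r). P R r \<and> q * R + p * r = M \<and> True \<and> d dvd R \<and> d dvd r}"
      by (auto simp: lin_sols_def)
    also have "card \<dots> = card {(R,r). P R r \<and> q * R + p * r = M div d \<and> True}"
      using card_lin_sols_scale[OF P _ M, where d = d and Q = "\<lambda>_. True"] d by simp
    also have "{(R,r). P R r \<and> q * R + p * r = M div d \<and> True} = lin_sols P q p (M div d)"
      by (auto simp: lin_sols_def)
    finally show "(\<Sum>x\<in>?S. if d dvd fst x \<and> d dvd snd x then moebius d else 0)
        = moebius d * real (card (lin_sols P q p (M div d)))" .
  qed
  finally show ?thesis .
qed

text \<open>Solutions are sorted by their gcd. This converse of the Moebius inversion permits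
  bounding the number of all solutions by numbers of positions in continued fractions, which
  \<open>split_sum_asymptotic\<close> does for large divisors.\<close>

lemma card_lin_sols_sum:
  assumes P: "cone P" and q: "q \<ge> 1" and M: "M \<ge> 1"
  shows "card (lin_sols P q p M) = (\<Sum>d | d dvd M. card (prim_sols P q p (M div d)))"
proof -
  let ?S = "lin_sols P q p M"
  have fin: "finite ?S" using P q by (rule finite_lin_sols)
  have finM: "finite {d. d dvd M}" using M by auto
  have g: "gcd (fst x) (snd x) dvd M" if "x \<in> ?S" for x
  proof -
    have "gcd (fst x) (snd x) dvd q * fst x + p * snd x" by simp
    then show ?thesis using that by (auto simp: lin_sols_def)
  qed
  have "card ?S = (\<Sum>d | d dvd M. card {x\<in>?S. gcd (fst x) (snd x) = d})"
  proof -
    have "(\<Sum>d\<in>{d. d dvd M}. \<Sum>x\<in>{x\<in>?S. gcd (fst x) (snd x) = d}. 1) = (\<Sum>x\<in>?S. 1::nat)"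
      using g by (intro sum.group[OF fin finM]) auto
    then show ?thesis by simp
  qed
  also have "\<dots> = (\<Sum>d | d dvd M. card (prim_sols P q p (M div d)))"
  proof (intro sum.cong refl)
    fix d assume d: "d \<in> {d. d dvd M}"
    then have d1: "d \<ge> 1" using M by (auto simp: Suc_le_eq intro!: Nat.gr0I)
    have 1: "{x\<in>?S. gcd (fst x) (snd x) = d}
        = {(R,r). P R r \<and> q * R + p * r = M \<and> gcd R r = d \<and> d dvd R \<and> d dvd r}"
      by (auto simp: lin_sols_def)
    have "d dvd M" using d by simp
    note 2 = card_lin_sols_scale[OF P this M, where q = q and p = p and Q = "\<lambda>g. g = d"]
    have 3: "{(R,r). P R r \<and> q * R + p * r = M div d \<and> d * gcd R r = d} = prim_sols P q p (M div d)"
      unfolding prim_sols_def coprime_iff_gcd_eq_1 using d1 by auto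
    show "card {x\<in>?S. gcd (fst x) (snd x) = d} = card (prim_sols P q p (M div d))"
      unfolding 1 2 3 ..
  qed
  finally show ?thesis .
qed

text \<open>\<open>R / r\<close> is \<open>m\<close> plus the value of \<open>v\<close>. That value
  lies in [0, 1) for canonical \<open>v\<close> and in (0, 1] for noncanonical \<open>v\<close>;
  hence the two half-open intervals of \<open>cone1\<close> and \<open>cone2\<close>, closed at
  opposite ends.\<close>

definition cone1 :: "nat \<Rightarrow> nat \<Rightarrow> nat \<Rightarrow> nat \<Rightarrow> bool" where
  "cone1 b c R r \<longleftrightarrow> b * r \<le> R \<and> R < (c + 1) * r"

definition cone2 :: "nat \<Rightarrow> nat \<Rightarrow> nat \<Rightarrow> nat \<Rightarrow> bool" where
  "cone2 b c R r \<longleftrightarrow> b * r < R \<and> R \<le> (c + 1) * r"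

lemma cone_cone1: assumes "b \<ge> 1" shows "cone (cone1 b c)"
  unfolding cone_def
proof (intro conjI allI impI)
  fix R r assume a: "cone1 b c R r"
  show "1 \<le> r" using a by (cases r) (auto simp: cone1_def)
  have "1 * r \<le> b * r" using assms by (rule mult_le_mono1)
  then show "r \<le> R" using a unfolding cone1_def by linarith
next
  fix d R r :: nat assume "d \<ge> 1"
  moreover have "b * (d * r) = d * (b * r)" "(c + 1) * (d * r) = d * ((c + 1) * r)" by (simp_all add: algebra_simps)
  ultimately show "cone1 b c (d * R) (d * r) = cone1 b c R r" unfolding cone1_def by simp
qed

lemma cone_cone2: assumes "b \<ge> 1" shows "cone (cone2 b c)"
  unfolding cone_def
proof (intro conjI allI impI)
  fix R r assume a: "cone2 b c R r"
  show "1 \<le> r" using a by (cases r) (auto simp: cone2_def)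
  have "1 * r \<le> b * r" using assms by (rule mult_le_mono1)
  then show "r \<le> R" using a unfolding cone2_def by linarith
next
  fix d R r :: nat assume "d \<ge> 1"
  moreover have "b * (d * r) = d * (b * r)" "(c + 1) * (d * r) = d * ((c + 1) * r)" by (simp_all add: algebra_simps)
  ultimately show "cone2 b c (d * R) (d * r) = cone2 b c R r" unfolding cone2_def by simp
qed

text \<open>With \<open>R = cont (m # v)\<close> and \<open>r = cont v\<close>, the numbers
  \<open>m\<close> and \<open>cont_tl v\<close> are the quotient and the remainder of
  \<open>R\<close> by \<open>r\<close>, and the remainder determines \<open>v\<close> by
  \<open>bij_betw_canon_lists\<close>.\<close>

lemma card_mv_canonical:
  assumes u: "poslist u" and b: "b \<ge> 1"
  shows "card {(m,v) \<in> mv_set b c u M. canonical_cfrac v} = card (prim_sols (cone1 b c) (cont u) (cont_bl u) M)"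
proof (rule bij_betw_same_card[where f = "\<lambda>(m,v). (cont (m # v), cont v)"], unfold bij_betw_def, intro conjI)
  have cv: "cont_tl v < cont v" "v \<in> canon_lists (cont v)" "1 \<le> cont v" if "poslist v" "canonical_cfrac v" for v
  proof -
    show 1: "v \<in> canon_lists (cont v)" "1 \<le> cont v" using that cont_pos[of v] by (auto simp: canon_lists_def cf_lists_def)
    show "cont_tl v < cont v" using bij_betw_apply[OF bij_betw_canon_lists[OF 1(2)] 1(1)] by auto
  qed
  show "inj_on (\<lambda>(m,v). (cont (m # v), cont v)) {(m,v) \<in> mv_set b c u M. canonical_cfrac v}"
  proof (rule inj_onI, clarify)
    fix m v m' v'
    assume h: "(m,v) \<in> mv_set b c u M" "canonical_cfrac v" "(m',v') \<in> mv_set b c u M" "canonical_cfrac v'"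
      and e: "cont (m # v) = cont (m' # v')" "cont v = cont v'"
    have v: "poslist v" "poslist v'" using h by (auto simp: mv_set_def)
    note c1 = cv[OF v(1) h(2)] and c2 = cv[OF v(2) h(4)]
    have m: "m = cont (m # v) div cont v" "cont_tl v = cont (m # v) mod cont v" using c1 by auto
    have m': "m' = cont (m' # v') div cont v'" "cont_tl v' = cont (m' # v') mod cont v'" using c2 by auto
    have "m = m'" by (subst m(1), subst m'(1)) (simp only: e)
    moreover have "cont_tl v = cont_tl v'" by (subst m(2), subst m'(2)) (simp only: e)
    ultimately have "m = m'" "cont_tl v = cont_tl v'" by auto
    then show "m = m' \<and> v = v'"
      using bij_betw_imp_inj_on[OF bij_betw_canon_lists[OF c1(3)]] c1(2) c2(2) e(2) by (auto dest: inj_onD)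
  qed
  show "(\<lambda>(m,v). (cont (m # v), cont v)) ` {(m,v) \<in> mv_set b c u M. canonical_cfrac v}
      = prim_sols (cone1 b c) (cont u) (cont_bl u) M"
  proof (intro equalityI subsetI)
    fix x assume "x \<in> (\<lambda>(m,v). (cont (m # v), cont v)) ` {(m,v) \<in> mv_set b c u M. canonical_cfrac v}"
    then obtain m v where x: "x = (cont (m # v), cont v)" "b \<le> m" "m \<le> c" "poslist v"
      "cont (u @ m # v) = M" "canonical_cfrac v" by (auto simp: mv_set_def)
    note c1 = cv[OF x(4,6)]
    have "b * cont v \<le> m * cont v" "m * cont v \<le> c * cont v" using x by (auto intro: mult_le_mono1)
    then have "cone1 b c (cont (m # v)) (cont v)" using c1(1)
      unfolding cone1_def cont.simps add_mult_distrib mult_1 by (intro conjI; linarith)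
    moreover have "coprime (cont (m # v)) (cont v)"
      using coprime_cont_tl[of "m # v"] by (simp add: coprime_commute)
    moreover have "cont u * cont (m # v) + cont_bl u * cont v = M" using x(5) cont_append[of u "m # v"] by simp
    ultimately show "x \<in> prim_sols (cone1 b c) (cont u) (cont_bl u) M" using x by (simp add: prim_sols_def)
  next
    fix x assume "x \<in> prim_sols (cone1 b c) (cont u) (cont_bl u) M"
    then obtain R r where x: "x = (R,r)" "b * r \<le> R" "R < (c + 1) * r" "cont u * R + cont_bl u * r = M" "coprime R r"
      by (auto simp: prim_sols_def cone1_def)
    have r: "r \<ge> 1" using x(3) by (cases r) auto
    have "gcd (R mod r) r = gcd R r" using gcd_red_nat[of R r] by (simp add: gcd.commute)
    then have "coprime (R mod r) r" using x(5) by (simp only: coprime_iff_gcd_eq_1)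
    then have "R mod r \<in> {k. k < r \<and> coprime k r}" using r by simp
    then obtain v where v: "v \<in> canon_lists r" "cont_tl v = R mod r"
      using bij_betw_imp_surj_on[OF bij_betw_canon_lists[OF r]] by (metis imageE)
    have R: "cont (R div r # v) = R" "cont v = r" using v by (auto simp: canon_lists_def cf_lists_def)
    have "b \<le> R div r" using x(2) r by (simp add: less_eq_div_iff_mult_less_eq)
    moreover have "R div r \<le> c" using x(3) r by (simp add: less_Suc_eq_le[symmetric] div_less_iff_less_mult)
    moreover have "cont (u @ (R div r) # v) = M" using cont_append[of u "R div r # v"] R x(4) by simp
    ultimately have "(R div r, v) \<in> {(m,v) \<in> mv_set b c u M. canonical_cfrac v}"
      using v by (auto simp: mv_set_def canon_lists_def cf_lists_def)
    then show "x \<in> (\<lambda>(m,v). (cont (m # v), cont v)) ` {(m,v) \<in> mv_set b c u M. canonical_cfrac v}"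
      using R x(1) by (intro rev_image_eqI) auto
  qed
qed

lemma card_mv_noncanonical:
  assumes u: "poslist u" and b: "b \<ge> 1"
  shows "card {(m,v) \<in> mv_set b c u M. \<not> canonical_cfrac v} = card (prim_sols (cone2 b c) (cont u) (cont_bl u) M)"
proof (rule bij_betw_same_card[where f = "\<lambda>(m,v). (cont (m # v), cont v)"], unfold bij_betw_def, intro conjI)
  have cv: "0 < cont_tl v" "cont_tl v \<le> cont v" "v \<in> noncanon_lists (cont v)" "1 \<le> cont v" if "poslist v" "\<not> canonical_cfrac v" for v
  proof -
    show 1: "v \<in> noncanon_lists (cont v)" "1 \<le> cont v" using that cont_pos[of v] by (auto simp: noncanon_lists_def cf_lists_def)
    show "0 < cont_tl v" "cont_tl v \<le> cont v" using bij_betw_apply[OF bij_betw_noncanon_lists[OF 1(2)] 1(1)] by auto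
  qed
  \<comment> \<open>For noncanonical \<open>v\<close> the remainder \<open>cont_tl v\<close> ranges
    over 1 to \<open>cont v\<close> instead of 0 to \<open>cont v - 1\<close>, so the quotient is
    recovered by dividing the predecessor.\<close>
  have dm: "m = (cont (m # v) - 1) div cont v" if "0 < cont_tl v" "cont_tl v \<le> cont v" for m v
  proof -
    have "cont (m # v) - 1 = m * cont v + (cont_tl v - 1)" using that by simp
    moreover have "cont_tl v - 1 < cont v" using that by simp
    ultimately show ?thesis by simp
  qed
  show "inj_on (\<lambda>(m,v). (cont (m # v), cont v)) {(m,v) \<in> mv_set b c u M. \<not> canonical_cfrac v}"
  proof (rule inj_onI, clarify)
    fix m v m' v'
    assume h: "(m,v) \<in> mv_set b c u M" "\<not> canonical_cfrac v" "(m',v') \<in> mv_set b c u M" "\<not> canonical_cfrac v'"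
      and e: "cont (m # v) = cont (m' # v')" "cont v = cont v'"
    have v: "poslist v" "poslist v'" using h by (auto simp: mv_set_def)
    note c1 = cv[OF v(1) h(2)] and c2 = cv[OF v(2) h(4)]
    have m: "m = m'" by (subst dm[OF c1(1,2)], subst dm[OF c2(1,2)]) (simp only: e)
    then have "cont_tl v = cont_tl v'" using e by simp
    then show "m = m' \<and> v = v'"
      using bij_betw_imp_inj_on[OF bij_betw_noncanon_lists[OF c1(4)]] c1(3) c2(3) e(2) m by (auto dest: inj_onD)
  qed
  show "(\<lambda>(m,v). (cont (m # v), cont v)) ` {(m,v) \<in> mv_set b c u M. \<not> canonical_cfrac v}
      = prim_sols (cone2 b c) (cont u) (cont_bl u) M"
  proof (intro equalityI subsetI)
    fix x assume "x \<in> (\<lambda>(m,v). (cont (m # v), cont v)) ` {(m,v) \<in> mv_set b c u M. \<not> canonical_cfrac v}"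
    then obtain m v where x: "x = (cont (m # v), cont v)" "b \<le> m" "m \<le> c" "poslist v"
      "cont (u @ m # v) = M" "\<not> canonical_cfrac v" by (auto simp: mv_set_def)
    note c1 = cv[OF x(4,6)]
    have "b * cont v \<le> m * cont v" "m * cont v \<le> c * cont v" using x by (auto intro: mult_le_mono1)
    then have "cone2 b c (cont (m # v)) (cont v)" using c1(1,2)
      unfolding cone2_def cont.simps add_mult_distrib mult_1 by (intro conjI; linarith)
    moreover have "coprime (cont (m # v)) (cont v)"
      using coprime_cont_tl[of "m # v"] by (simp add: coprime_commute)
    moreover have "cont u * cont (m # v) + cont_bl u * cont v = M" using x(5) cont_append[of u "m # v"] by simp
    ultimately show "x \<in> prim_sols (cone2 b c) (cont u) (cont_bl u) M" using x by (simp add: prim_sols_def)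
  next
    fix x assume "x \<in> prim_sols (cone2 b c) (cont u) (cont_bl u) M"
    then obtain R r where x: "x = (R,r)" "b * r < R" "R \<le> (c + 1) * r" "cont u * R + cont_bl u * r = M" "coprime R r"
      by (auto simp: prim_sols_def cone2_def)
    have r: "r \<ge> 1" using x(2,3) by (cases r) auto
    define m where "m = (R - 1) div r"
    define k where "k = (R - 1) mod r + 1"
    have Rmk: "R = m * r + k" using x(2) by (simp add: m_def k_def)
    have k: "0 < k" "k \<le> r" using r by (auto simp: k_def Suc_le_eq)
    have "gcd r (m * r + k) = gcd r k" by (rule gcd_add_mult)
    then have "gcd k r = gcd R r" unfolding Rmk by (simp add: gcd.commute)
    then have "k \<in> {k. 0 < k \<and> k \<le> r \<and> coprime k r}" using k x(5) by (simp only: coprime_iff_gcd_eq_1 mem_Collect_eq)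
    then obtain v where v: "v \<in> noncanon_lists r" "cont_tl v = k"
      using bij_betw_imp_surj_on[OF bij_betw_noncanon_lists[OF r]] by (metis imageE)
    have R: "cont (m # v) = R" "cont v = r" using v Rmk by (auto simp: noncanon_lists_def cf_lists_def)
    have "b \<le> m" unfolding m_def using x(2) r by (simp add: less_eq_div_iff_mult_less_eq)
    moreover have "m \<le> c" unfolding m_def using x(2,3) r by (simp add: less_Suc_eq_le[symmetric] div_less_iff_less_mult)
    moreover have "cont (u @ m # v) = M" using cont_append[of u "m # v"] R x(4) by simp
    ultimately have "(m, v) \<in> {(m,v) \<in> mv_set b c u M. \<not> canonical_cfrac v}"
      using v by (auto simp: mv_set_def noncanon_lists_def cf_lists_def)
    then show "x \<in> (\<lambda>(m,v). (cont (m # v), cont v)) ` {(m,v) \<in> mv_set b c u M. \<not> canonical_cfrac v}"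
      using R x(1) by (intro rev_image_eqI) auto
  qed
qed

lemma card_mv_set:
  assumes u: "poslist u" and b: "b \<ge> 1"
  shows "card (mv_set b c u M) = card (prim_sols (cone1 b c) (cont u) (cont_bl u) M)
    + card (prim_sols (cone2 b c) (cont u) (cont_bl u) M)"
proof -
  have "mv_set b c u M = {(m,v) \<in> mv_set b c u M. canonical_cfrac v} \<union> {(m,v) \<in> mv_set b c u M. \<not> canonical_cfrac v}"
    by auto
  also have "card \<dots> = card {(m,v) \<in> mv_set b c u M. canonical_cfrac v} + card {(m,v) \<in> mv_set b c u M. \<not> canonical_cfrac v}"
    by (rule card_Un_disjoint) (auto intro: finite_subset[OF _ finite_mv_set[OF assms, of c M]])
  finally show ?thesis using card_mv_canonical[OF assms] card_mv_noncanonical[OF assms] by simp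
qed

section \<open>Counting solutions of the splitting equation\<close>

text \<open>The count is the ceiling of (n - s) / q. Both bounds retain \<open>s\<close>, so it
  cancels when two counts are subtracted and \<open>card_ap\<close> has error at most 1.\<close>

lemma card_mod_eq_bounds:
  assumes "s < (q::nat)"
  shows "(real n - real s) / real q \<le> real (card {r. r < n \<and> r mod q = s})"
    "real (card {r. r < n \<and> r mod q = s}) \<le> (real n + real q - 1 - real s) / real q"
proof -
  define k where "k = (n + q - 1 - s) div q"
  have q: "q > 0" using assms by simp
  have lt: "s + q * i < n \<longleftrightarrow> i < k" for i
  proof -
    have "i < k \<longleftrightarrow> (i + 1) * q \<le> n + q - 1 - s"
      unfolding k_def using q by (simp add: less_eq_div_iff_mult_less_eq Suc_le_eq[symmetric])
    also have "\<dots> \<longleftrightarrow> i * q + q \<le> n + q - 1 - s" by (simp add: add.commute)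
    also have "\<dots> \<longleftrightarrow> s + q * i < n" using assms by (auto simp: mult.commute)
    finally show ?thesis by simp
  qed
  have "card {r. r < n \<and> r mod q = s} = card {..<k}"
  proof (rule bij_betw_same_card[symmetric, where f = "\<lambda>i. s + q * i"],
      rule bij_betw_byWitness[where f' = "\<lambda>r. r div q"])
    show "(\<lambda>r. r div q) ` {r. r < n \<and> r mod q = s} \<subseteq> {..<k}"
    proof safe
      fix r assume "r < n" "s = r mod q"
      moreover have "r mod q + q * (r div q) = r" by simp
      ultimately show "r div q < k" using lt[of "r div q"] by simp
    qed
    show "\<forall>i\<in>{..<k}. (s + q * i) div q = i" using assms by simp
    show "\<forall>r\<in>{r. r < n \<and> r mod q = s}. s + q * (r div q) = r" by auto
    show "(\<lambda>i. s + q * i) ` {..<k} \<subseteq> {r. r < n \<and> r mod q = s}"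
      using lt assms by (simp add: image_subset_iff)
  qed
  then have c: "card {r. r < n \<and> r mod q = s} = k" by simp
  have e: "real (n + q - 1 - s) = real n + real q - 1 - real s" using assms by (simp add: of_nat_diff)
  have "real k \<le> real (n + q - 1 - s) / real q" unfolding k_def by (rule of_nat_div_le_of_nat)
  then show "real (card {r. r < n \<and> r mod q = s}) \<le> (real n + real q - 1 - real s) / real q" unfolding c e .
  have "n + q - 1 - s < (k + 1) * q" unfolding k_def using q by (simp add: dividend_less_div_times)
  then have "n \<le> k * q + s" using assms by simp
  then have "real n \<le> real (k * q + s)" by linarith
  then show "(real n - real s) / real q \<le> real (card {r. r < n \<and> r mod q = s})" unfolding c
    using q by (simp add: field_simps)
qed

lemma card_ap:
  assumes q: "q \<ge> 1" and cop: "coprime p (q::nat)" and xy: "x \<le> y"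
  shows "\<bar>real (card {r\<in>{x..<y}. [p * r = M] (mod q)}) - (real y - real x) / real q\<bar> \<le> 1"
proof -
  obtain p' where p': "[p * p' = 1] (mod q)" using cong_solve_coprime_nat[OF cop] by auto
  define s where "s = (p' * M) mod q"
  have s: "s < q" using q by (simp add: s_def)
  have "[p * s = M] (mod q)"
  proof -
    have "[p * s = p * (p' * M)] (mod q)" by (auto simp: s_def cong_def mod_mult_right_eq)
    also have "p * (p' * M) = (p * p') * M" by simp
    also have "[\<dots> = 1 * M] (mod q)" using p' by (rule cong_scalar_right)
    finally show ?thesis by simp
  qed
  then have "[p * r = M] (mod q) \<longleftrightarrow> [p * r = p * s] (mod q)" for r by (meson cong_sym cong_trans)
  moreover have "[p * r = p * s] (mod q) \<longleftrightarrow> [r = s] (mod q)" for r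
    using cop by (rule cong_mult_lcancel_nat)
  ultimately have iff: "[p * r = M] (mod q) \<longleftrightarrow> r mod q = s" for r
    using s by (simp only: cong_def mod_less)
  let ?C = "\<lambda>n. {r. r < n \<and> r mod q = s}"
  have C: "?C y = ?C x \<union> {r\<in>{x..<y}. r mod q = s}" using xy by auto
  have "card (?C y) = card (?C x) + card {r\<in>{x..<y}. r mod q = s}"
    unfolding C by (rule card_Un_disjoint) auto
  then have e: "real (card {r\<in>{x..<y}. r mod q = s}) = real (card (?C y)) - real (card (?C x))" by linarith
  note b = card_mod_eq_bounds[OF s, of y] card_mod_eq_bounds[OF s, of x]
  have "(real y + real q - 1 - real s) / real q - (real x - real s) / real q = (real y - real x) / real q + (1 - 1 / real q)"
    using q by (simp add: field_simps)
  moreover have "(real y - real s) / real q - (real x + real q - 1 - real s) / real q = (real y - real x) / real q - (1 - 1 / real q)"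
    using q by (simp add: field_simps)
  moreover have "0 \<le> 1 / real q" by simp
  ultimately show ?thesis using b unfolding iff e by linarith
qed

text \<open>For \<open>R = (M - p * r) / q\<close> the condition b <= R / r < c + 1 confines
  \<open>r\<close> to an interval of length \<open>M / q\<close> times
  \<open>gap_fun b c (p / q)\<close>. Since \<open>r\<close> also runs through one residue class
  modulo \<open>q\<close>, the expected number of solutions has \<open>q ^ 2\<close> in the
  denominator.\<close>

definition gap_fun :: "nat \<Rightarrow> nat \<Rightarrow> real \<Rightarrow> real" where
  "gap_fun b c x = 1 / (real b + x) - 1 / (real c + 1 + x)"

lemma gap_fun_bounds:
  assumes "1 \<le> b" "b \<le> c" "0 \<le> x"
  shows "0 \<le> gap_fun b c x" "gap_fun b c x \<le> 1 / real b"
proof -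
  have "1 / (real c + 1 + x) \<le> 1 / (real b + x)" using assms by (intro divide_left_mono) auto
  then show "0 \<le> gap_fun b c x" by (simp add: gap_fun_def)
  have "1 / (real b + x) \<le> 1 / real b" using assms by (intro divide_left_mono) auto
  moreover have "0 \<le> 1 / (real c + 1 + x)" using assms by simp
  ultimately show "gap_fun b c x \<le> 1 / real b" unfolding gap_fun_def by linarith
qed

lemma div_real_floor: "d > 0 \<Longrightarrow> real n / real d - 1 < real (n div d) \<and> real (n div d) \<le> real n / real d"
proof -
  assume d: "d > 0"
  have "n < (n div d + 1) * d" using d by (simp add: dividend_less_div_times)
  then have "real n < real ((n div d + 1) * d)" by linarith
  then have "real n / real d < real (n div d) + 1" using d by (simp add: field_simps)
  then show ?thesis using of_nat_div_le_of_nat[of n d, where ?'a = real] by simp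
qed

text \<open>Common to both cones, with \<open>K = M\<close> for \<open>cone1\<close> and
  \<open>K = M - 1\<close> for \<open>cone2\<close>. The error 3 consists of 1 for the arithmetic
  progression, 1 for rounding the end points and 1 for replacing \<open>K\<close> by
  \<open>M\<close>.\<close>

lemma card_lin_sols_interval:
  assumes q: "q \<ge> 1" and cop: "coprime p q" and bc: "b \<ge> 1" "b \<le> c"
    and P: "\<And>R r. q * R + p * r = M \<Longrightarrow> P R r \<longleftrightarrow> r \<in> {K div ((c + 1) * q + p) + 1..<K div (b * q + p) + 1}"
    and KM: "K \<le> M" "M \<le> K + 1"
  shows "\<bar>real (card (lin_sols P q p M)) - real M / real q ^ 2 * gap_fun b c (real p / real q)\<bar> \<le> 3"
proof -
  define \<alpha> where "\<alpha> = b * q + p"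
  define \<beta> where "\<beta> = (c + 1) * q + p"
  have pos: "\<alpha> \<ge> 1" "\<beta> \<ge> 1" using q bc by (auto simp: \<alpha>_def \<beta>_def Suc_le_eq)
  have "b * q \<le> (c + 1) * q" using bc by (intro mult_le_mono1) simp
  then have ab: "\<alpha> \<le> \<beta>" by (simp add: \<alpha>_def \<beta>_def)
  define x where "x = K div \<beta> + 1"
  define y where "y = K div \<alpha> + 1"
  have xy: "x \<le> y" unfolding x_def y_def using ab pos by (simp add: div_le_mono2)
  have "card (lin_sols P q p M) = card {r\<in>{x..<y}. [p * r = M] (mod q)}"
  proof (rule bij_betw_same_card[of snd], unfold bij_betw_def, intro conjI)
    show "inj_on snd (lin_sols P q p M)" using q by (auto simp: inj_on_def lin_sols_def)
    show "snd ` lin_sols P q p M = {r\<in>{x..<y}. [p * r = M] (mod q)}"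
    proof (intro equalityI subsetI)
      fix r assume "r \<in> snd ` lin_sols P q p M"
      then obtain R where R: "P R r" "q * R + p * r = M" by (auto simp: lin_sols_def)
      have "[p * r = M] (mod q)" using R(2) by (auto simp: cong_def)
      then show "r \<in> {r\<in>{x..<y}. [p * r = M] (mod q)}" using P[OF R(2)] R(1) by (simp add: x_def y_def \<alpha>_def \<beta>_def)
    next
      fix r assume r: "r \<in> {r\<in>{x..<y}. [p * r = M] (mod q)}"
      \<comment> \<open>The upper end of the interval ensures \<open>p * r <= M\<close>, so that the
        natural subtraction \<open>M - p * r\<close> is exact.\<close>
      have "r \<le> K div \<alpha>" using r by (simp add: y_def)
      then have "r * \<alpha> \<le> K" using pos by (simp add: less_eq_div_iff_mult_less_eq)
      moreover have "r * p \<le> r * \<alpha>" unfolding \<alpha>_def by (rule mult_le_mono2) simp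
      ultimately have "r * p \<le> M" using KM by linarith
      then have le: "p * r \<le> M" by (simp only: mult.commute)
      have "M mod q = (p * r) mod q" using r by (simp add: cong_def)
      then have "q dvd M - p * r" using le by (simp add: mod_eq_dvd_iff_nat)
      then obtain R where "M - p * r = q * R" by blast
      then have R: "q * R + p * r = M" using le by simp
      then have "(R, r) \<in> lin_sols P q p M" using P[OF R] r by (simp add: lin_sols_def x_def y_def \<alpha>_def \<beta>_def)
      then show "r \<in> snd ` lin_sols P q p M" by force
    qed
  qed
  then have 1: "\<bar>real (card (lin_sols P q p M)) - (real y - real x) / real q\<bar> \<le> 1"
    using card_ap[OF q cop xy, of M] by simp
  define \<delta> where "\<delta> = 1 / real \<alpha> - 1 / real \<beta>"
  have d: "0 \<le> \<delta>" "\<delta> \<le> 1"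
  proof -
    have "1 / real \<beta> \<le> 1 / real \<alpha>" using ab pos by (intro divide_left_mono) auto
    moreover have "1 / real \<alpha> \<le> 1 / 1" using pos by (intro divide_left_mono) auto
    moreover have "0 \<le> 1 / real \<beta>" by simp
    ultimately show "0 \<le> \<delta>" "\<delta> \<le> 1" unfolding \<delta>_def by linarith+
  qed
  have "\<bar>(real y - real x) - real K * \<delta>\<bar> \<le> 1"
    using div_real_floor[of \<alpha> K] div_real_floor[of \<beta> K] pos
    by (simp add: x_def y_def \<delta>_def right_diff_distrib) linarith
  moreover have "0 \<le> (real M - real K) * \<delta>" using d KM by simp
  moreover have "(real M - real K) * \<delta> \<le> 1 * 1" using d KM by (intro mult_mono) auto
  ultimately have 2: "\<bar>(real y - real x) - real M * \<delta>\<bar> \<le> 2" by (simp add: left_diff_distrib)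
  have "\<bar>(real y - real x) / real q - real M * \<delta> / real q\<bar> = \<bar>(real y - real x) - real M * \<delta>\<bar> / real q"
    by (simp add: diff_divide_distrib[symmetric] abs_divide)
  also have "\<dots> \<le> 2 / 1" using 2 q by (intro frac_le) auto
  finally have 3: "\<bar>(real y - real x) / real q - real M * \<delta> / real q\<bar> \<le> 2" by simp
  have "gap_fun b c (real p / real q) = real q * \<delta>"
  proof -
    have "real b + real p / real q = real \<alpha> / real q" "real c + 1 + real p / real q = real \<beta> / real q"
      using q by (auto simp: \<alpha>_def \<beta>_def field_simps)
    then show ?thesis by (simp add: gap_fun_def \<delta>_def right_diff_distrib)
  qed
  then have "real M / real q ^ 2 * gap_fun b c (real p / real q) = real M * \<delta> / real q"
    using q by (simp add: power2_eq_square)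
  then show ?thesis using 1 3 by linarith
qed

lemma card_lin_sols_cone1:
  assumes q: "q \<ge> 1" and cop: "coprime p q" and bc: "b \<ge> 1" "b \<le> c"
  shows "\<bar>real (card (lin_sols (cone1 b c) q p M)) - real M / real q ^ 2 * gap_fun b c (real p / real q)\<bar> \<le> 3"
proof (rule card_lin_sols_interval[OF assms, where K = M])
  fix R r assume e: "q * R + p * r = M"
  have pos: "b * q + p > 0" "(c + 1) * q + p > 0" using q bc by auto
  have "b * r \<le> R \<longleftrightarrow> q * (b * r) \<le> q * R" using q by simp
  also have "\<dots> \<longleftrightarrow> r * (b * q + p) \<le> M" unfolding e[symmetric] by (simp add: algebra_simps)
  also have "\<dots> \<longleftrightarrow> r \<le> M div (b * q + p)" using pos by (simp add: less_eq_div_iff_mult_less_eq)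
  finally have 1: "b * r \<le> R \<longleftrightarrow> r \<le> M div (b * q + p)" .
  have "(c + 1) * r \<le> R \<longleftrightarrow> q * ((c + 1) * r) \<le> q * R" using q by simp
  also have "\<dots> \<longleftrightarrow> r * ((c + 1) * q + p) \<le> M" unfolding e[symmetric] by (simp add: algebra_simps)
  also have "\<dots> \<longleftrightarrow> r \<le> M div ((c + 1) * q + p)" using pos by (simp add: less_eq_div_iff_mult_less_eq)
  finally have 2: "(c + 1) * r \<le> R \<longleftrightarrow> r \<le> M div ((c + 1) * q + p)" .
  show "cone1 b c R r \<longleftrightarrow> r \<in> {M div ((c + 1) * q + p) + 1..<M div (b * q + p) + 1}"
    unfolding cone1_def using 1 2 by (auto simp: not_le[symmetric])
qed auto

lemma card_lin_sols_cone2: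
  assumes q: "q \<ge> 1" and cop: "coprime p q" and bc: "b \<ge> 1" "b \<le> c" and M: "M \<ge> 1"
  shows "\<bar>real (card (lin_sols (cone2 b c) q p M)) - real M / real q ^ 2 * gap_fun b c (real p / real q)\<bar> \<le> 3"
\<comment> \<open>A strict inequality against \<open>M\<close> is a weak one against
  \<open>M - 1\<close>; both ends of the interval for \<open>r\<close> move accordingly.\<close>
proof (rule card_lin_sols_interval[OF assms(1-4), where K = "M - 1"])
  fix R r assume e: "q * R + p * r = M"
  have pos: "b * q + p > 0" "(c + 1) * q + p > 0" using q bc by auto
  have "b * r < R \<longleftrightarrow> q * (b * r) < q * R" using q by simp
  also have "\<dots> \<longleftrightarrow> r * (b * q + p) < M" unfolding e[symmetric] by (simp add: algebra_simps)
  also have "\<dots> \<longleftrightarrow> r * (b * q + p) \<le> M - 1" using M by auto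
  also have "\<dots> \<longleftrightarrow> r \<le> (M - 1) div (b * q + p)" using pos by (simp add: less_eq_div_iff_mult_less_eq)
  finally have 1: "b * r < R \<longleftrightarrow> r \<le> (M - 1) div (b * q + p)" .
  have "(c + 1) * r < R \<longleftrightarrow> q * ((c + 1) * r) < q * R" using q by simp
  also have "\<dots> \<longleftrightarrow> r * ((c + 1) * q + p) < M" unfolding e[symmetric] by (simp add: algebra_simps)
  also have "\<dots> \<longleftrightarrow> r * ((c + 1) * q + p) \<le> M - 1" using M by auto
  also have "\<dots> \<longleftrightarrow> r \<le> (M - 1) div ((c + 1) * q + p)" using pos by (simp add: less_eq_div_iff_mult_less_eq)
  finally have 2: "(c + 1) * r < R \<longleftrightarrow> r \<le> (M - 1) div ((c + 1) * q + p)" .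
  show "cone2 b c R r \<longleftrightarrow> r \<in> {(M - 1) div ((c + 1) * q + p) + 1..<(M - 1) div (b * q + p) + 1}"
  proof -
    have "R \<le> (c + 1) * r \<longleftrightarrow> \<not> r \<le> (M - 1) div ((c + 1) * q + p)" unfolding 2[symmetric] by linarith
    then show ?thesis unfolding cone2_def 1 atLeastLessThan_iff by linarith
  qed
qed auto

lemma prim_subset_lin: "prim_sols P q p M \<subseteq> lin_sols P q p M"
  by (auto simp: prim_sols_def lin_sols_def)

lemma combine_bounds:
  fixes A B t :: real
  assumes "\<bar>A - t\<bar> \<le> 3" "\<bar>B - t\<bar> \<le> 3"
  shows "\<bar>A + B - 2 * t\<bar> \<le> 6"
  using assms by linarith

lemma card_mv_set_upper:
  assumes u: "poslist u" and b: "b \<ge> 1" and M: "M \<ge> 1"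
  shows "real (card (mv_set b c u M)) \<le> 2 * (real M / (real b * real (cont u) ^ 2) + 3)"
proof (cases "b \<le> c")
  case True
  have q: "cont u \<ge> 1" using cont_pos[OF u] .
  have g: "real M / real (cont u) ^ 2 * gap_fun b c (real (cont_bl u) / real (cont u)) \<le> real M / real (cont u) ^ 2 * (1 / real b)"
    using b True by (intro mult_left_mono gap_fun_bounds) auto
  have "card (prim_sols (cone1 b c) (cont u) (cont_bl u) M) \<le> card (lin_sols (cone1 b c) (cont u) (cont_bl u) M)"
    using finite_lin_sols[OF cone_cone1[OF b] q] by (intro card_mono prim_subset_lin)
  moreover have "card (prim_sols (cone2 b c) (cont u) (cont_bl u) M) \<le> card (lin_sols (cone2 b c) (cont u) (cont_bl u) M)"
    using finite_lin_sols[OF cone_cone2[OF b] q] by (intro card_mono prim_subset_lin)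
  ultimately have le: "real (card (mv_set b c u M)) \<le> real (card (lin_sols (cone1 b c) (cont u) (cont_bl u) M))
      + real (card (lin_sols (cone2 b c) (cont u) (cont_bl u) M))"
    unfolding card_mv_set[OF u b] by simp
  have up: "X \<le> 2 * (t' + 3)" if "X \<le> A + B" "\<bar>A + B - 2 * t\<bar> \<le> 6" "t \<le> t'" for X A B t t' :: real
  proof -
    have "A + B - 2 * t \<le> 6" using that(2) by (rule abs_le_D1)
    then show ?thesis using that(1,3) by (simp add: algebra_simps)
  qed
  have "real (card (mv_set b c u M)) \<le> 2 * (real M / real (cont u) ^ 2 * (1 / real b) + 3)"
    by (rule up[OF le combine_bounds g])
      (rule card_lin_sols_cone1[OF q coprime_cont_bl b True] card_lin_sols_cone2[OF q coprime_cont_bl b True M])+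
  then show ?thesis by (simp add: mult.commute)
next
  case False
  then have "mv_set b c u M = {}" by (auto simp: mv_set_def)
  then show ?thesis by simp
qed

lemma card_cf_lists_le: "real (card (cf_lists n)) \<le> 2 * real n"
proof (cases "n \<ge> 1")
  case True
  then show ?thesis using card_cf_lists[OF True] totient_le[of n] by simp
next
  case False
  then have "n = 0" by simp
  moreover have "cf_lists 0 = {}" using cont_pos by (force simp: cf_lists_def)
  ultimately show ?thesis by simp
qed

lemma sum_card_mv_upper:
  assumes b: "b \<ge> 1" and M: "M \<ge> 1" and q: "q \<ge> 1"
  shows "(\<Sum>u\<in>cf_lists q. real (card (mv_set b c u M))) \<le> 4 * real M / (real b * real q) + 12 * real q"
proof -
  have "(\<Sum>u\<in>cf_lists q. real (card (mv_set b c u M))) \<le> (\<Sum>u\<in>cf_lists q. 2 * (real M / (real b * real q ^ 2) + 3))"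
    using card_mv_set_upper[OF _ b M] by (intro sum_mono) (auto simp: cf_lists_def)
  also have "\<dots> = real (card (cf_lists q)) * (2 * (real M / (real b * real q ^ 2) + 3))" by simp
  also have "\<dots> \<le> (2 * real q) * (2 * (real M / (real b * real q ^ 2) + 3))"
    by (intro mult_right_mono card_cf_lists_le) auto
  also have "\<dots> = 4 * real M / (real b * real q) + 12 * real q"
    using q b by (simp add: field_simps power2_eq_square)
  finally show ?thesis .
qed

section \<open>Weighted counts of split positions\<close>

definition split_sum :: "nat \<Rightarrow> nat \<Rightarrow> nat set \<Rightarrow> (nat list \<Rightarrow> real) \<Rightarrow> nat list \<Rightarrow> real" where
  "split_sum b c A wt w = (\<Sum>j | j < length w \<and> b \<le> w ! j \<and> w ! j \<le> c \<and> cont (take j w) \<in> A. wt (take j w))"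

text \<open>The predicted value of the sum of \<open>split_sum\<close> over
  \<open>cf_lists N\<close> is \<open>2 * totient N\<close> times this. The 2 stands for the two
  cones, and the totient arises from the Moebius sum over the divisors of \<open>N\<close>.\<close>

definition main_sum :: "nat \<Rightarrow> nat \<Rightarrow> nat set \<Rightarrow> (nat list \<Rightarrow> real) \<Rightarrow> real" where
  "main_sum b c A wt = (\<Sum>q\<in>A. \<Sum>u\<in>cf_lists q. wt u * gap_fun b c (real (cont_bl u) / real q) / real q ^ 2)"

lemma sum_totient_quotients:
  assumes "M \<ge> 1"
  shows "(\<Sum>d | d dvd M. totient (M div d)) = M"
proof -
  have "(\<Sum>d | d dvd M. totient (M div d)) = (\<Sum>d | d dvd M. totient d)"
    using assms by (intro sum.reindex_bij_witness[of _ "\<lambda>d. M div d" "\<lambda>d. M div d"])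
      (auto elim!: dvdE simp: div_dvd_iff_mult)
  then show ?thesis using totient_divisor_sum by simp
qed

text \<open>\<open>Z\<close> counts positions, that is primitive solutions, and \<open>G\<close>
  counts all solutions; each is a divisor sum of the other. In the Moebius sum for
  \<open>Z N\<close> the terms with \<open>d <= D\<close> use the asymptotic count
  \<open>Gasy\<close>, whose error \<open>E\<close> does not depend on \<open>d\<close>. Summing
  \<open>E\<close> over the remaining \<open>d\<close> would be too costly, so there
  \<open>G\<close> is bounded trivially: written back as a divisor sum of \<open>Z\<close>, with the
  number of positions bounded by the list length, it is linear in \<open>M\<close> because the
  totients of the quotients \<open>M div d\<close> add up to \<open>M\<close>.\<close>

proposition split_sum_asymptotic:
  fixes wt :: "nat list \<Rightarrow> real"
  assumes b: "b \<ge> 1" "b \<le> c" and N: "N \<ge> 1" and wt: "\<And>u. poslist u \<Longrightarrow> 0 \<le> wt u \<and> wt u \<le> \<omega>"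
    and len: "\<And>M w. M \<le> N \<Longrightarrow> w \<in> cf_lists M \<Longrightarrow> real (length w) \<le> Len"
    and D: "D \<ge> 0"
  shows "\<bar>(\<Sum>w\<in>cf_lists N. split_sum b c {1..Q} wt w) - 2 * real (totient N) * main_sum b c {1..Q} wt\<bar>
    \<le> D * (12 * \<omega> * real Q ^ 2)
      + (2 * Len * \<omega> + 2 * main_sum b c {1..Q} wt) * real N * (\<Sum>d | d dvd N \<and> real d > D. \<bar>moebius d\<bar> / real d)"
proof -
  define S where "S = main_sum b c {1..Q} wt"
  define Z where "Z M = (\<Sum>w\<in>cf_lists M. split_sum b c {1..Q} wt w)" for M
  define L where "L u M = real (card (lin_sols (cone1 b c) (cont u) (cont_bl u) M)) + real (card (lin_sols (cone2 b c) (cont u) (cont_bl u) M))" for u M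
  define G where "G M = (\<Sum>q\<in>{1..Q}. \<Sum>u\<in>cf_lists q. wt u * L u M)" for M
  define E where "E = 12 * \<omega> * real Q ^ 2"
  have om: "\<omega> \<ge> 0" using wt[of "[]"] by simp
  have u: "poslist u" "cont u = q" "cont u \<ge> 1" if "u \<in> cf_lists q" for u q
    using that cont_pos[of u] by (auto simp: cf_lists_def)
  have Zmv: "Z M = (\<Sum>q\<in>{1..Q}. \<Sum>u\<in>cf_lists q. wt u * real (card (mv_set b c u M)))" for M
    unfolding Z_def split_sum_def using b by (intro sum_splits) auto
  have S0: "S \<ge> 0" unfolding S_def main_sum_def using wt b
    by (intro sum_nonneg divide_nonneg_nonneg mult_nonneg_nonneg gap_fun_bounds) (auto simp: cf_lists_def)
  have Z0: "Z M \<ge> 0" for M unfolding Zmv using wt by (intro sum_nonneg mult_nonneg_nonneg) (auto simp: cf_lists_def)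
  have ZG: "Z M = (\<Sum>d | d dvd M. moebius d * G (M div d))" if M: "M \<ge> 1" for M
  proof -
    have "Z M = (\<Sum>q\<in>{1..Q}. \<Sum>u\<in>cf_lists q. wt u * (\<Sum>d | d dvd M. moebius d * L u (M div d)))"
      unfolding Zmv
    proof (intro sum.cong refl)
      fix q x assume x: "x \<in> cf_lists q"
      show "wt x * real (card (mv_set b c x M)) = wt x * (\<Sum>d | d dvd M. moebius d * L x (M div d))"
        unfolding card_mv_set[OF u(1)[OF x] b(1)] of_nat_add
          card_prim_sols_moebius[OF cone_cone1[OF b(1)] u(3)[OF x] M] card_prim_sols_moebius[OF cone_cone2[OF b(1)] u(3)[OF x] M]
        by (simp add: L_def distrib_left sum.distrib)
    qed
    also have "\<dots> = (\<Sum>q\<in>{1..Q}. \<Sum>u\<in>cf_lists q. \<Sum>d | d dvd M. moebius d * (wt u * L u (M div d)))"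
      by (simp add: sum_distrib_left mult_ac)
    also have "\<dots> = (\<Sum>q\<in>{1..Q}. \<Sum>d | d dvd M. \<Sum>u\<in>cf_lists q. moebius d * (wt u * L u (M div d)))"
      by (intro sum.cong refl sum.swap)
    also have "\<dots> = (\<Sum>d | d dvd M. \<Sum>q\<in>{1..Q}. \<Sum>u\<in>cf_lists q. moebius d * (wt u * L u (M div d)))"
      by (rule sum.swap)
    finally show ?thesis by (simp add: G_def sum_distrib_left)
  qed
  have GZ: "G M = (\<Sum>d | d dvd M. Z (M div d))" if M: "M \<ge> 1" for M
  proof -
    have "G M = (\<Sum>q\<in>{1..Q}. \<Sum>u\<in>cf_lists q. wt u * (\<Sum>d | d dvd M. real (card (mv_set b c u (M div d)))))"
      unfolding G_def
    proof (intro sum.cong refl)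
      fix q x assume x: "x \<in> cf_lists q"
      show "wt x * L x M = wt x * (\<Sum>d | d dvd M. real (card (mv_set b c x (M div d))))"
        unfolding card_mv_set[OF u(1)[OF x] b(1)] L_def
          card_lin_sols_sum[OF cone_cone1[OF b(1)] u(3)[OF x] M] card_lin_sols_sum[OF cone_cone2[OF b(1)] u(3)[OF x] M]
        by (simp add: sum.distrib)
    qed
    also have "\<dots> = (\<Sum>q\<in>{1..Q}. \<Sum>u\<in>cf_lists q. \<Sum>d | d dvd M. wt u * real (card (mv_set b c u (M div d))))"
      by (simp add: sum_distrib_left)
    also have "\<dots> = (\<Sum>q\<in>{1..Q}. \<Sum>d | d dvd M. \<Sum>u\<in>cf_lists q. wt u * real (card (mv_set b c u (M div d))))"
      by (intro sum.cong refl sum.swap)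
    also have "\<dots> = (\<Sum>d | d dvd M. \<Sum>q\<in>{1..Q}. \<Sum>u\<in>cf_lists q. wt u * real (card (mv_set b c u (M div d))))"
      by (rule sum.swap)
    finally show ?thesis by (simp add: Zmv)
  qed
  have Zup: "Z M \<le> 2 * real (totient M) * (Len * \<omega>)" if M: "1 \<le> M" "M \<le> N" for M
  proof -
    have "Z M \<le> (\<Sum>w\<in>cf_lists M. Len * \<omega>)" unfolding Z_def
    proof (rule sum_mono)
      fix w assume w: "w \<in> cf_lists M"
      have p: "poslist (take j w)" for j using u(1)[OF w] by (auto simp: poslist_def dest: in_set_takeD)
      let ?J = "{j. j < length w \<and> b \<le> w ! j \<and> w ! j \<le> c \<and> cont (take j w) \<in> {1..Q}}"
      have "split_sum b c {1..Q} wt w \<le> (\<Sum>j\<in>?J. \<omega>)"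
        unfolding split_sum_def using wt p by (intro sum_mono) blast
      also have "\<dots> = real (card ?J) * \<omega>" by simp
      also have "\<dots> \<le> Len * \<omega>"
      proof (intro mult_right_mono om)
        have "card ?J \<le> card {..<length w}" by (intro card_mono) auto
        then show "real (card ?J) \<le> Len" using len[OF M(2) w] by simp
      qed
      finally show "split_sum b c {1..Q} wt w \<le> Len * \<omega>" .
    qed
    then show ?thesis using card_cf_lists[OF M(1)] by simp
  qed
  have Gup: "0 \<le> G M \<and> G M \<le> 2 * Len * \<omega> * real M" if M: "1 \<le> M" "M \<le> N" for M
  proof
    show "0 \<le> G M" unfolding GZ[OF M(1)] using Z0 by (intro sum_nonneg)
    have "G M \<le> (\<Sum>d | d dvd M. 2 * real (totient (M div d)) * (Len * \<omega>))"
      unfolding GZ[OF M(1)]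
    proof (intro sum_mono Zup)
      fix d assume d: "d \<in> {d. d dvd M}"
      then have "d \<ge> 1" "d \<le> M" using M by (auto simp: Suc_le_eq dvd_pos_nat intro: dvd_imp_le)
      then show "1 \<le> M div d" by (simp add: Suc_le_eq div_greater_zero_iff)
      show "M div d \<le> N" using M(2) div_le_dividend[of M d] by linarith
    qed
    also have "\<dots> = 2 * (Len * \<omega>) * real (\<Sum>d | d dvd M. totient (M div d))"
      by (simp add: sum_distrib_left mult_ac)
    finally show "G M \<le> 2 * Len * \<omega> * real M" unfolding sum_totient_quotients[OF M(1)] by (simp add: mult_ac)
  qed
  have Gasy: "\<bar>G M - 2 * real M * S\<bar> \<le> E" if M: "1 \<le> M" for M
  proof -
    have "G M - 2 * real M * S = (\<Sum>q\<in>{1..Q}. \<Sum>u\<in>cf_lists q. wt u * (L u M - 2 * (real M / real q ^ 2 * gap_fun b c (real (cont_bl u) / real q))))"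
      by (simp add: G_def S_def main_sum_def sum_distrib_left right_diff_distrib sum_subtractf mult_ac)
    also have "\<bar>\<dots>\<bar> \<le> (\<Sum>q\<in>{1..Q}. \<Sum>u\<in>cf_lists q. \<omega> * 6)"
    proof (intro order.trans[OF sum_abs] sum_mono)
      fix q x assume x: "x \<in> cf_lists q"
      note h = card_lin_sols_cone1[OF u(3)[OF x] coprime_cont_bl b, of M] card_lin_sols_cone2[OF u(3)[OF x] coprime_cont_bl b M]
      have "\<bar>L x M - 2 * (real M / real q ^ 2 * gap_fun b c (real (cont_bl x) / real q))\<bar> \<le> 6"
        using combine_bounds[OF h] unfolding L_def u(2)[OF x] .
      then show "\<bar>wt x * (L x M - 2 * (real M / real q ^ 2 * gap_fun b c (real (cont_bl x) / real q)))\<bar> \<le> \<omega> * 6"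
        unfolding abs_mult using wt[OF u(1)[OF x]] by (intro mult_mono) auto
    qed
    also have "\<dots> = (\<Sum>q\<in>{1..Q}. real (card (cf_lists q)) * (\<omega> * 6))" by simp
    also have "\<dots> \<le> (\<Sum>q\<in>{1..Q}. (2 * real Q) * (\<omega> * 6))"
    proof (intro sum_mono mult_right_mono)
      fix q assume "q \<in> {1..Q}"
      then show "real (card (cf_lists q)) \<le> 2 * real Q" using card_cf_lists_le[of q] by simp
    qed (use om in simp)
    also have "\<dots> = E" by (simp add: E_def power2_eq_square)
    finally show ?thesis .
  qed
  have fin: "finite {d. d dvd N}" using N by auto
  let ?T = "\<lambda>d. moebius d * (G (N div d) - 2 * (real N / real d) * S)"
  have dp: "1 \<le> d \<and> 1 \<le> N div d \<and> N div d \<le> N \<and> real (N div d) = real N / real d" if "d dvd N" for d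
  proof -
    have "d \<ge> 1" "d \<le> N" using that N by (auto simp: Suc_le_eq dvd_pos_nat intro: dvd_imp_le)
    then show ?thesis using that by (simp add: Suc_le_eq div_greater_zero_iff real_of_nat_div)
  qed
  have "Z N - 2 * real (totient N) * S = (\<Sum>d | d dvd N. ?T d)"
    unfolding ZG[OF N] totient_moebius[of N, OF less_le_trans[OF zero_less_one N]]
    by (simp add: sum_distrib_left sum_distrib_right right_diff_distrib sum_subtractf mult_ac)
  then have eq1: "\<bar>Z N - 2 * real (totient N) * S\<bar> = \<bar>\<Sum>d | d dvd N. ?T d\<bar>" by (rule arg_cong)
  have eq2: "(\<Sum>d | d dvd N. ?T d) = (\<Sum>d | d dvd N \<and> real d \<le> D. ?T d) + (\<Sum>d | d dvd N \<and> real d > D. ?T d)"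
  proof -
    have e: "{d. d dvd N} = {d. d dvd N \<and> real d \<le> D} \<union> {d. d dvd N \<and> real d > D}" by auto
    have f: "finite {d. d dvd N \<and> real d \<le> D}" "finite {d. d dvd N \<and> real d > D}"
      by (rule finite_subset[OF _ fin]; blast)+
    show ?thesis by (subst e, rule sum.union_disjoint[OF f]) force
  qed
  have "\<bar>Z N - 2 * real (totient N) * S\<bar> \<le> (\<Sum>d | d dvd N \<and> real d \<le> D. \<bar>?T d\<bar>) + (\<Sum>d | d dvd N \<and> real d > D. \<bar>?T d\<bar>)"
    unfolding eq1 eq2 by (rule order.trans[OF abs_triangle_ineq add_mono[OF sum_abs sum_abs]])
  also have "\<dots> \<le> D * E + (2 * Len * \<omega> + 2 * S) * real N * (\<Sum>d | d dvd N \<and> real d > D. \<bar>moebius d\<bar> / real d)"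
  proof (rule add_mono)
    have E0: "E \<ge> 0" using om by (simp add: E_def)
    have "(\<Sum>d | d dvd N \<and> real d \<le> D. \<bar>?T d\<bar>) \<le> (\<Sum>d | d dvd N \<and> real d \<le> D. E)"
    proof (rule sum_mono)
      fix d assume d: "d \<in> {d. d dvd N \<and> real d \<le> D}"
      then have h: "1 \<le> N div d" "real (N div d) = real N / real d" using dp by auto
      have "\<bar>?T d\<bar> \<le> 1 * E" unfolding abs_mult
        using Gasy[OF h(1)] unfolding h(2) by (intro mult_mono abs_moebius_le) auto
      then show "\<bar>?T d\<bar> \<le> E" by simp
    qed
    also have "\<dots> = real (card {d. d dvd N \<and> real d \<le> D}) * E" by simp
    also have "\<dots> \<le> D * E"
    proof (intro mult_right_mono E0)
      have "card {d. d dvd N \<and> real d \<le> D} \<le> card {1..nat \<lfloor>D\<rfloor>}"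
        using dp by (intro card_mono) (auto simp: le_nat_floor)
      also have "\<dots> = nat \<lfloor>D\<rfloor>" by simp
      finally show "real (card {d. d dvd N \<and> real d \<le> D}) \<le> D" using D by linarith
    qed
    finally show "(\<Sum>d | d dvd N \<and> real d \<le> D. \<bar>?T d\<bar>) \<le> D * E" .
    have "(\<Sum>d | d dvd N \<and> real d > D. \<bar>?T d\<bar>) \<le> (\<Sum>d | d dvd N \<and> real d > D. (2 * Len * \<omega> + 2 * S) * real N * (\<bar>moebius d\<bar> / real d))"
    proof (rule sum_mono)
      fix d assume d: "d \<in> {d. d dvd N \<and> real d > D}"
      then have h: "1 \<le> N div d" "N div d \<le> N" "real (N div d) = real N / real d" using dp by auto
      have "0 \<le> 2 * (real N / real d) * S" using S0 by simp
      then have "\<bar>G (N div d) - 2 * (real N / real d) * S\<bar> \<le> 2 * Len * \<omega> * (real N / real d) + 2 * (real N / real d) * S"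
        using Gup[OF h(1,2)] unfolding h(3) by linarith
      then have "\<bar>?T d\<bar> \<le> \<bar>moebius d\<bar> * (2 * Len * \<omega> * (real N / real d) + 2 * (real N / real d) * S)"
        unfolding abs_mult by (intro mult_left_mono) auto
      also have "\<dots> = (2 * Len * \<omega> + 2 * S) * real N * (\<bar>moebius d\<bar> / real d)"
        by (simp add: add_divide_distrib[symmetric]) (simp add: algebra_simps add_divide_distrib)
      finally show "\<bar>?T d\<bar> \<le> (2 * Len * \<omega> + 2 * S) * real N * (\<bar>moebius d\<bar> / real d)" .
    qed
    then show "(\<Sum>d | d dvd N \<and> real d > D. \<bar>?T d\<bar>) \<le> (2 * Len * \<omega> + 2 * S) * real N * (\<Sum>d | d dvd N \<and> real d > D. \<bar>moebius d\<bar> / real d)"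
      by (simp add: sum_distrib_left)
  qed
  finally show ?thesis by (simp add: Z_def S_def E_def)
qed

section \<open>Evaluation of the main term\<close>

text \<open>The integral of \<open>gap_fun b c\<close> over [0, 1].\<close>

definition gap_int :: "nat \<Rightarrow> nat \<Rightarrow> real" where
  "gap_int b c = ln (1 + 1 / real b) - ln (1 + 1 / (real c + 1))"

lemma gap_int_bounds:
  assumes "1 \<le> b" "b \<le> c"
  shows "0 \<le> gap_int b c" "gap_int b c \<le> 1 / real b"
proof -
  have "1 / (real c + 1) \<le> 1 / real b" using assms by (intro divide_left_mono) auto
  then have "ln (1 + 1 / (real c + 1)) \<le> ln (1 + 1 / real b)"
    using assms by (subst ln_le_cancel_iff) (auto intro: add_pos_nonneg)
  then show "0 \<le> gap_int b c" by (simp add: gap_int_def)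
  have "ln (1 + 1 / real b) \<le> 1 / real b" by (rule ln_add_one_self_le_self) simp
  moreover have "0 \<le> ln (1 + 1 / (real c + 1))" by simp
  ultimately show "gap_int b c \<le> 1 / real b" unfolding gap_int_def by linarith
qed

text \<open>The sum telescopes, since 1 + 1 / (m (m + 2)) is the quotient of 1 + 1 / m by 1 + 1 / (m
  + 1).\<close>

lemma cfrac_mu_eq:
  assumes "1 \<le> b" "b \<le> c"
  shows "cfrac_mu b c = 12 / pi\<^sup>2 * gap_int b c"
proof -
  have "(\<Sum>m=b..c. ln (1 + 1 / (real m * (real m + 2)))) = gap_int b c"
    using assms(2)
  proof (induction c rule: dec_induct)
    case base
    have "1 + 1 / (real b * (real b + 2)) = (1 + 1 / real b) / (1 + 1 / (real b + 1))"
      using assms by (simp add: divide_simps) (simp add: algebra_simps)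
    moreover have "1 + 1 / real b > 0" "1 + 1 / (real b + 1) > 0" using assms by (auto intro: add_pos_pos)
    ultimately show ?case by (simp add: gap_int_def ln_div)
  next
    case (step c)
    have c: "real c > 0" using assms step by simp
    have "1 + 1 / (real (Suc c) * (real (Suc c) + 2)) = (1 + 1 / (real c + 1)) / (1 + 1 / (real c + 2))"
      using c by (simp add: divide_simps) (simp add: algebra_simps)
    then have "ln (1 + 1 / (real (Suc c) * (real (Suc c) + 2))) = ln (1 + 1 / (real c + 1)) - ln (1 + 1 / (real c + 2))"
    proof -
      have "1 + 1 / (real c + 1) > 0" "1 + 1 / (real c + 2) > 0" using c by (auto intro: add_pos_pos)
      then show ?thesis using \<open>1 + 1 / (real (Suc c) * (real (Suc c) + 2)) = _\<close> by (simp only: ln_divide_pos)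
    qed
    moreover have "real (Suc c) + 1 = real c + 2" by simp
    ultimately show ?case using step unfolding gap_int_def by (simp add: ac_simps)
  qed
  then show ?thesis by (simp add: cfrac_mu_def)
qed

text \<open>Reversal turns \<open>cont_bl\<close> into \<open>cont_tl\<close>, for which the two
  kinds of lists run through the reduced residues once each.\<close>

lemma sum_cf_lists_cont_bl:
  assumes "q \<ge> 1"
  shows "(\<Sum>u\<in>cf_lists q. g (cont_bl u)) = (\<Sum>p | p < q \<and> coprime p q. g p) + (\<Sum>p | 0 < p \<and> p \<le> q \<and> coprime p q. g p)"
proof -
  have "(\<Sum>u\<in>cf_lists q. g (cont_bl u)) = (\<Sum>u\<in>cf_lists q. g (cont_tl u))"
    using sum_cf_lists_rev[of "\<lambda>u. g (cont_bl u)" q] by simp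
  also have "\<dots> = (\<Sum>p | p < q \<and> coprime p q. g p) + (\<Sum>p | 0 < p \<and> p \<le> q \<and> coprime p q. g p)"
    unfolding sum_cf_lists_split using sum.reindex_bij_betw[OF bij_betw_canon_lists[OF assms], of g]
      sum.reindex_bij_betw[OF bij_betw_noncanon_lists[OF assms], of g] by simp
  finally show ?thesis .
qed

lemma sum_coprime_moebius:
  fixes h :: "nat \<Rightarrow> real"
  assumes "finite I" "q \<ge> 1"
  shows "(\<Sum>p\<in>{p\<in>I. coprime p q}. h p) = (\<Sum>e | e dvd q. moebius e * (\<Sum>p\<in>{p\<in>I. e dvd p}. h p))"
proof -
  have finq: "finite {e. e dvd q}" using assms by auto
  have "(\<Sum>p\<in>{p\<in>I. coprime p q}. h p) = (\<Sum>p\<in>I. if coprime p q then h p else 0)"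
    using assms(1) by (simp add: sum.inter_filter)
  also have "\<dots> = (\<Sum>p\<in>I. \<Sum>e | e dvd q. if e dvd p then moebius e * h p else 0)"
  proof (intro sum.cong refl)
    fix p assume "p \<in> I"
    have g: "gcd p q > 0" using assms by simp
    have "(\<Sum>e | e dvd q. if e dvd p then moebius e * h p else 0) = (\<Sum>e\<in>{e\<in>{e. e dvd q}. e dvd p}. moebius e * h p)"
      using finq by (rule sum.inter_filter[symmetric])
    also have "{e\<in>{e. e dvd q}. e dvd p} = {e. e dvd gcd p q}" by auto
    also have "(\<Sum>e\<in>{e. e dvd gcd p q}. moebius e * h p) = (\<Sum>e\<in>{e. e dvd gcd p q}. moebius e) * h p"
      by (rule sum_distrib_right[symmetric])
    also have "\<dots> = (if gcd p q = 1 then h p else 0)" unfolding sum_moebius_divisors[OF g] by simp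
    finally show "(if coprime p q then h p else 0) = (\<Sum>e | e dvd q. if e dvd p then moebius e * h p else 0)"
      by (simp only: coprime_iff_gcd_eq_1)
  qed
  also have "\<dots> = (\<Sum>e | e dvd q. \<Sum>p\<in>I. if e dvd p then moebius e * h p else 0)" by (rule sum.swap)
  also have "\<dots> = (\<Sum>e | e dvd q. moebius e * (\<Sum>p\<in>{p\<in>I. e dvd p}. h p))"
    using assms(1) by (intro sum.cong refl) (simp add: sum.inter_filter[symmetric] sum_distrib_left)
  finally show ?thesis .
qed

text \<open>These are right and left Riemann sums, scaled by \<open>k\<close>, of the decreasing
  function 1 / (B + y) on [0, 1]. The scaled integral lies between them, and they differ by less
  than \<open>1 / B\<close>.\<close>

lemma sum_inverse_shift_bounds:
  fixes B :: real
  assumes B: "B \<ge> 1" and k: "k \<ge> 1"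
  shows "\<bar>(\<Sum>j=1..k. 1 / (B + real j / real k)) - real k * ln (1 + 1 / B)\<bar> \<le> 1 / B"
    "\<bar>(\<Sum>j<k. 1 / (B + real j / real k)) - real k * ln (1 + 1 / B)\<bar> \<le> 1 / B"
proof -
  define y where "y j = B + real j / real k" for j
  have y: "y j > 0" for j using B by (simp add: y_def add_pos_nonneg)
  have d: "y (Suc j) - y j = 1 / real k" for j by (simp add: y_def add_divide_distrib)
  have s1: "1 / y (Suc j) \<le> real k * (ln (y (Suc j)) - ln (y j))" for j
  proof -
    have "ln (y j / y (Suc j)) \<le> y j / y (Suc j) - 1" using y by (intro ln_le_minus_one) auto
    also have "\<dots> = - ((y (Suc j) - y j) / y (Suc j))" using y[of "Suc j"] by (simp add: field_simps)
    finally have "1 / real k / y (Suc j) \<le> ln (y (Suc j)) - ln (y j)"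
      using y[of j] y[of "Suc j"] unfolding d by (simp add: ln_div)
    then have "real k * (1 / real k / y (Suc j)) \<le> real k * (ln (y (Suc j)) - ln (y j))" by (rule mult_left_mono) simp
    then show ?thesis using k by simp
  qed
  have s2: "real k * (ln (y (Suc j)) - ln (y j)) \<le> 1 / y j" for j
  proof -
    have "ln (y (Suc j) / y j) \<le> y (Suc j) / y j - 1" using y by (intro ln_le_minus_one) auto
    also have "\<dots> = (y (Suc j) - y j) / y j" using y[of j] by (simp add: field_simps)
    finally have "ln (y (Suc j)) - ln (y j) \<le> 1 / real k / y j"
      using y[of j] y[of "Suc j"] unfolding d by (simp add: ln_div)
    then have "real k * (ln (y (Suc j)) - ln (y j)) \<le> real k * (1 / real k / y j)" by (rule mult_left_mono) simp
    then show ?thesis using k by simp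
  qed
  have tel: "(\<Sum>j<k. real k * (ln (y (Suc j)) - ln (y j))) = real k * ln (1 + 1 / B)"
  proof -
    have "(\<Sum>j<k. real k * (ln (y (Suc j)) - ln (y j))) = real k * (ln (y k) - ln (y 0))"
      unfolding sum_distrib_left[symmetric] sum_lessThan_telescope[of "\<lambda>j. ln (y j)"] ..
    also have "ln (y k) - ln (y 0) = ln (1 + 1 / B)"
    proof -
      have "y k = y 0 * (1 + 1 / B)" using B k by (simp add: y_def field_simps)
      moreover have "1 + 1 / B > 0" using B by (intro add_pos_pos) auto
      ultimately show ?thesis using y[of 0] by (simp add: ln_mult_pos)
    qed
    finally show ?thesis .
  qed
  have e: "(\<Sum>j=1..k. 1 / y j) = (\<Sum>j<k. 1 / y (Suc j))"
    by (rule sum.reindex_bij_witness[of _ Suc "\<lambda>k. k - 1"]) auto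
  have lo: "(\<Sum>j=1..k. 1 / y j) \<le> real k * ln (1 + 1 / B)"
    unfolding e tel[symmetric] by (intro sum_mono s1)
  have hi: "real k * ln (1 + 1 / B) \<le> (\<Sum>j<k. 1 / y j)"
    unfolding tel[symmetric] by (intro sum_mono s2)
  have "(\<Sum>j<k. 1 / y (Suc j)) - (\<Sum>j<k. 1 / y j) = 1 / y k - 1 / y 0"
    unfolding sum_subtractf[symmetric] by (rule sum_lessThan_telescope)
  moreover have "1 / y k \<ge> 0" using y[of k] by simp
  moreover have "1 / y 0 = 1 / B" by (simp add: y_def)
  ultimately have "(\<Sum>j<k. 1 / y j) \<le> (\<Sum>j=1..k. 1 / y j) + 1 / B" unfolding e by linarith
  with lo hi show "\<bar>(\<Sum>j=1..k. 1 / (B + real j / real k)) - real k * ln (1 + 1 / B)\<bar> \<le> 1 / B"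
    "\<bar>(\<Sum>j<k. 1 / (B + real j / real k)) - real k * ln (1 + 1 / B)\<bar> \<le> 1 / B"
    unfolding y_def[symmetric] by linarith+
qed

lemma sum_gap_fun_bounds:
  assumes bc: "1 \<le> b" "b \<le> c" and k: "k \<ge> 1"
  shows "\<bar>(\<Sum>j=1..k. gap_fun b c (real j / real k)) - real k * gap_int b c\<bar> \<le> 2 / real b"
    "\<bar>(\<Sum>j<k. gap_fun b c (real j / real k)) - real k * gap_int b c\<bar> \<le> 2 / real b"
proof -
  have B: "1 \<le> real b" "1 \<le> real c + 1" using bc by auto
  have le: "1 / (real c + 1) \<le> 1 / real b" using bc by (intro divide_left_mono) auto
  note 1 = sum_inverse_shift_bounds[OF B(1) k] and 2 = sum_inverse_shift_bounds[OF B(2) k]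
  have tr: "\<bar>(A - A') - real k * gap_int b c\<bar> \<le> 2 / real b"
    if "\<bar>A - real k * ln (1 + 1 / real b)\<bar> \<le> 1 / real b" "\<bar>A' - real k * ln (1 + 1 / (real c + 1))\<bar> \<le> 1 / (real c + 1)" for A A'
  proof -
    have "2 / real b = 1 / real b + 1 / real b" by simp
    then show ?thesis using that le unfolding gap_int_def right_diff_distrib by linarith
  qed
  show "\<bar>(\<Sum>j=1..k. gap_fun b c (real j / real k)) - real k * gap_int b c\<bar> \<le> 2 / real b"
    unfolding gap_fun_def sum_subtractf using 1(1) 2(1) by (rule tr)
  show "\<bar>(\<Sum>j<k. gap_fun b c (real j / real k)) - real k * gap_int b c\<bar> \<le> 2 / real b"
    unfolding gap_fun_def sum_subtractf using 1(2) 2(2) by (rule tr)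
qed

text \<open>Coprimality is removed by Moebius inversion. A divisor \<open>e\<close> of
  \<open>q\<close> leaves a Riemann sum with \<open>q div e\<close> nodes, in error by at most
  \<open>2 / b\<close>; the main terms recombine to \<open>totient q\<close>, and the errors to the
  number of divisors, which is summable against \<open>1 / q ^ 2\<close>.\<close>

lemma sum_cf_lists_gap_fun:
  assumes bc: "1 \<le> b" "b \<le> c" and q: "q \<ge> 1"
  shows "\<bar>(\<Sum>u\<in>cf_lists q. gap_fun b c (real (cont_bl u) / real q)) - 2 * real (totient q) * gap_int b c\<bar>
    \<le> 4 / real b * real (card {e. e dvd q})"
proof -
  let ?h = "\<lambda>p. gap_fun b c (real p / real q)"
  have fin: "finite {e. e dvd q}" using q by auto
  have main: "\<bar>(\<Sum>p\<in>{p\<in>I. coprime p q}. ?h p) - real (totient q) * gap_int b c\<bar> \<le> real (card {e. e dvd q}) * (2 / real b)"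
    if I: "finite I" "\<And>e. e dvd q \<Longrightarrow> \<bar>(\<Sum>p\<in>{p\<in>I. e dvd p}. ?h p) - real (q div e) * gap_int b c\<bar> \<le> 2 / real b" for I
  proof -
    have "(\<Sum>p\<in>{p\<in>I. coprime p q}. ?h p) - real (totient q) * gap_int b c
        = (\<Sum>e | e dvd q. moebius e * ((\<Sum>p\<in>{p\<in>I. e dvd p}. ?h p) - real (q div e) * gap_int b c))"
      unfolding sum_coprime_moebius[OF I(1) q] totient_moebius[of q, OF less_le_trans[OF zero_less_one q]]
      by (simp add: right_diff_distrib sum_subtractf sum_distrib_right sum_distrib_left real_of_nat_div mult_ac)
    also have "\<bar>\<dots>\<bar> \<le> (\<Sum>e | e dvd q. 1 * (2 / real b))"
    proof (intro order.trans[OF sum_abs] sum_mono)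
      fix e assume "e \<in> {e. e dvd q}"
      then show "\<bar>moebius e * ((\<Sum>p\<in>{p\<in>I. e dvd p}. ?h p) - real (q div e) * gap_int b c)\<bar> \<le> 1 * (2 / real b)"
        unfolding abs_mult by (intro mult_mono abs_moebius_le I(2)) auto
    qed
    finally show ?thesis by simp
  qed
  have dp: "1 \<le> e \<and> 1 \<le> q div e \<and> q = e * (q div e)" if "e dvd q" for e
  proof -
    have "e \<ge> 1" "e \<le> q" using that q by (auto simp: Suc_le_eq dvd_pos_nat intro: dvd_imp_le)
    then show ?thesis using that by (simp add: Suc_le_eq div_greater_zero_iff)
  qed
  have frac: "real (e * j) / real q = real j / real (q div e)" if "e dvd q" for e j
  proof -
    have "real q = real e * real (q div e)" using dp[OF that] by (metis of_nat_mult)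
    then have "real (e * j) / real q = (real e * real j) / (real e * real (q div e))" by simp
    then show ?thesis using dp[OF that] by simp
  qed
  have 1: "\<bar>(\<Sum>p\<in>{p\<in>{1..q}. coprime p q}. ?h p) - real (totient q) * gap_int b c\<bar> \<le> real (card {e. e dvd q}) * (2 / real b)"
  proof (rule main)
    fix e assume e: "e dvd q"
    have "(\<Sum>p\<in>{p\<in>{1..q}. e dvd p}. ?h p) = (\<Sum>j=1..q div e. ?h (e * j))"
    proof (rule sum.reindex_bij_witness[of _ "\<lambda>j. e * j" "\<lambda>p. p div e"])
      fix p assume "p \<in> {p\<in>{1..q}. e dvd p}"
      then obtain j where "p = e * j" "1 \<le> p" "p \<le> q" by auto
      then show "e * (p div e) = p" "p div e \<in> {1..q div e}" "?h (e * (p div e)) = ?h p"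
        using dp[OF e] by (auto simp: div_le_mono intro: Nat.gr0I)
           (metis dp e div_le_mono less_le_trans nonzero_mult_div_cancel_left not_one_le_zero)
    next
      fix j assume j: "j \<in> {1..q div e}"
      then have "e * j \<le> e * (q div e)" by simp
      then show "e * j div e = j" "e * j \<in> {p\<in>{1..q}. e dvd p}" using dp[OF e] j by auto
    qed
    also have "\<dots> = (\<Sum>j=1..q div e. gap_fun b c (real j / real (q div e)))" unfolding frac[OF e] ..
    finally show "\<bar>(\<Sum>p\<in>{p\<in>{1..q}. e dvd p}. ?h p) - real (q div e) * gap_int b c\<bar> \<le> 2 / real b"
      using sum_gap_fun_bounds(1)[OF bc, of "q div e"] dp[OF e] by simp
  qed simp
  have 2: "\<bar>(\<Sum>p\<in>{p\<in>{..<q}. coprime p q}. ?h p) - real (totient q) * gap_int b c\<bar> \<le> real (card {e. e dvd q}) * (2 / real b)"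
  proof (rule main)
    fix e assume e: "e dvd q"
    have "(\<Sum>p\<in>{p\<in>{..<q}. e dvd p}. ?h p) = (\<Sum>j<q div e. ?h (e * j))"
    proof (rule sum.reindex_bij_witness[of _ "\<lambda>j. e * j" "\<lambda>p. p div e"])
      fix p assume "p \<in> {p\<in>{..<q}. e dvd p}"
      then obtain j where "p = e * j" "p < q" by auto
      then have "e * j < e * (q div e)" using dp[OF e] by simp
      then have "j < q div e" by simp
      then show "e * (p div e) = p" "p div e \<in> {..<q div e}" "?h (e * (p div e)) = ?h p"
        using dp[OF e] \<open>p = e * j\<close> by auto
    next
      fix j assume j: "j \<in> {..<q div e}"
      have "e * j < e * (q div e)" by (rule mult_less_mono2) (use j dp[OF e] in auto)
      then have "e * j < q" using e by (simp only: dvd_mult_div_cancel)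
      then show "e * j div e = j" "e * j \<in> {p\<in>{..<q}. e dvd p}" using dp[OF e] by auto
    qed
    also have "\<dots> = (\<Sum>j<q div e. gap_fun b c (real j / real (q div e)))" unfolding frac[OF e] ..
    finally show "\<bar>(\<Sum>p\<in>{p\<in>{..<q}. e dvd p}. ?h p) - real (q div e) * gap_int b c\<bar> \<le> 2 / real b"
      using sum_gap_fun_bounds(2)[OF bc, of "q div e"] dp[OF e] by simp
  qed simp
  have s: "{p\<in>{1..q}. coprime p q} = {p. 0 < p \<and> p \<le> q \<and> coprime p q}" "{p\<in>{..<q}. coprime p q} = {p. p < q \<and> coprime p q}"
    by auto
  have "4 / real b * real (card {e. e dvd q}) = real (card {e. e dvd q}) * (2 / real b) + real (card {e. e dvd q}) * (2 / real b)"
    by simp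
  then show ?thesis using 1 2 unfolding sum_cf_lists_cont_bl[OF q, of ?h] s by linarith
qed

lemma sum_divisor_count_le: "(\<Sum>q=1..Q. real (card {e. e dvd q}) / real q ^ 2) \<le> 4"
proof -
  have "(\<Sum>q=1..Q. real (card {e. e dvd q}) / real q ^ 2) = (\<Sum>q=1..Q. \<Sum>e | e dvd q. 1 / real e ^ 2 * (1 / real (q div e) ^ 2))"
  proof (intro sum.cong refl)
    fix q assume q: "q \<in> {1..Q}"
    have "(\<Sum>e | e dvd q. 1 / real e ^ 2 * (1 / real (q div e) ^ 2)) = (\<Sum>e | e dvd q. 1 / real q ^ 2)"
      using q by (intro sum.cong refl) (auto simp: real_of_nat_div field_simps)
    then show "real (card {e. e dvd q}) / real q ^ 2 = (\<Sum>e | e dvd q. 1 / real e ^ 2 * (1 / real (q div e) ^ 2))" by simp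
  qed
  also have "\<dots> = (\<Sum>e=1..Q. 1 / real e ^ 2 * (\<Sum>k=1..Q div e. 1 / real k ^ 2))"
    unfolding sum_divisors_swap[of "\<lambda>e k. 1 / real e ^ 2 * (1 / real k ^ 2)"] by (simp add: sum_distrib_left)
  also have "\<dots> \<le> (\<Sum>e=1..Q. 1 / real e ^ 2 * 2)"
    by (intro sum_mono mult_left_mono sum_inverse_squares_le) auto
  also have "\<dots> = (\<Sum>e=1..Q. 1 / real e ^ 2) * 2" by (rule sum_distrib_right[symmetric])
  also have "\<dots> \<le> 2 * 2" by (intro mult_right_mono sum_inverse_squares_le) auto
  finally show ?thesis by simp
qed

text \<open>The constant 56 is 4 * 4 from the Riemann sums plus 2 * 20 from the sum of
  \<open>totient n / n ^ 2\<close>.\<close>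

lemma main_sum_one:
  assumes bc: "1 \<le> b" "b \<le> c" and Q: "Q \<ge> 1"
  shows "\<bar>main_sum b c {1..Q} (\<lambda>_. 1) - cfrac_mu b c * ln (real Q)\<bar> \<le> 56 / real b"
proof -
  define \<Phi> where "\<Phi> = (\<Sum>n=1..Q. real (totient n) / real n ^ 2)"
  have "main_sum b c {1..Q} (\<lambda>_. 1) - 2 * gap_int b c * \<Phi>
     = (\<Sum>q=1..Q. ((\<Sum>u\<in>cf_lists q. gap_fun b c (real (cont_bl u) / real q)) - 2 * real (totient q) * gap_int b c) / real q ^ 2)"
    by (simp add: main_sum_def \<Phi>_def diff_divide_distrib sum_subtractf sum_divide_distrib sum_distrib_left mult_ac)
  also have "\<bar>\<dots>\<bar> \<le> (\<Sum>q=1..Q. 4 / real b * (real (card {e. e dvd q}) / real q ^ 2))"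
  proof (intro order.trans[OF sum_abs] sum_mono)
    fix q assume "q \<in> {1..Q}"
    then have "q \<ge> 1" by simp
    from divide_right_mono[OF sum_cf_lists_gap_fun[OF bc this], of "real q ^ 2"]
    show "\<bar>((\<Sum>u\<in>cf_lists q. gap_fun b c (real (cont_bl u) / real q)) - 2 * real (totient q) * gap_int b c) / real q ^ 2\<bar>
        \<le> 4 / real b * (real (card {e. e dvd q}) / real q ^ 2)" by (simp add: abs_divide)
  qed
  also have "\<dots> = 4 / real b * (\<Sum>q=1..Q. real (card {e. e dvd q}) / real q ^ 2)" by (rule sum_distrib_left[symmetric])
  also have "\<dots> \<le> 4 / real b * 4" by (intro mult_left_mono sum_divisor_count_le) auto
  finally have 1: "\<bar>main_sum b c {1..Q} (\<lambda>_. 1) - 2 * gap_int b c * \<Phi>\<bar> \<le> 16 / real b" by simp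
  have mu: "cfrac_mu b c * ln (real Q) = 2 * gap_int b c * (6 / pi\<^sup>2 * ln (real Q))"
    unfolding cfrac_mu_eq[OF bc] by simp
  have "\<bar>2 * gap_int b c * \<Phi> - cfrac_mu b c * ln (real Q)\<bar> = 2 * gap_int b c * \<bar>\<Phi> - 6 / pi\<^sup>2 * ln (real Q)\<bar>"
    unfolding mu right_diff_distrib[symmetric] abs_mult using gap_int_bounds[OF bc] by simp
  also have "\<dots> \<le> 2 * (1 / real b) * 20"
    unfolding \<Phi>_def using sum_totient_over_squares[OF Q] gap_int_bounds[OF bc] by (intro mult_mono) auto
  finally have 2: "\<bar>2 * gap_int b c * \<Phi> - cfrac_mu b c * ln (real Q)\<bar> \<le> 40 / real b" by simp
  have "56 / real b = 16 / real b + 40 / real b" by (simp add: add_divide_distrib[symmetric])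
  then show ?thesis using 1 2 by linarith
qed

text \<open>The symmetrized reciprocal is \<open>(2 * B + 1) / (B * (B + 1) + x * (1 - x))\<close>.
  As \<open>x * (1 - x)\<close> lies between 0 and 1/4, it lies between \<open>lo\<close> and
  \<open>hi\<close>, which are twice the midpoint and twice the trapezoidal value for the integral
  of 1 / y over [B, B + 1]. By convexity \<open>2 * ln (1 + 1 / B)\<close> lies there too, and
  \<open>hi - lo\<close> is of order 1 / B^3. This is applied with \<open>B = b\<close> and with
  \<open>B = c + 1\<close>.\<close>

lemma gap_fun_symmetrized_le:
  assumes bc: "1 \<le> b" "b \<le> c" and x: "0 \<le> x" "x \<le> 1"
  shows "gap_fun b c x + gap_fun b c (1 - x) \<le> 2 * gap_int b c + 1 / real b ^ 3"
proof -
  have key: "\<bar>1 / (B + x) + 1 / (B + (1 - x)) - 2 * ln (1 + 1 / B)\<bar> \<le> 1 / (2 * B ^ 3)" if B: "B \<ge> 1" for B :: real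
  proof -
    have e: "1 / (B + x) + 1 / (B + (1 - x)) = (2 * B + 1) / ((B + x) * (B + (1 - x)))"
      using B x by (simp add: field_simps)
    have prod: "(B + x) * (B + (1 - x)) = B * (B + 1) + x * (1 - x)" by (simp add: algebra_simps)
    have x0: "0 \<le> x * (1 - x)" using x by simp
    have "0 \<le> (x - 1/2) ^ 2" by simp
    then have x1: "x * (1 - x) \<le> 1 / 4" by (simp add: power2_eq_square algebra_simps)
    define lo where "lo = 4 / (2 * B + 1)"
    define hi where "hi = (2 * B + 1) / (B * (B + 1))"
    have pos: "B * (B + 1) > 0" using B by simp
    then have pos2: "B * (B + 1) + x * (1 - x) > 0" using x0 by linarith
    have up: "1 / (B + x) + 1 / (B + (1 - x)) \<le> hi" unfolding e hi_def prod
      using B x0 pos pos2 by (intro divide_left_mono mult_pos_pos) auto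
    have "lo = (2 * B + 1) / (B * (B + 1) + 1 / 4)"
    proof -
      have e': "B * (B + 1) + 1 / 4 = (2 * B + 1) * (2 * B + 1) / 4" by (simp add: algebra_simps)
      have "4 / (2 * B + 1) = (2 * B + 1) / ((2 * B + 1) * (2 * B + 1) / 4)"
        using B by simp (simp add: divide_simps)
      then show ?thesis unfolding lo_def e' .
    qed
    also have "\<dots> \<le> (2 * B + 1) / ((B + x) * (B + (1 - x)))" unfolding prod
      using B x0 x1 pos pos2 by (intro divide_left_mono mult_pos_pos) auto
    finally have low: "lo \<le> 1 / (B + x) + 1 / (B + (1 - x))" unfolding e .
    have lne: "ln (1 + 1 / B) = ln (B + 1) - ln B"
    proof -
      have "1 + 1 / B = (B + 1) / B" using B by (simp add: field_simps)
      then show ?thesis using B by (simp add: ln_div)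
    qed
    have "ln (B + 1) - ln B \<le> 1 * (inverse B + inverse (B + 1)) / 2" using B by (intro ln_inverse_approx_le) auto
    then have lu: "2 * ln (1 + 1 / B) \<le> hi" using B pos unfolding lne hi_def by (simp add: field_simps)
    have "ln (B + 1) - ln B \<ge> 2 * ((B + 1) - B) / (B + (B + 1))" using B by (intro ln_inverse_approx_ge) auto
    then have ll: "lo \<le> 2 * ln (1 + 1 / B)" unfolding lne lo_def by (simp add: mult_2[symmetric])
    have "hi - lo = 1 / (B * (B + 1) * (2 * B + 1))"
      using B unfolding hi_def lo_def by (simp add: divide_simps) (simp add: algebra_simps)
    also have "\<dots> \<le> 1 / (2 * B ^ 3)"
    proof (intro divide_left_mono mult_pos_pos)
      have "2 * B ^ 3 = B * B * (2 * B)" by (simp add: power3_eq_cube)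
      also have "\<dots> \<le> B * (B + 1) * (2 * B + 1)" using B by (intro mult_mono) auto
      finally show "2 * B ^ 3 \<le> B * (B + 1) * (2 * B + 1)" .
    qed (use B in auto)
    finally show ?thesis using up low lu ll by linarith
  qed
  have B: "1 \<le> real b" "1 \<le> real c + 1" using bc by auto
  have "1 / (2 * (real c + 1) ^ 3) \<le> 1 / (2 * real b ^ 3)"
    using bc by (intro divide_left_mono mult_left_mono power_mono mult_pos_pos) auto
  moreover have "1 / real b ^ 3 = 1 / (2 * real b ^ 3) + 1 / (2 * real b ^ 3)" by simp
  moreover have "A1 - C1 + (A2 - C2) \<le> 2 * (L - M) + T"
    if "A1 + A2 - 2 * L \<le> e1" "- (C1 + C2 - 2 * M) \<le> e2" "e2 \<le> e1" "T = e1 + e1" for A1 A2 C1 C2 L M e1 e2 T :: real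
    using that by (simp add: algebra_simps)
  ultimately show ?thesis
    using abs_le_D1[OF key[OF B(1)]] abs_le_D2[OF key[OF B(2)]] unfolding gap_fun_def gap_int_def by blast
qed

text \<open>Partial summation. The leading coefficient must be exact: in
  \<open>main_sum_quot_count_le\<close> it becomes half of a square, which cancels against the
  squared mean in the second moment.\<close>

lemma sum_totient_ln_le:
  assumes "Q \<ge> 1"
  shows "(\<Sum>n=1..Q. real (totient n) / real n ^ 2 * ln (real n)) \<le> 3 / pi\<^sup>2 * ln (real Q) ^ 2 + 40 * ln (real Q) + 1"
proof -
  define a where "a n = real (totient n) / real n ^ 2" for n
  define A where "A n = (\<Sum>k=1..n. a k)" for n
  define \<kappa> where "\<kappa> = 6 / pi\<^sup>2"
  have pi: "pi\<^sup>2 / 6 \<ge> 1" using zeta2_partial(1)[of 1] by simp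
  then have k: "0 \<le> \<kappa>" "\<kappa> \<le> 1" by (auto simp: \<kappa>_def divide_le_eq_1)
  have A: "\<bar>A n - \<kappa> * ln (real n)\<bar> \<le> 20" if "n \<ge> 1" for n
    using sum_totient_over_squares[OF that] by (simp add: A_def a_def \<kappa>_def)
  \<comment> \<open>The induction step uses s (t - s) = (t^2 - s^2) / 2 - (t - s)^2 / 2 for
    consecutive logarithms s and t. The last sum of the invariant collects the squares (t - s)^2 <=
    1 / n^2.\<close>
  have "(\<Sum>n=1..Q. a n * ln (real n)) \<le> A Q * ln (real Q) - \<kappa> / 2 * ln (real Q) ^ 2 + 20 * ln (real Q)
      + \<kappa> / 2 * (\<Sum>n=1..<Q. 1 / real n ^ 2)"
    using assms
  proof (induction Q rule: dec_induct)
    case (step n)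
    define s where "s = ln (real n)"
    define t where "t = ln (real (Suc n))"
    have n: "real n > 0" using step by simp
    have st: "s \<le> t" unfolding s_def t_def using n by simp
    have "ln (real (Suc n) / real n) \<le> real (Suc n) / real n - 1" using n by (intro ln_le_minus_one) auto
    also have "\<dots> = 1 / real n" using n by (simp add: field_simps)
    finally have "t - s \<le> 1 / real n" unfolding s_def t_def using n by (simp add: ln_div)
    then have "(t - s) ^ 2 \<le> (1 / real n) ^ 2" using st by (intro power_mono) auto
    then have sq: "(t - s) ^ 2 \<le> 1 / real n ^ 2" by (simp add: power_divide)
    have "A n \<ge> \<kappa> * s - 20" using A[of n] step unfolding s_def by linarith
    then have "(\<kappa> * s - 20) * (t - s) \<le> A n * (t - s)" using st by (intro mult_right_mono) auto
    moreover have "s * (t - s) = (t ^ 2 - s ^ 2) / 2 - (t - s) ^ 2 / 2" by (simp add: power2_eq_square field_simps)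
    ultimately have "\<kappa> * ((t ^ 2 - s ^ 2) / 2 - (t - s) ^ 2 / 2) - 20 * (t - s) \<le> A n * (t - s)"
      by (metis left_diff_distrib mult.assoc)
    moreover have "\<kappa> * (t - s) ^ 2 \<le> \<kappa> * (1 / real n ^ 2)" using sq k by (intro mult_left_mono) auto
    ultimately have main: "\<kappa> / 2 * t ^ 2 - \<kappa> / 2 * s ^ 2 - \<kappa> / 2 * (1 / real n ^ 2) - 20 * t + 20 * s \<le> A n * t - A n * s"
      by (simp add: algebra_simps diff_divide_distrib add_divide_distrib)
    have "A (Suc n) = A n + a (Suc n)" by (simp add: A_def)
    then have AS: "A (Suc n) * t = A n * t + a (Suc n) * t" by (simp add: distrib_right)
    have S: "(\<Sum>k=1..<Suc n. 1 / real k ^ 2) = (\<Sum>k=1..<n. 1 / real k ^ 2) + 1 / real n ^ 2" using step by simp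
    have "(\<Sum>k=1..Suc n. a k * ln (real k)) = (\<Sum>k=1..n. a k * ln (real k)) + a (Suc n) * t"
      by (simp add: t_def)
    then show ?case using step.IH main AS unfolding S t_def[symmetric] s_def[symmetric] distrib_left by linarith
  qed (simp add: A_def)
  also have "(\<Sum>n=1..<Q. 1 / real n ^ 2) \<le> 2"
  proof -
    have "(\<Sum>n=1..<Q. 1 / real n ^ 2) \<le> (\<Sum>n=1..Q. 1 / real n ^ 2)" by (intro sum_mono2) auto
    then show ?thesis using sum_inverse_squares_le[of Q] by linarith
  qed
  also have "A Q * ln (real Q) \<le> (\<kappa> * ln (real Q) + 20) * ln (real Q)"
    using A[OF assms] assms by (intro mult_right_mono) auto
  finally have "(\<Sum>n=1..Q. a n * ln (real n)) \<le> (\<kappa> * ln (real Q) + 20) * ln (real Q) - \<kappa> / 2 * ln (real Q) ^ 2 + 20 * ln (real Q) + \<kappa> / 2 * 2"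
    using k by (simp add: mult_left_mono)
  also have "\<dots> = \<kappa> / 2 * ln (real Q) ^ 2 + 40 * ln (real Q) + \<kappa>" by (simp add: power2_eq_square algebra_simps)
  finally have "(\<Sum>n=1..Q. a n * ln (real n)) \<le> \<kappa> / 2 * ln (real Q) ^ 2 + 40 * ln (real Q) + 1" using k by linarith
  then show ?thesis by (simp add: a_def \<kappa>_def)
qed

section \<open>Partial quotients in the first half, the second half, and the middle\<close>

definition good_idx :: "nat \<Rightarrow> nat \<Rightarrow> nat list \<Rightarrow> nat set" where
  "good_idx b c w = {j. j < length w \<and> b \<le> w ! j \<and> w ! j \<le> c}"

definition quot_count :: "nat \<Rightarrow> nat \<Rightarrow> nat list \<Rightarrow> real" where
  "quot_count b c w = real (card (good_idx b c w))"

definition mid_count :: "nat \<Rightarrow> nat \<Rightarrow> nat \<Rightarrow> nat list \<Rightarrow> real" where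
  "mid_count b c Q w = real (card {j\<in>good_idx b c w. Q < cont (take j w) \<and> Q < cont (drop (Suc j) w)})"

definition both_count :: "nat \<Rightarrow> nat \<Rightarrow> nat \<Rightarrow> nat list \<Rightarrow> real" where
  "both_count b c Q w = real (card {j\<in>good_idx b c w. cont (take j w) \<le> Q \<and> cont (drop (Suc j) w) \<le> Q})"

lemma finite_good_idx [simp]: "finite (good_idx b c w)"
  by (simp add: good_idx_def)

lemma count_quotients_eq: "real (count_quotients b c x) = quot_count b c (partial_quotients x)"
  by (simp add: count_quotients_def quot_count_def good_idx_def Let_def)

lemma split_sum_alt: "split_sum b c A wt w = (\<Sum>j\<in>{j\<in>good_idx b c w. cont (take j w) \<in> A}. wt (take j w))"
  unfolding split_sum_def good_idx_def by (intro sum.cong) auto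

lemma quot_count_nonneg: "0 \<le> quot_count b c w"
  by (simp add: quot_count_def)

lemma quot_count_le_length: "quot_count b c w \<le> real (length w)"
proof -
  have "card (good_idx b c w) \<le> card {..<length w}" by (intro card_mono) (auto simp: good_idx_def)
  then show ?thesis by (simp add: quot_count_def)
qed

text \<open>The constant 4 is 2 * (3/2) + 1: the 3/2 comes from \<open>ln 2 >= 2/3\<close>, the rest
  from \<open>length w <= 2 * (length w div 2) + 1\<close> and \<open>ln N >= 1\<close>.\<close>

lemma length_cf_lists_le:
  assumes N: "N \<ge> 3" "M \<le> N" and w: "w \<in> cf_lists M"
  shows "real (length w) \<le> 4 * ln (real N)"
proof -
  have "2 ^ (length w div 2) \<le> M" using w cont_ge_power[of w] by (simp add: cf_lists_def)
  then have "2 ^ (length w div 2) \<le> N" using N by linarith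
  then have "real (2 ^ (length w div 2)) \<le> real N" by (rule of_nat_mono)
  then have "ln (2 ^ (length w div 2)) \<le> ln (real N)" by (subst ln_le_cancel_iff) (use N in auto)
  then have k: "real (length w div 2) * ln 2 \<le> ln (real N)" by (simp add: ln_realpow)
  have "real (length w div 2) * (2 / 3) \<le> real (length w div 2) * ln 2"
    by (intro mult_left_mono ln2_ge_two_thirds) auto
  with k have "real (length w div 2) \<le> 3 / 2 * ln (real N)" by linarith
  moreover have "length w \<le> 2 * (length w div 2) + 1" by linarith
  moreover have "ln (real N) \<ge> 1" using N exp_le by (subst ln_ge_iff) auto
  ultimately show ?thesis by linarith
qed

lemma quot_count_le_ln: "w \<in> cf_lists M \<Longrightarrow> M \<le> N \<Longrightarrow> N \<ge> 3 \<Longrightarrow> quot_count b c w \<le> 4 * ln (real N)"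
  using quot_count_le_length[of b c w] length_cf_lists_le[of N M w] by linarith

text \<open>Position \<open>j\<close> of \<open>w\<close> becomes position
  \<open>length w - Suc j\<close> of \<open>rev w\<close>, and its prefix there is the reversed
  suffix behind \<open>j\<close>, with the same continuant.\<close>

lemma split_sum_rev:
  assumes "poslist w"
  shows "split_sum b c {1..Q} (\<lambda>_. 1) (rev w) = real (card {j\<in>good_idx b c w. cont (drop (Suc j) w) \<le> Q})"
proof -
  have "split_sum b c {1..Q} (\<lambda>_. 1) (rev w) = real (card {j\<in>good_idx b c (rev w). cont (take j (rev w)) \<in> {1..Q}})"
    by (simp add: split_sum_alt)
  also have "card {j\<in>good_idx b c (rev w). cont (take j (rev w)) \<in> {1..Q}}
      = card {j\<in>good_idx b c w. cont (drop (Suc j) w) \<le> Q}"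
  proof (rule bij_betw_same_card[where f = "\<lambda>j. length w - Suc j"],
      rule bij_betw_byWitness[where f' = "\<lambda>j. length w - Suc j"])
    have pd: "1 \<le> cont (drop j w)" for j using assms by (intro cont_pos) (auto simp: poslist_def dest: in_set_dropD)
    show "(\<lambda>j. length w - Suc j) ` {j\<in>good_idx b c (rev w). cont (take j (rev w)) \<in> {1..Q}}
        \<subseteq> {j\<in>good_idx b c w. cont (drop (Suc j) w) \<le> Q}"
      by (auto simp: good_idx_def rev_nth take_rev Suc_diff_Suc)
    show "(\<lambda>j. length w - Suc j) ` {j\<in>good_idx b c w. cont (drop (Suc j) w) \<le> Q}
        \<subseteq> {j\<in>good_idx b c (rev w). cont (take j (rev w)) \<in> {1..Q}}"
      using pd by (auto simp: good_idx_def rev_nth take_rev Suc_diff_Suc)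
  qed (auto simp: good_idx_def)
  finally show ?thesis .
qed

lemma split_sum_one:
  assumes "poslist w"
  shows "split_sum b c {1..Q} (\<lambda>_. 1) w = real (card {j\<in>good_idx b c w. cont (take j w) \<le> Q})"
proof -
  have "1 \<le> cont (take j w)" for j using assms by (intro cont_pos) (auto simp: poslist_def dest: in_set_takeD)
  then have "{j\<in>good_idx b c w. cont (take j w) \<in> {1..Q}} = {j\<in>good_idx b c w. cont (take j w) \<le> Q}" by auto
  then show ?thesis by (simp add: split_sum_alt)
qed

text \<open>Inclusion and exclusion for the positions with a short prefix and those with a short
  suffix; \<open>mid_count\<close> collects the positions in neither set, \<open>both_count\<close>
  those counted twice.\<close>

lemma quot_count_decomp:
  assumes "poslist w"
  shows "quot_count b c w + both_count b c Q w = split_sum b c {1..Q} (\<lambda>_. 1) w + split_sum b c {1..Q} (\<lambda>_. 1) (rev w) + mid_count b c Q w"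
proof -
  define G where "G = good_idx b c w"
  define X where "X = {j\<in>G. cont (take j w) \<le> Q}"
  define Y where "Y = {j\<in>G. cont (drop (Suc j) w) \<le> Q}"
  define Z where "Z = {j\<in>G. Q < cont (take j w) \<and> Q < cont (drop (Suc j) w)}"
  have fin: "finite G" "finite X" "finite Y" "finite Z" by (auto simp: G_def X_def Y_def Z_def)
  have "card (X \<union> Y) + card Z = card ((X \<union> Y) \<union> Z)"
    by (rule card_Un_disjoint[symmetric]) (use fin in \<open>auto simp: X_def Y_def Z_def\<close>)
  also have "(X \<union> Y) \<union> Z = G" by (auto simp: X_def Y_def Z_def)
  finally have "card G = card (X \<union> Y) + card Z" ..
  moreover have "card X + card Y = card (X \<union> Y) + card (X \<inter> Y)" using fin by (intro card_Un_Int) auto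
  moreover have "X \<inter> Y = {j\<in>G. cont (take j w) \<le> Q \<and> cont (drop (Suc j) w) \<le> Q}" by (auto simp: X_def Y_def)
  ultimately show ?thesis
    unfolding split_sum_one[OF assms] split_sum_rev[OF assms] quot_count_def mid_count_def both_count_def
      G_def[symmetric] X_def[symmetric] Y_def[symmetric] Z_def[symmetric] by simp
qed

lemma cont_split_bounds:
  assumes "poslist w" "j < length w"
  shows "cont (take j w) * (w ! j * cont (drop (Suc j) w)) \<le> cont w"
    "cont w \<le> (w ! j + 2) * (cont (take j w) * cont (drop (Suc j) w))"
proof -
  let ?u = "take j w" and ?v = "drop (Suc j) w" and ?m = "w ! j"
  have w: "w = ?u @ ?m # ?v" using assms(2) by (simp add: id_take_nth_drop[symmetric])
  have p: "poslist ?u" "poslist ?v" using assms(1) by (auto simp: poslist_def dest: in_set_takeD in_set_dropD)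
  have c: "cont w = cont ?u * (?m * cont ?v + cont_tl ?v) + cont_bl ?u * cont ?v"
    by (subst w, subst cont_append) simp
  show "cont ?u * (?m * cont ?v) \<le> cont w" unfolding c by (simp add: distrib_left)
  have "cont ?u * cont_tl ?v \<le> cont ?u * cont ?v" "cont_bl ?u * cont ?v \<le> cont ?u * cont ?v"
    using cont_tl_le[OF p(2)] cont_bl_le[OF p(1)] by (auto intro: mult_le_mono)
  moreover have "(?m + 2) * (cont ?u * cont ?v) = cont ?u * (?m * cont ?v) + (cont ?u * cont ?v + cont ?u * cont ?v)"
    by (simp add: algebra_simps)
  ultimately show "cont w \<le> (?m + 2) * (cont ?u * cont ?v)" unfolding c distrib_left by linarith
qed

lemma sum_inverse_le_ln:
  assumes "1 \<le> Q" "Q \<le> Y"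
  shows "(\<Sum>q\<in>{Q<..Y}. 1 / real q) \<le> ln (real Y) - ln (real Q)"
  using assms(2)
proof (induction Y rule: dec_induct)
  case (step n)
  have n: "real n > 0" using step assms by simp
  have "ln (real n / real (Suc n)) \<le> real n / real (Suc n) - 1" using n by (intro ln_le_minus_one) auto
  also have "\<dots> = - (1 / real (Suc n))" by (simp add: field_simps)
  finally have "1 / real (Suc n) \<le> ln (real (Suc n)) - ln (real n)" using n by (simp add: ln_divide_pos)
  moreover have "{Q<..Suc n} = insert (Suc n) {Q<..n}" using step by auto
  ultimately show ?case using step by simp
qed simp

text \<open>Since \<open>b K(u) K(v) \<le> N\<close>, one of the two continuants is at most \<open>sqrt (N / b)\<close>; for such
  \<open>q\<close> the bounded counting error is dominated by \<open>N / (b * q\<^sup>2) \<ge> 1\<close>.\<close>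

lemma sum_mid_count_le:
  assumes b: "b \<ge> 1" and N: "N \<ge> 1" and Q: "Q \<ge> 1" "real Q ^ 2 \<le> real N"
  shows "(\<Sum>w\<in>cf_lists N. mid_count b c Q w) \<le> 32 * real N / real b * (ln (real N) / 2 - ln (real Q))"
proof -
  define A where "A = {q. Q < q \<and> q * q * b \<le> N}"
  define Y where "Y = nat \<lfloor>sqrt (real N)\<rfloor>"
  have AY: "A \<subseteq> {Q<..Y}"
  proof
    fix q assume q: "q \<in> A"
    have "q * q \<le> q * q * b" using b by simp
    moreover have "q * q * b \<le> N" using q by (simp add: A_def)
    ultimately have "q * q \<le> N" by (rule order.trans)
    then have "real (q * q) \<le> real N" by (rule of_nat_mono)
    then have "real q \<le> sqrt (real N)" by (intro real_le_rsqrt) (simp add: power2_eq_square)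
    then have "q \<le> Y" unfolding Y_def by (simp add: le_nat_floor)
    then show "q \<in> {Q<..Y}" using q by (simp add: A_def)
  qed
  then have finA: "finite A" by (rule finite_subset) simp
  have QY: "Q \<le> Y" unfolding Y_def using Q(2) by (simp add: le_nat_floor real_le_rsqrt)
  have lm: "mid_count b c Q w \<le> split_sum b c A (\<lambda>_. 1) w + split_sum b c A (\<lambda>_. 1) (rev w)" if w: "w \<in> cf_lists N" for w
  proof -
    have pw: "poslist w" "cont w = N" using w by (auto simp: cf_lists_def)
    define X where "X = {j\<in>good_idx b c w. cont (take j w) \<in> A}"
    define Y where "Y = {j\<in>good_idx b c w. cont (drop (Suc j) w) \<in> A}"
    have "{j\<in>good_idx b c w. Q < cont (take j w) \<and> Q < cont (drop (Suc j) w)} \<subseteq> X \<union> Y"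
    proof
      fix j assume j: "j \<in> {j\<in>good_idx b c w. Q < cont (take j w) \<and> Q < cont (drop (Suc j) w)}"
      let ?x = "cont (take j w)" and ?y = "cont (drop (Suc j) w)"
      have jl: "j < length w" "b \<le> w ! j" using j by (auto simp: good_idx_def)
      have "?x * ?y * b \<le> ?x * ?y * w ! j" using jl by (intro mult_le_mono2)
      also have "\<dots> \<le> N" using cont_split_bounds(1)[OF pw(1) jl(1)] pw(2) by (simp add: mult_ac)
      finally have le: "?x * ?y * b \<le> N" .
      show "j \<in> X \<union> Y"
      proof (cases "?x \<le> ?y")
        case True
        then have "?x * ?x * b \<le> ?x * ?y * b" by (intro mult_le_mono) auto
        then have "?x * ?x * b \<le> N" using le by (rule order.trans)
        then show ?thesis using j by (simp add: X_def A_def)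
      next
        case False
        then have "?y * ?y * b \<le> ?x * ?y * b" by (intro mult_le_mono) auto
        then have "?y * ?y * b \<le> N" using le by (rule order.trans)
        then show ?thesis using j by (simp add: Y_def A_def)
      qed
    qed
    then have "card {j\<in>good_idx b c w. Q < cont (take j w) \<and> Q < cont (drop (Suc j) w)} \<le> card (X \<union> Y)"
      by (intro card_mono) (auto simp: X_def Y_def)
    also have "\<dots> \<le> card X + card Y" by (rule card_Un_le)
    finally have 1: "mid_count b c Q w \<le> real (card X) + real (card Y)" unfolding mid_count_def by linarith
    have "card {j\<in>good_idx b c (rev w). cont (take j (rev w)) \<in> A} = card Y"
    proof (rule bij_betw_same_card[where f = "\<lambda>j. length w - Suc j"],
        rule bij_betw_byWitness[where f' = "\<lambda>j. length w - Suc j"])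
      show "(\<lambda>j. length w - Suc j) ` {j\<in>good_idx b c (rev w). cont (take j (rev w)) \<in> A} \<subseteq> Y"
        by (auto simp: Y_def good_idx_def rev_nth take_rev Suc_diff_Suc)
      show "(\<lambda>j. length w - Suc j) ` Y \<subseteq> {j\<in>good_idx b c (rev w). cont (take j (rev w)) \<in> A}"
        by (auto simp: Y_def good_idx_def rev_nth take_rev Suc_diff_Suc)
    qed (auto simp: Y_def good_idx_def)
    then show ?thesis using 1 by (simp add: split_sum_alt X_def)
  qed
  have "(\<Sum>w\<in>cf_lists N. mid_count b c Q w) \<le> (\<Sum>w\<in>cf_lists N. split_sum b c A (\<lambda>_. 1) w + split_sum b c A (\<lambda>_. 1) (rev w))"
    by (intro sum_mono lm)
  also have "\<dots> = 2 * (\<Sum>w\<in>cf_lists N. split_sum b c A (\<lambda>_. 1) w)"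
    by (simp add: sum.distrib sum_cf_lists_rev)
  also have "(\<Sum>w\<in>cf_lists N. split_sum b c A (\<lambda>_. 1) w) = (\<Sum>q\<in>A. \<Sum>u\<in>cf_lists q. real (card (mv_set b c u N)))"
    unfolding split_sum_def using sum_splits[OF finA b, where M = N and c = c and wt = "\<lambda>_. 1"] by simp
  also have "\<dots> \<le> (\<Sum>q\<in>A. 16 * real N / real b * (1 / real q))"
  proof (rule sum_mono)
    fix q assume q: "q \<in> A"
    then have q1: "q \<ge> 1" "q * q * b \<le> N" using Q by (auto simp: A_def)
    have "real (q * q * b) \<le> real N" using q1(2) by (rule of_nat_mono)
    then have "real q \<le> real N / (real b * real q)" using b q1 by (simp add: field_simps)
    then have "4 * real N / (real b * real q) + 12 * real q \<le> 16 * real N / real b * (1 / real q)" by simp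
    then show "(\<Sum>u\<in>cf_lists q. real (card (mv_set b c u N))) \<le> 16 * real N / real b * (1 / real q)"
      using sum_card_mv_upper[OF b N q1(1), of c] by linarith
  qed
  also have "\<dots> = 16 * real N / real b * (\<Sum>q\<in>A. 1 / real q)" by (rule sum_distrib_left[symmetric])
  also have "\<dots> \<le> 16 * real N / real b * (ln (real N) / 2 - ln (real Q))"
  proof (intro mult_left_mono)
    have "(\<Sum>q\<in>A. 1 / real q) \<le> (\<Sum>q\<in>{Q<..Y}. 1 / real q)" using AY by (intro sum_mono2) auto
    also have "\<dots> \<le> ln (real Y) - ln (real Q)" using Q(1) QY by (rule sum_inverse_le_ln)
    also have "ln (real Y) \<le> ln (sqrt (real N))"
      using QY Q(1) N unfolding Y_def by (subst ln_le_cancel_iff) auto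
    also have "ln (sqrt (real N)) = ln (real N) / 2" using N by (simp add: ln_sqrt)
    finally show "(\<Sum>q\<in>A. 1 / real q) \<le> ln (real N) / 2 - ln (real Q)" by simp
  qed simp
  finally show ?thesis by simp
qed

text \<open>A block between the first middle position \<open>i\<close> and the last one
  \<open>j\<close> has continuant at least \<open>2 ^ ((j - i) div 2)\<close>. Together with the
  prefix before \<open>i\<close> and the suffix behind \<open>j\<close>, both of continuant above
  \<open>Q\<close>, it must fit into \<open>N\<close>. This pointwise bound complements the mean
  bound when \<open>mid_count\<close> is squared.\<close>

lemma mid_count_le:
  assumes N: "N \<ge> 1" and b: "b \<ge> 1" and Q: "Q \<ge> 1" "real Q ^ 2 \<le> real N" and w: "w \<in> cf_lists N"
  shows "mid_count b c Q w \<le> 6 * (ln (real N) / 2 - ln (real Q)) + 2"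
proof -
  define J where "J = {j\<in>good_idx b c w. Q < cont (take j w) \<and> Q < cont (drop (Suc j) w)}"
  have pw: "poslist w" "cont w = N" using w by (auto simp: cf_lists_def)
  have lnQ: "ln (real Q) \<le> ln (real N) / 2"
  proof -
    have "ln (real Q ^ 2) \<le> ln (real N)" using Q N by (subst ln_le_cancel_iff) auto
    then show ?thesis using Q by (simp add: ln_realpow)
  qed
  show ?thesis
  proof (cases "J = {}")
    case True
    then show ?thesis using lnQ unfolding mid_count_def J_def[symmetric] by simp
  next
    case False
    have fin: "finite J" by (simp add: J_def)
    define i where "i = Min J"
    define j where "j = Max J"
    have ij: "i \<in> J" "j \<in> J" "i \<le> j" using fin False by (auto simp: i_def j_def)
    have jl: "j < length w" "b \<le> w ! j" using ij by (auto simp: J_def good_idx_def)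
    have "take j w = take i w @ take (j - i) (drop i w)"
      using ij(3) by (metis le_add_diff_inverse take_add)
    then have c: "cont (take i w) * cont (take (j - i) (drop i w)) \<le> cont (take j w)" by (simp add: cont_ge_mult)
    have len: "length (take (j - i) (drop i w)) = j - i" using jl ij by simp
    have "poslist (take (j - i) (drop i w))" using pw(1) by (auto simp: poslist_def dest!: in_set_takeD in_set_dropD)
    from cont_ge_power[OF this] have p: "2 ^ ((j - i) div 2) \<le> cont (take (j - i) (drop i w))" unfolding len .
    have "Q * 2 ^ ((j - i) div 2) * Q \<le> cont (take j w) * cont (drop (Suc j) w)"
    proof (rule mult_le_mono)
      have "Q * 2 ^ ((j - i) div 2) \<le> cont (take i w) * cont (take (j - i) (drop i w))"
        using ij(1) p by (intro mult_le_mono) (auto simp: J_def)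
      then show "Q * 2 ^ ((j - i) div 2) \<le> cont (take j w)" using c by linarith
      show "Q \<le> cont (drop (Suc j) w)" using ij(2) by (simp add: J_def)
    qed
    also have "\<dots> \<le> cont (take j w) * (w ! j * cont (drop (Suc j) w))"
      using jl b by (intro mult_le_mono) auto
    also have "\<dots> \<le> N" using cont_split_bounds(1)[OF pw(1) jl(1)] pw(2) by simp
    finally have "real (Q * 2 ^ ((j - i) div 2) * Q) \<le> real N" by (rule of_nat_mono)
    then have "ln (real Q ^ 2 * 2 ^ ((j - i) div 2)) \<le> ln (real N)"
      using Q N by (subst ln_le_cancel_iff) (auto simp: power2_eq_square mult_ac)
    then have 0: "2 * ln (real Q) + real ((j - i) div 2) * ln 2 \<le> ln (real N)"
      using Q by (simp add: ln_mult_pos ln_realpow)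
    define t where "t = real ((j - i) div 2)"
    have "t * (2 / 3) \<le> t * ln 2"
      by (intro mult_left_mono ln2_ge_two_thirds) (auto simp: t_def)
    then have "t \<le> 3 * (ln (real N) / 2 - ln (real Q))" using 0[folded t_def] by (simp add: field_simps)
    then have 1: "real ((j - i) div 2) \<le> 3 * (ln (real N) / 2 - ln (real Q))" unfolding t_def .
    have "card J \<le> card {i..j}" using fin by (intro card_mono) (auto simp: i_def j_def)
    also have "\<dots> \<le> 2 * ((j - i) div 2) + 2" using ij by simp
    finally have "mid_count b c Q w \<le> 2 * real ((j - i) div 2) + 2" unfolding mid_count_def J_def[symmetric] by linarith
    then show ?thesis using 1 by linarith
  qed
qed

text \<open>If both continuants are at most \<open>Q\<close>, the partial quotient between them must be huge.\<close>

lemma sum_both_count_le: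
  assumes N: "N \<ge> 1" and B: "B \<ge> 1" "(B + 2) * (Q * Q) \<le> N" and Q: "Q \<ge> 1" and b: "b \<ge> 1"
  shows "(\<Sum>w\<in>cf_lists N. both_count b c Q w) \<le> 4 * real N / real B * (1 + ln (real Q)) + 12 * real Q ^ 2"
proof -
  have lb: "both_count b c Q w \<le> split_sum B c {1..Q} (\<lambda>_. 1) w" if w: "w \<in> cf_lists N" for w
  proof -
    have pw: "poslist w" "cont w = N" using w by (auto simp: cf_lists_def)
    have "{j\<in>good_idx b c w. cont (take j w) \<le> Q \<and> cont (drop (Suc j) w) \<le> Q} \<subseteq> {j\<in>good_idx B c w. cont (take j w) \<le> Q}"
    proof
      fix j assume j: "j \<in> {j\<in>good_idx b c w. cont (take j w) \<le> Q \<and> cont (drop (Suc j) w) \<le> Q}"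
      then have jl: "j < length w" by (simp add: good_idx_def)
      have "(B + 2) * (Q * Q) \<le> (w ! j + 2) * (cont (take j w) * cont (drop (Suc j) w))"
        using B(2) cont_split_bounds(2)[OF pw(1) jl] pw(2) by linarith
      also have "\<dots> \<le> (w ! j + 2) * (Q * Q)" using j by (intro mult_le_mono) auto
      finally have "B \<le> w ! j" using Q by simp
      then show "j \<in> {j\<in>good_idx B c w. cont (take j w) \<le> Q}" using j by (simp add: good_idx_def)
    qed
    then show ?thesis unfolding both_count_def split_sum_one[OF pw(1)] by (intro of_nat_mono card_mono) auto
  qed
  have "(\<Sum>w\<in>cf_lists N. both_count b c Q w) \<le> (\<Sum>w\<in>cf_lists N. split_sum B c {1..Q} (\<lambda>_. 1) w)" by (intro sum_mono lb)
  also have "\<dots> = (\<Sum>q\<in>{1..Q}. \<Sum>u\<in>cf_lists q. real (card (mv_set B c u N)))"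
    unfolding split_sum_def using sum_splits[of "{1..Q}" B, where M = N and c = c and wt = "\<lambda>_. 1"] B by simp
  also have "\<dots> \<le> (\<Sum>q\<in>{1..Q}. 4 * real N / real B * (1 / real q) + 12 * real Q)"
  proof (rule sum_mono)
    fix q assume q: "q \<in> {1..Q}"
    then have "(\<Sum>u\<in>cf_lists q. real (card (mv_set B c u N))) \<le> 4 * real N / (real B * real q) + 12 * real q"
      by (intro sum_card_mv_upper B N) auto
    then show "(\<Sum>u\<in>cf_lists q. real (card (mv_set B c u N))) \<le> 4 * real N / real B * (1 / real q) + 12 * real Q"
      using q by simp
  qed
  also have "\<dots> = 4 * real N / real B * (\<Sum>q\<in>{1..Q}. 1 / real q) + 12 * real Q ^ 2"
    by (simp add: sum.distrib sum_distrib_left power2_eq_square)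
  also have "(\<Sum>q\<in>{1..Q}. 1 / real q) = harm Q" by (simp add: harm_def inverse_eq_divide)
  also have "4 * real N / real B * harm Q \<le> 4 * real N / real B * (1 + ln (real Q))"
    using harm_bounds(2)[OF Q] by (intro mult_left_mono) auto
  finally show ?thesis by simp
qed

lemma quot_count_append: "quot_count b c (x @ y) = quot_count b c x + quot_count b c y"
proof -
  have e: "quot_count b c w = real (length (filter (\<lambda>a. b \<le> a \<and> a \<le> c) w))" for w
    by (simp add: quot_count_def good_idx_def length_filter_conv_card)
  show ?thesis unfolding e by simp
qed

lemma quot_count_Nil [simp]: "quot_count b c [] = 0"
  and quot_count_Cons: "quot_count b c (a # v) = (if b \<le> a \<and> a \<le> c then 1 else 0) + quot_count b c v"
proof -
  have e: "quot_count b c w = real (length (filter (\<lambda>a. b \<le> a \<and> a \<le> c) w))" for w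
    by (simp add: quot_count_def good_idx_def length_filter_conv_card)
  show "quot_count b c [] = 0" "quot_count b c (a # v) = (if b \<le> a \<and> a \<le> c then 1 else 0) + quot_count b c v"
    unfolding e by auto
qed

text \<open>The summand \<open>1 / b\<close> pays for the new final entry 1, which is counted only
  when \<open>b = 1\<close>; replacing the last entry by its predecessor matters only if that entry
  is at least \<open>b\<close>.\<close>

lemma quot_count_twin:
  assumes w: "w \<in> canon_lists N" and N: "N \<ge> 2" and b: "b \<ge> 1"
  shows "\<bar>quot_count b c (twin w) - quot_count b c w\<bar> \<le> 1 / real b + (if b \<le> last w then 1 else 0)"
    "w \<noteq> []"
proof -
  obtain x a where wx: "w = x @ [a]" "a \<ge> 2"
    using assms by (cases w rule: rev_exhaust) (auto simp: canon_lists_def cf_lists_def canonical_iff)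
  then show "w \<noteq> []" by simp
  have d: "quot_count b c (twin w) - quot_count b c w = (if b \<le> a - 1 \<and> a - 1 \<le> c then 1 else 0)
      + (if b \<le> 1 \<and> 1 \<le> c then 1 else 0) - (if b \<le> a \<and> a \<le> c then 1 else 0)"
    unfolding wx twin_snoc by (simp add: quot_count_append quot_count_Cons)
  show "\<bar>quot_count b c (twin w) - quot_count b c w\<bar> \<le> 1 / real b + (if b \<le> last w then 1 else 0)"
  proof (cases "b = 1")
    case True
    then show ?thesis unfolding d using wx by auto
  next
    case False
    then have "b \<ge> 2" using b by simp
    moreover have "(-1::real) \<le> 1 / real b" by (rule order.trans[of _ 0]) auto
    ultimately show ?thesis unfolding d using wx by auto
  qed
qed

text \<open>Reversal moves the last entry to the front, where it is a marked partial quotient with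
  empty prefix, of continuant 1. The upper limit \<open>N\<close> is no restriction, because every
  entry is at most the continuant.\<close>

lemma card_last_ge:
  assumes b: "b \<ge> 1" and N: "N \<ge> 1"
  shows "real (card {w\<in>cf_lists N. w \<noteq> [] \<and> b \<le> last w}) \<le> 2 * (real N / real b + 3)"
proof -
  have "card {w\<in>cf_lists N. w \<noteq> [] \<and> b \<le> last w} = card {w\<in>cf_lists N. w \<noteq> [] \<and> b \<le> hd w}"
    by (rule bij_betw_same_card[of rev], rule bij_betw_byWitness[where f' = rev])
      (auto simp: cf_lists_def hd_rev last_rev)
  also have "\<dots> = card (mv_set b N [] N)"
  proof (rule bij_betw_same_card[where f = "\<lambda>w. (hd w, tl w)"], rule bij_betw_byWitness[where f' = "\<lambda>(m,v). m # v"])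
    show "(\<lambda>w. (hd w, tl w)) ` {w\<in>cf_lists N. w \<noteq> [] \<and> b \<le> hd w} \<subseteq> mv_set b N [] N"
    proof
      fix z assume "z \<in> (\<lambda>w. (hd w, tl w)) ` {w\<in>cf_lists N. w \<noteq> [] \<and> b \<le> hd w}"
      then obtain m v where z: "z = (m, v)" "m # v \<in> cf_lists N" "b \<le> m" by (auto simp: neq_Nil_conv)
      have "m \<le> N" using z(2) cont_ge_elem[of "m # v" m] by (simp add: cf_lists_def)
      then show "z \<in> mv_set b N [] N" using z by (simp add: mv_set_def cf_lists_def)
    qed
    show "(\<lambda>(m,v). m # v) ` mv_set b N [] N \<subseteq> {w\<in>cf_lists N. w \<noteq> [] \<and> b \<le> hd w}"
      using b by (auto simp: mv_set_def cf_lists_def)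
  qed auto
  also have "real (card (mv_set b N [] N)) \<le> 2 * (real N / (real b * real (cont []) ^ 2) + 3)"
    by (rule card_mv_set_upper[OF _ b N]) simp
  finally show ?thesis by simp
qed

text \<open>The counting treats both expansions together, whereas the theorem speaks of the
  canonical one. The constant 9 is 1 + 2 + 6, the bounded term 6 being absorbed by
  \<open>1 <= N / b\<close>.\<close>

lemma sum_canon_lists_noncanon_lists_diff:
  assumes b: "b \<ge> 1" "b \<le> N" and N: "N \<ge> 2"
  shows "\<bar>(\<Sum>w\<in>canon_lists N. quot_count b c w) - (\<Sum>w\<in>noncanon_lists N. quot_count b c w)\<bar> \<le> 9 * real N / real b"
proof -
  have "(\<Sum>w\<in>noncanon_lists N. quot_count b c w) = (\<Sum>w\<in>canon_lists N. quot_count b c (twin w))"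
    by (rule sum.reindex_bij_betw[OF bij_betw_twin[OF N], symmetric])
  then have "\<bar>(\<Sum>w\<in>canon_lists N. quot_count b c w) - (\<Sum>w\<in>noncanon_lists N. quot_count b c w)\<bar> = \<bar>\<Sum>w\<in>canon_lists N. quot_count b c (twin w) - quot_count b c w\<bar>"
    by (simp add: sum_subtractf abs_minus_commute)
  also have "\<dots> \<le> (\<Sum>w\<in>canon_lists N. 1 / real b + (if b \<le> last w then 1 else 0))"
    by (rule order.trans[OF sum_abs sum_mono]) (rule quot_count_twin(1)[OF _ N b(1)])
  also have "\<dots> = real (totient N) / real b + (\<Sum>w\<in>canon_lists N. if b \<le> last w then 1 else 0)"
    using N by (simp add: sum.distrib card_canon_lists)
  also have "(\<Sum>w\<in>canon_lists N. if b \<le> last w then 1 else (0::real)) = real (card {w\<in>canon_lists N. b \<le> last w})"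
    by (simp add: sum.If_cases Int_def)
  also have "card {w\<in>canon_lists N. b \<le> last w} \<le> card {w\<in>cf_lists N. w \<noteq> [] \<and> b \<le> last w}"
    using quot_count_twin(2)[OF _ N b(1)] by (intro card_mono) (auto simp: canon_lists_def)
  also have "real (card {w\<in>cf_lists N. w \<noteq> [] \<and> b \<le> last w}) \<le> 2 * (real N / real b + 3)"
    using b N by (intro card_last_ge) auto
  finally have "\<bar>(\<Sum>w\<in>canon_lists N. quot_count b c w) - (\<Sum>w\<in>noncanon_lists N. quot_count b c w)\<bar> \<le> real (totient N) / real b + 2 * (real N / real b + 3)"
    by simp
  moreover have "real (totient N) / real b \<le> real N / real b" by (intro divide_right_mono) (auto simp: totient_le)
  moreover have "1 \<le> real N / real b" using b by simp
  ultimately show ?thesis by simp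
qed

section \<open>The first moment\<close>

lemma cfrac_mu_bounds:
  assumes "1 \<le> b" "b \<le> c"
  shows "0 \<le> cfrac_mu b c" "cfrac_mu b c \<le> 2 / real b"
proof -
  have pi: "pi\<^sup>2 \<ge> 6" using zeta2_partial(1)[of 1] by simp
  then have p: "0 \<le> 12 / pi\<^sup>2" "12 / pi\<^sup>2 \<le> 2" by (auto simp: divide_le_eq)
  show "0 \<le> cfrac_mu b c" unfolding cfrac_mu_eq[OF assms] using gap_int_bounds(1)[OF assms] by simp
  have "cfrac_mu b c \<le> 2 * (1 / real b)" unfolding cfrac_mu_eq[OF assms]
    using p gap_int_bounds[OF assms] by (intro mult_mono) auto
  then show "cfrac_mu b c \<le> 2 / real b" by simp
qed

text \<open>A single term of the exponential series. With \<open>t = l\<close> it trades any power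
  of log log N for one factor log N.\<close>

lemma power_le_fact_exp:
  assumes "(t::real) \<ge> 0"
  shows "t ^ n \<le> fact n * exp t"
proof -
  have "(\<Sum>k<Suc n. t ^ k /\<^sub>R fact k) \<le> exp t"
    unfolding exp_def by (rule sum_le_suminf[OF summable_exp_generic]) (use assms in auto)
  moreover have "t ^ n /\<^sub>R fact n \<le> (\<Sum>k<Suc n. t ^ k /\<^sub>R fact k)"
    using assms by (intro member_le_sum) auto
  ultimately have "t ^ n /\<^sub>R fact n \<le> exp t" by linarith
  then show ?thesis by (simp add: field_simps)
qed

text \<open>In \<open>A = C + 5\<close>, four powers of \<open>x\<close> compensate losses: two for
  the weight and the list length, both at most \<open>4 * x\<close>, one for
  \<open>l ^ 3 <= 6 * x\<close> in Rankin's bound and one for \<open>N / totient N\<close>.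
  \<open>C\<close> powers provide the factor \<open>1 / b\<close>. The last one is a saving
  \<open>1 / x\<close>, which is used up in the second moment when the error is multiplied by the
  mean. The assumption \<open>NC\<close> gives \<open>b <= N\<close>.\<close>

locale large_denominator =
  fixes C A :: real and N :: nat and x l D :: real and Q :: nat
  assumes C: "C > 0" and A: "A = C + 5" and x: "x = ln (real N)" and l: "l = ln x"
    and D: "D = exp (A * l ^ 2)" and Q: "Q = nat \<lfloor>sqrt (real N) / D\<rfloor>"
    and N3: "N \<ge> 3" and l1: "1 \<le> l" and big: "2 * D \<le> sqrt (real N)" and NC: "x powr C \<le> real N"
begin

lemma x1: "x \<ge> 1" and expl: "exp l = x" and lx: "l \<le> x"
proof -
  show x1: "x \<ge> 1" unfolding x using N3 exp_le by (subst ln_ge_iff) auto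
  then show "exp l = x" by (simp add: l)
  show "l \<le> x" using ln_le_minus_one[of x] x1 by (simp add: l)
qed

lemma l_power_le: "l ^ n \<le> fact n * x"
  using power_le_fact_exp[of l n] l1 by (simp add: expl)

lemma D6: "D \<ge> 6"
proof -
  have "1 \<le> l ^ 2" using l1 by (intro one_le_power)
  then have "5 * 1 \<le> A * l ^ 2" using C A by (intro mult_mono) auto
  then have "exp 5 \<le> D" unfolding D by simp
  moreover have "6 \<le> exp (5::real)" using exp_ge_add_one_self[of 5] by simp
  ultimately show ?thesis by linarith
qed

lemma Q_bounds: "Q \<ge> 1" "real Q \<le> sqrt (real N) / D" "sqrt (real N) / (2 * D) \<le> real Q"
proof -
  define z where "z = sqrt (real N) / D"
  have z: "z \<ge> 2" using big D6 by (simp add: z_def field_simps)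
  have Qz: "Q = nat \<lfloor>z\<rfloor>" by (simp add: Q z_def)
  have "real Q = of_int \<lfloor>z\<rfloor>" using z unfolding Qz by simp
  then have q: "real Q \<le> z" "z < real Q + 1" by linarith+
  then show "Q \<ge> 1" "real Q \<le> sqrt (real N) / D" using z by (auto simp: z_def)
  have "z / 2 \<le> real Q" using q z by linarith
  then show "sqrt (real N) / (2 * D) \<le> real Q" by (simp add: z_def)
qed

lemma Q_sq: "real Q ^ 2 * D ^ 2 \<le> real N"
proof -
  have "real Q * D \<le> sqrt (real N)" using Q_bounds(2) D6 by (simp add: field_simps)
  then have "(real Q * D) ^ 2 \<le> sqrt (real N) ^ 2" using D6 by (intro power_mono) auto
  then show ?thesis by (simp add: power_mult_distrib)
qed

lemma Q_sq_le: "real Q ^ 2 \<le> real N / D" "real Q ^ 2 \<le> real N"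
proof -
  have "real Q ^ 2 * D \<le> real Q ^ 2 * D ^ 2" using D6 by (intro mult_left_mono) (auto simp: power2_eq_square)
  then have "real Q ^ 2 * D \<le> real N" using Q_sq by linarith
  then show 1: "real Q ^ 2 \<le> real N / D" using D6 by (simp add: field_simps)
  have "real N / D \<le> real N / 1" using D6 by (intro divide_left_mono) auto
  then show "real Q ^ 2 \<le> real N" using 1 by linarith
qed

lemma lnQ: "0 \<le> ln (real Q)" "ln (real Q) \<le> x / 2" "x / 2 - ln (real Q) \<le> (A + 1) * l ^ 2"
proof -
  have N0: "real N > 0" using N3 by simp
  show "0 \<le> ln (real Q)" using Q_bounds(1) by simp
  have "ln (real Q ^ 2) \<le> ln (real N)" using Q_sq_le(2) Q_bounds(1) N0 by (subst ln_le_cancel_iff) auto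
  then show "ln (real Q) \<le> x / 2" using Q_bounds(1) by (simp add: x ln_realpow)
  have "ln (sqrt (real N) / (2 * D)) \<le> ln (real Q)"
    using Q_bounds N0 D6 by (subst ln_le_cancel_iff) auto
  moreover have "ln (sqrt (real N) / (2 * D)) = x / 2 - (ln 2 + A * l ^ 2)"
    using N0 D6 by (simp add: ln_divide_pos ln_mult_pos ln_sqrt x) (simp add: D)
  moreover have "ln 2 \<le> l ^ 2"
  proof -
    have "ln (2::real) \<le> 1" using ln_2_less_1 by simp
    also have "1 \<le> l ^ 2" using l1 by (intro one_le_power)
    finally show ?thesis .
  qed
  ultimately show "x / 2 - ln (real Q) \<le> (A + 1) * l ^ 2" by (simp add: algebra_simps)
qed

lemma N_le: "real N \<le> 4 * exp 4 * l * real (totient N)"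
  using totient_lower_bound[of N] l1 N3 by (simp add: l x)

lemma N_le_x: "real N \<le> 4 * exp 4 * x * real (totient N)"
proof -
  have "4 * exp 4 * l * real (totient N) \<le> 4 * exp 4 * x * real (totient N)"
    using lx l1 x1 by (intro mult_mono) auto
  then show ?thesis using N_le by linarith
qed

text \<open>The square in the exponent of \<open>D\<close> is what turns Rankin's saving
  \<open>D powr (- 1 / l)\<close> into a fixed negative power of \<open>x\<close>; the lattice point
  error \<open>1 / D\<close> is even smaller.\<close>

lemma powr_A_le_D: "1 / D \<le> x powr (- A)" and D_powr: "D powr (- 1 / l) = x powr (- A)"
proof -
  have xA: "x powr (- A) = exp (- (A * l))" using x1 by (simp add: powr_def l)
  have "l * 1 \<le> l * l" using l1 by (intro mult_left_mono) auto
  then have "A * l \<le> A * l ^ 2" using C A by (intro mult_left_mono) (auto simp: power2_eq_square)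
  then show "1 / D \<le> x powr (- A)" unfolding xA D by (simp add: exp_minus field_simps)
  show "D powr (- 1 / l) = x powr (- A)" unfolding xA using l1
    by (simp add: powr_def D power2_eq_square)
qed

lemma powr_A: "real N * x ^ 3 * x powr (- A) \<le> 4 * exp 4 * (real (totient N) / (real b * x))"
  if b: "1 \<le> b" "real b \<le> x powr C" for b
proof -
  have "real N * x ^ 3 * x powr (- A) \<le> (4 * exp 4 * x * real (totient N)) * x ^ 3 * x powr (- A)"
    using N_le_x x1 by (intro mult_right_mono) auto
  also have "\<dots> = 4 * exp 4 * real (totient N) * (x ^ 4 * x powr (- A))"
    by (simp add: power4_eq_xxxx power3_eq_cube)
  also have "x ^ 4 * x powr (- A) = x powr (- C) / x"
  proof -
    have "x ^ 4 * x powr (- A) = x powr 4 * x powr (- A)" using x1 by simp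
    also have "\<dots> = x powr (- C - 1)"
    proof -
      have "4 + - A = - C - 1" by (simp add: A)
      then show ?thesis by (simp only: powr_add[symmetric])
    qed
    also have "\<dots> = x powr (- C) / x" using x1 by (simp add: powr_diff)
    finally show ?thesis .
  qed
  also have "x powr (- C) \<le> 1 / real b"
    using b x1 unfolding powr_minus inverse_eq_divide by (intro divide_left_mono) auto
  finally have "real N * x ^ 3 * x powr (- A) \<le> 4 * exp 4 * real (totient N) * ((1 / real b) / x)"
    using x1 by (simp add: divide_right_mono mult_left_mono)
  then show ?thesis by simp
qed

lemma main_sum_one_le:
  assumes "1 \<le> b" "b \<le> c"
  shows "main_sum b c {1..Q} (\<lambda>_. 1) \<le> 57 * x"
proof -
  have "cfrac_mu b c \<le> 2"
  proof -
    have "2 / real b \<le> 2 / 1" using assms by (intro divide_left_mono) auto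
    then show ?thesis using cfrac_mu_bounds(2)[OF assms] by simp
  qed
  then have "cfrac_mu b c * ln (real Q) \<le> 2 * (x / 2)"
    using lnQ cfrac_mu_bounds(1)[OF assms] by (intro mult_mono) auto
  moreover have "56 / real b \<le> 56 / 1" using assms by (intro divide_left_mono) auto
  ultimately show ?thesis using main_sum_one[OF assms Q_bounds(1)] x1 by linarith
qed

text \<open>The bound \<open>4 * x\<close> on the weight covers the constant weight 1 of the first
  moment as well as the truncated \<open>quot_count\<close> of the second.\<close>

lemma split_sum_error:
  assumes bc: "1 \<le> b" "b \<le> c" "real b \<le> x powr C"
    and wt: "\<And>u. poslist u \<Longrightarrow> 0 \<le> wt u \<and> wt u \<le> 4 * x"
  shows "\<bar>(\<Sum>w\<in>cf_lists N. split_sum b c {1..Q} wt w) - 2 * real (totient N) * main_sum b c {1..Q} wt\<bar>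
    \<le> (48 + 23424 * exp 18) * (4 * exp 4) * (real (totient N) / (real b * x))"
proof -
  let ?y = "x powr (- A)"
  let ?\<omega> = "4 * x"
  let ?\<tau> = "\<Sum>d | d dvd N \<and> real d > D. \<bar>moebius d\<bar> / real d"
  let ?S = "main_sum b c {1..Q} wt"
  have D0: "D > 0" using D6 by simp
  have N1: "1 \<le> N" using N3 by simp
  have len: "real (length w) \<le> 4 * x" if "M \<le> N" "w \<in> cf_lists M" for M w
    using length_cf_lists_le[OF N3 that] by (simp add: x)
  have "\<bar>(\<Sum>w\<in>cf_lists N. split_sum b c {1..Q} wt w) - 2 * real (totient N) * ?S\<bar>
      \<le> D * (12 * ?\<omega> * real Q ^ 2) + (2 * (4 * x) * ?\<omega> + 2 * ?S) * real N * ?\<tau>"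
    using D0 by (intro split_sum_asymptotic bc N1 wt len) auto
  also have "D * (12 * ?\<omega> * real Q ^ 2) \<le> 48 * (real N * x ^ 3 * ?y)"
  proof -
    have "D * real Q ^ 2 \<le> D * (real N / D ^ 2)"
      using Q_sq D6 by (intro mult_left_mono) (auto simp: pos_le_divide_eq)
    also have "\<dots> = real N * (1 / D)" using D6 by (simp add: power2_eq_square)
    also have "\<dots> \<le> real N * ?y" using powr_A_le_D by (intro mult_left_mono) auto
    finally have 1: "D * real Q ^ 2 \<le> real N * ?y" .
    have "D * (12 * ?\<omega> * real Q ^ 2) = 48 * x * (D * real Q ^ 2)" by simp
    also have "\<dots> \<le> 48 * x ^ 3 * (real N * ?y)"
    proof (rule mult_mono[OF _ 1])
      show "48 * x \<le> 48 * x ^ 3" using self_le_power[OF x1, of 3] by simp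
    qed (use x1 D6 in auto)
    finally show ?thesis by (simp add: mult_ac)
  qed
  \<comment> \<open>Here 23424 = 488 * 48, where 488 = 2 * 4 * 4 + 2 * 228 with 228 = 4 * 57, and 48
    = 8 * 6 with 6 = 3! from \<open>l ^ 3 <= 6 * x\<close>.\<close>
  also have "(2 * (4 * x) * ?\<omega> + 2 * ?S) * real N * ?\<tau> \<le> 23424 * exp 18 * (real N * x ^ 3 * ?y)"
  proof -
    have "?S \<le> main_sum b c {1..Q} (\<lambda>_. ?\<omega>)"
      unfolding main_sum_def using wt bc
      by (intro sum_mono divide_right_mono mult_right_mono gap_fun_bounds) (auto simp: cf_lists_def)
    also have "\<dots> = ?\<omega> * main_sum b c {1..Q} (\<lambda>_. 1)" by (simp add: main_sum_def sum_distrib_left)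
    also have "\<dots> \<le> ?\<omega> * (57 * x)" using x1 bc by (intro mult_left_mono main_sum_one_le) auto
    finally have S: "?S \<le> 228 * x ^ 2" by (simp add: power2_eq_square)
    have t0: "?\<tau> \<ge> 0" by (intro sum_nonneg) auto
    have "?\<tau> \<le> 8 * exp 18 * l ^ 3 * ?y" using rankin_tail[of N D] l1 N3 D0 D_powr by (simp add: l x)
    also have "\<dots> \<le> 8 * exp 18 * (6 * x) * ?y"
      using l_power_le[of 3] l1 x1 by (intro mult_mono) (auto simp: fact_numeral)
    finally have t: "?\<tau> \<le> 48 * exp 18 * x * ?y" by simp
    have "(2 * (4 * x) * ?\<omega> + 2 * ?S) * real N * ?\<tau> \<le> (488 * x ^ 2) * real N * (48 * exp 18 * x * ?y)"
    proof (intro mult_mono t)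
      show "2 * (4 * x) * (4 * x) + 2 * ?S \<le> 488 * x ^ 2" using S by (simp add: power2_eq_square)
    qed (use x1 t0 in auto)
    also have "\<dots> = 23424 * exp 18 * (real N * x ^ 3 * ?y)" by (simp add: power2_eq_square power3_eq_cube)
    finally show ?thesis .
  qed
  finally have "\<bar>(\<Sum>w\<in>cf_lists N. split_sum b c {1..Q} wt w) - 2 * real (totient N) * ?S\<bar>
      \<le> (48 + 23424 * exp 18) * (real N * x ^ 3 * ?y)" by (simp add: distrib_right)
  also have "\<dots> \<le> (48 + 23424 * exp 18) * (4 * exp 4 * (real (totient N) / (real b * x)))"
    using bc by (intro mult_left_mono powr_A) (auto intro: add_nonneg_nonneg)
  finally show ?thesis by (simp only: mult.assoc)
qed

lemma sum_mid_count: 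
  assumes b: "1 \<le> b"
  shows "(\<Sum>w\<in>cf_lists N. mid_count b c Q w) \<le> 128 * exp 4 * (A + 1) * (real (totient N) * l ^ 3 / real b)"
proof -
  have "(\<Sum>w\<in>cf_lists N. mid_count b c Q w) \<le> 32 * real N / real b * (x / 2 - ln (real Q))"
    unfolding x using N3 by (intro sum_mid_count_le b Q_bounds Q_sq_le) auto
  also have "\<dots> \<le> 32 * (4 * exp 4 * l * real (totient N)) / real b * ((A + 1) * l ^ 2)"
    using lnQ N_le by (intro mult_mono divide_right_mono) auto
  also have "\<dots> = 128 * exp 4 * (A + 1) * (real (totient N) * l ^ 3 / real b)"
    by (simp add: power2_eq_square power3_eq_cube)
  finally show ?thesis .
qed

lemma mid_count_bound:
  assumes "1 \<le> b" "w \<in> cf_lists N"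
  shows "mid_count b c Q w \<le> (6 * A + 8) * l ^ 2"
proof -
  have "mid_count b c Q w \<le> 6 * (x / 2 - ln (real Q)) + 2"
    unfolding x using N3 assms by (intro mid_count_le Q_bounds Q_sq_le) auto
  also have "\<dots> \<le> 6 * ((A + 1) * l ^ 2) + 2 * l ^ 2"
  proof (rule add_mono)
    show "6 * (x / 2 - ln (real Q)) \<le> 6 * ((A + 1) * l ^ 2)" using lnQ(3) by (intro mult_left_mono) auto
    show "2 \<le> 2 * l ^ 2" using one_le_power[OF l1, of 2] by simp
  qed
  finally show ?thesis by (simp add: algebra_simps)
qed

lemma sum_both_count:
  assumes b: "1 \<le> b" "real b \<le> x powr C"
  shows "(\<Sum>w\<in>cf_lists N. both_count b c Q w) \<le> 112 * exp 4 * (real (totient N) / (real b * x))"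
proof -
  \<comment> \<open>By \<open>Q_sq\<close> this \<open>B\<close> satisfies
    \<open>(B + 2) * Q ^ 2 <= N\<close>, as \<open>sum_both_count_le\<close> requires, and
    \<open>D >= 6\<close> keeps it above \<open>D ^ 2 / 2\<close>.\<close>
  define B where "B = nat \<lfloor>D ^ 2\<rfloor> - 2"
  have "D ^ 2 \<ge> 6 ^ 2" using D6 by (intro power_mono) auto
  then have D36: "D ^ 2 \<ge> 36" by simp
  then have "real (nat \<lfloor>D ^ 2\<rfloor>) = of_int \<lfloor>D ^ 2\<rfloor>" by simp
  then have fl: "real (nat \<lfloor>D ^ 2\<rfloor>) \<le> D ^ 2" "D ^ 2 - 1 < real (nat \<lfloor>D ^ 2\<rfloor>)"
    using floor_correct[of "D ^ 2"] by linarith+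
  have B2: "real (B + 2) \<le> D ^ 2" "real B \<ge> D ^ 2 / 2" "B \<ge> 1" using fl D36 unfolding B_def by linarith+
  have "real ((B + 2) * (Q * Q)) = real (B + 2) * real Q ^ 2"
    by (simp only: of_nat_mult power2_eq_square)
  also have "\<dots> \<le> D ^ 2 * real Q ^ 2" using B2(1) by (intro mult_right_mono) auto
  also have "\<dots> \<le> real N" using Q_sq by (simp add: mult.commute)
  finally have BQ: "(B + 2) * (Q * Q) \<le> N" by linarith
  have "(\<Sum>w\<in>cf_lists N. both_count b c Q w) \<le> 4 * real N / real B * (1 + ln (real Q)) + 12 * real Q ^ 2"
    using N3 B2 by (intro sum_both_count_le BQ Q_bounds b) auto
  also have "\<dots> \<le> 4 * real N / (D ^ 2 / 2) * (2 * x) + 12 * (real N / D ^ 2) * x"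
  proof (rule add_mono)
    have "4 * real N / real B \<le> 4 * real N / (D ^ 2 / 2)" using B2 D36 by (intro divide_left_mono mult_pos_pos) auto
    moreover have "1 + ln (real Q) \<le> 2 * x" using lnQ x1 by linarith
    ultimately show "4 * real N / real B * (1 + ln (real Q)) \<le> 4 * real N / (D ^ 2 / 2) * (2 * x)"
      by (rule mult_mono) (use lnQ in auto)
    have "real Q ^ 2 \<le> real N / D ^ 2" using Q_sq D6 by (simp add: pos_le_divide_eq)
    then have "12 * real Q ^ 2 * 1 \<le> 12 * (real N / D ^ 2) * x" using x1 by (intro mult_mono) auto
    then show "12 * real Q ^ 2 \<le> 12 * (real N / D ^ 2) * x" by simp
  qed
  also have "\<dots> = 28 * real N * x * (1 / D ^ 2)" by (simp add: field_simps)
  also have "\<dots> \<le> 28 * real N * x ^ 3 * x powr (- A)"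
  proof (intro mult_mono)
    have "1 / D ^ 2 \<le> 1 / D" using D6 by (intro divide_left_mono) (auto simp: power2_eq_square)
    then show "1 / D ^ 2 \<le> x powr (- A)" using powr_A_le_D by linarith
    show "x \<le> x ^ 3" using self_le_power[OF x1, of 3] by simp
  qed (use x1 in auto)
  also have "\<dots> = 28 * (real N * x ^ 3 * x powr (- A))" by simp
  also have "\<dots> \<le> 28 * (4 * exp 4 * (real (totient N) / (real b * x)))" using b by (intro mult_left_mono powr_A) auto
  finally show ?thesis by simp
qed

lemma b_le_N: "real b \<le> x powr C \<Longrightarrow> b \<le> N"
  using NC by linarith

text \<open>Twice the canonical sum \<open>V\<close> is \<open>V - X\<close> plus the sum over both
  expansions, and by reversal invariance the latter is \<open>2 * P + Lm - Lb\<close>. Then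
  \<open>P\<close> is replaced by \<open>2 * totient N * S\<close>, \<open>S\<close> by the mean
  times \<open>ln Q\<close>, and \<open>ln Q\<close> by \<open>x / 2\<close>. Only the middle term
  \<open>Lm\<close> needs the full cube of \<open>l\<close>.\<close>

lemma quot_count_sum_canon_lists:
  assumes bc: "1 \<le> b" "b \<le> c" "real b \<le> x powr C"
  shows "\<bar>(\<Sum>w\<in>canon_lists N. quot_count b c w) - real (totient N) * cfrac_mu b c * x\<bar>
    \<le> ((48 + 23424 * exp 18) * (4 * exp 4) + 64 * exp 4 * (A + 1) + 56 * exp 4 + 18 * exp 4 + 112 + 4 * (A + 1)) * (real (totient N) * l ^ 3 / real b)"
proof -
  define \<phi> where "\<phi> = real (totient N)"
  define t where "t = \<phi> * l ^ 3 / real b"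
  define E where "E = \<phi> / (real b * x)"
  define P where "P = (\<Sum>w\<in>cf_lists N. split_sum b c {1..Q} (\<lambda>_. 1) w)"
  define S where "S = main_sum b c {1..Q} (\<lambda>_. 1)"
  define k1 where "k1 = (48 + 23424 * exp (18::real)) * (4 * exp 4)"
  define k2 where "k2 = exp (4::real)"
  define V where "V = (\<Sum>w\<in>canon_lists N. quot_count b c w)"
  define X where "X = (\<Sum>w\<in>noncanon_lists N. quot_count b c w)"
  define Lm where "Lm = (\<Sum>w\<in>cf_lists N. mid_count b c Q w)"
  define Lb where "Lb = (\<Sum>w\<in>cf_lists N. both_count b c Q w)"
  have l3: "1 \<le> l ^ 3" "l \<le> l ^ 3" "l ^ 2 \<le> l ^ 3"
    using l1 self_le_power[OF l1, of 3] power_increasing[of 2 3 l] by (auto simp: one_le_power)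
  have b0: "real b > 0" using bc by simp
  have f0: "\<phi> \<ge> 0" by (simp add: \<phi>_def)
  have Et: "E \<le> t"
  proof -
    have "\<phi> / (real b * x) \<le> \<phi> / (real b * 1)" using x1 b0 f0 by (intro divide_left_mono mult_left_mono) auto
    also have "\<dots> \<le> \<phi> * l ^ 3 / real b" using l3 f0 b0 mult_left_mono[OF l3(1) f0] by (simp add: divide_right_mono)
    finally show ?thesis by (simp add: E_def t_def)
  qed
  have P: "\<bar>P - 2 * \<phi> * S\<bar> \<le> k1 * E"
    unfolding P_def \<phi>_def S_def k1_def E_def using x1 by (intro split_sum_error bc) auto
  have Lm: "0 \<le> Lm" "Lm \<le> 128 * k2 * (A + 1) * t"
    unfolding Lm_def t_def \<phi>_def k2_def using sum_mid_count[OF bc(1), of c] by (auto intro: sum_nonneg simp: mid_count_def)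
  have Lb: "0 \<le> Lb" "Lb \<le> 112 * k2 * E"
    unfolding Lb_def E_def \<phi>_def k2_def using sum_both_count[OF bc(1,3), of c] by (auto intro: sum_nonneg simp: both_count_def)
  have VX: "\<bar>V - X\<bar> \<le> 36 * k2 * t"
  proof -
    have "\<bar>V - X\<bar> \<le> 9 * real N / real b" unfolding V_def X_def
      by (rule sum_canon_lists_noncanon_lists_diff[OF bc(1) b_le_N[OF bc(3)]]) (use N3 in simp)
    also have "\<dots> \<le> 9 * (4 * exp 4 * l * \<phi>) / real b" using N_le b0 by (intro divide_right_mono mult_left_mono) (auto simp: \<phi>_def)
    also have "\<dots> \<le> 9 * (4 * exp 4 * l ^ 3 * \<phi>) / real b"
      using l3 f0 b0 by (intro divide_right_mono mult_left_mono mult_right_mono) auto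
    finally show ?thesis by (simp add: t_def k2_def mult_ac)
  qed
  have dec: "V + X + Lb = 2 * P + Lm"
  proof -
    have "(\<Sum>w\<in>cf_lists N. quot_count b c w + both_count b c Q w)
        = (\<Sum>w\<in>cf_lists N. split_sum b c {1..Q} (\<lambda>_. 1) w + split_sum b c {1..Q} (\<lambda>_. 1) (rev w) + mid_count b c Q w)"
      by (intro sum.cong refl quot_count_decomp) (auto simp: cf_lists_def)
    then show ?thesis by (simp add: sum.distrib sum_cf_lists_rev sum_cf_lists_split[of "quot_count b c"] V_def X_def Lb_def Lm_def P_def)
  qed
  have S: "\<phi> * \<bar>S - cfrac_mu b c * ln (real Q)\<bar> \<le> 56 * t"
  proof -
    have "\<phi> * \<bar>S - cfrac_mu b c * ln (real Q)\<bar> \<le> \<phi> * (56 / real b)"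
      unfolding S_def using f0 by (intro mult_left_mono main_sum_one bc Q_bounds) auto
    also have "\<dots> \<le> \<phi> * (56 * l ^ 3 / real b)" using f0 l3 b0 by (intro mult_left_mono divide_right_mono) auto
    finally show ?thesis by (simp add: t_def mult_ac)
  qed
  have M: "\<phi> * \<bar>cfrac_mu b c * ln (real Q) - cfrac_mu b c * (x / 2)\<bar> \<le> 2 * (A + 1) * t"
  proof -
    have "\<phi> * \<bar>cfrac_mu b c * ln (real Q) - cfrac_mu b c * (x / 2)\<bar> = \<phi> * (cfrac_mu b c * (x / 2 - ln (real Q)))"
      unfolding right_diff_distrib[symmetric] abs_mult using cfrac_mu_bounds(1)[OF bc(1,2)] lnQ(2) by simp
    also have "\<dots> \<le> \<phi> * (2 / real b * ((A + 1) * l ^ 3))"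
    proof (intro mult_left_mono mult_mono)
      show "x / 2 - ln (real Q) \<le> (A + 1) * l ^ 3"
        by (rule order.trans[OF lnQ(3) mult_left_mono[OF l3(3)]]) (use C A in simp)
    qed (use cfrac_mu_bounds[OF bc(1,2)] lnQ f0 in auto)
    also have "\<dots> = 2 * (A + 1) * t" by (simp add: t_def)
    finally show ?thesis .
  qed
  have abs_comb: "\<bar>z\<bar> \<le> \<bar>a\<bar> + y1 + y2 + 2 * \<bar>p\<bar> + 4 * \<bar>s\<bar> + 4 * \<bar>m\<bar>"
    if "z = a + y1 - y2 + 2 * p + 4 * s + 4 * m" "0 \<le> y1" "0 \<le> y2" for z a y1 y2 p s m :: real
    using that by linarith
  have "2 * V - 2 * (\<phi> * cfrac_mu b c * x) = (V - X) + Lm - Lb + 2 * (P - 2 * \<phi> * S)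
      + 4 * (\<phi> * (S - cfrac_mu b c * ln (real Q))) + 4 * (\<phi> * (cfrac_mu b c * ln (real Q) - cfrac_mu b c * (x / 2)))"
    using dec by (simp add: algebra_simps)
  then have "\<bar>2 * V - 2 * (\<phi> * cfrac_mu b c * x)\<bar> \<le> \<bar>V - X\<bar> + Lm + Lb + 2 * \<bar>P - 2 * \<phi> * S\<bar>
      + 4 * \<bar>\<phi> * (S - cfrac_mu b c * ln (real Q))\<bar> + 4 * \<bar>\<phi> * (cfrac_mu b c * ln (real Q) - cfrac_mu b c * (x / 2))\<bar>"
    by (rule abs_comb) (fact Lm(1) Lb(1))+
  also have "\<dots> \<le> 36 * k2 * t + 128 * k2 * (A + 1) * t + 112 * k2 * t + 2 * (k1 * t) + 4 * (56 * t) + 4 * (2 * (A + 1) * t)"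
  proof -
    have "112 * k2 * E \<le> 112 * k2 * t" by (rule mult_left_mono[OF Et]) (simp add: k2_def)
    moreover have "k1 * E \<le> k1 * t" by (rule mult_left_mono[OF Et]) (simp add: k1_def add_nonneg_nonneg)
    moreover have "\<bar>\<phi> * z\<bar> = \<phi> * \<bar>z\<bar>" for z using f0 by (simp add: abs_mult)
    ultimately show ?thesis using VX Lm Lb P S M by (intro add_mono mult_left_mono) auto
  qed
  also have "\<dots> = 2 * ((k1 + 64 * k2 * (A + 1) + 56 * k2 + 18 * k2 + 112 + 4 * (A + 1)) * t)" by (simp add: algebra_simps)
  finally have "\<bar>V - \<phi> * cfrac_mu b c * x\<bar> \<le> (k1 + 64 * k2 * (A + 1) + 56 * k2 + 18 * k2 + 112 + 4 * (A + 1)) * t" by linarith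
  then show ?thesis by (simp only: V_def \<phi>_def t_def k1_def k2_def)
qed

end

lemma eventually_large_denominator:
  fixes C :: real
  assumes "C > 0"
  shows "\<exists>N0\<ge>3. \<forall>N\<ge>N0. large_denominator C (C + 5) N (ln (real N)) (ln (ln (real N))) (exp ((C + 5) * ln (ln (real N)) ^ 2))
    (nat \<lfloor>sqrt (real N) / exp ((C + 5) * ln (ln (real N)) ^ 2)\<rfloor>)"
proof -
  have 1: "eventually (\<lambda>N::nat. 1 \<le> ln (ln (real N))) sequentially" by real_asymp
  have 2: "eventually (\<lambda>N::nat. 2 * exp ((C + 5) * ln (ln (real N)) ^ 2) \<le> sqrt (real N)) sequentially"
    using assms by real_asymp
  have 3: "eventually (\<lambda>N::nat. ln (real N) powr C \<le> real N) sequentially" using assms by real_asymp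
  obtain N0 where N0: "\<And>N. N \<ge> N0 \<Longrightarrow> 1 \<le> ln (ln (real N)) \<and> 2 * exp ((C + 5) * ln (ln (real N)) ^ 2) \<le> sqrt (real N) \<and> ln (real N) powr C \<le> real N"
    using eventually_conj[OF 1 eventually_conj[OF 2 3]] unfolding eventually_sequentially by blast
  show ?thesis
    using N0 assms by (intro exI[of _ "max 3 N0"]) (auto simp: large_denominator_def)
qed

lemma first_moment_large:
  fixes C :: real
  assumes "C > 0"
  shows "\<exists>K N0. K \<ge> 0 \<and> N0 \<ge> 3 \<and> (\<forall>N\<ge>N0. \<forall>b c. 1 \<le> b \<longrightarrow> b \<le> c \<longrightarrow> real b \<le> ln (real N) powr C \<longrightarrow>
    \<bar>(\<Sum>w\<in>canon_lists N. quot_count b c w) - real (totient N) * cfrac_mu b c * ln (real N)\<bar> \<le> K * (real (totient N) * ln (ln (real N)) ^ 3 / real b))"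
proof -
  obtain N0 where N0: "N0 \<ge> 3" "\<And>N. N \<ge> N0 \<Longrightarrow> large_denominator C (C + 5) N (ln (real N)) (ln (ln (real N))) (exp ((C + 5) * ln (ln (real N)) ^ 2))
    (nat \<lfloor>sqrt (real N) / exp ((C + 5) * ln (ln (real N)) ^ 2)\<rfloor>)"
    using eventually_large_denominator[OF assms] by blast
  define K where "K = (48 + 23424 * exp 18) * (4 * exp 4) + 64 * exp 4 * (C + 5 + 1) + 56 * exp 4 + 18 * exp 4 + 112 + 4 * (C + 5 + 1)"
  have "K \<ge> 0" using assms by (simp add: K_def)
  moreover have "\<bar>(\<Sum>w\<in>canon_lists N. quot_count b c w) - real (totient N) * cfrac_mu b c * ln (real N)\<bar> \<le> K * (real (totient N) * ln (ln (real N)) ^ 3 / real b)"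
    if "N \<ge> N0" "1 \<le> b" "b \<le> c" "real b \<le> ln (real N) powr C" for N b c
    unfolding K_def by (rule large_denominator.quot_count_sum_canon_lists[OF N0(2)[OF that(1)] that(2-4)])
  ultimately show ?thesis using N0(1) by blast
qed

section \<open>The second moment\<close>

lemma card_square_pairs:
  assumes "finite (J :: nat set)"
  shows "real (card J) ^ 2 = 2 * (\<Sum>j\<in>J. real (card {i\<in>J. i < j})) + real (card J)"
  using assms
proof (induction J rule: finite_linorder_max_induct)
  case (insert b A)
  have nb: "b \<notin> A" using insert by auto
  have 1: "{i\<in>insert b A. i < j} = {i\<in>A. i < j}" if "j \<in> A" for j using insert that by auto
  have 2: "{i\<in>insert b A. i < b} = A" using insert by auto
  have "(\<Sum>j\<in>insert b A. real (card {i\<in>insert b A. i < j})) = real (card A) + (\<Sum>j\<in>A. real (card {i\<in>A. i < j}))"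
    using insert nb 2 1 by (simp add: sum.insert)
  then show ?case using insert nb by (simp add: power2_eq_square algebra_simps)
qed simp

lemma split_sum_one_square_le:
  "(split_sum b c {1..Q} (\<lambda>_. 1) w) ^ 2 \<le> 2 * split_sum b c {1..Q} (quot_count b c) w + split_sum b c {1..Q} (\<lambda>_. 1) w"
proof -
  define J where "J = {j\<in>good_idx b c w. cont (take j w) \<in> {1..Q}}"
  have fin: "finite J" by (simp add: J_def)
  have 1: "split_sum b c {1..Q} (\<lambda>_. 1) w = real (card J)" by (simp add: split_sum_alt J_def)
  have "(\<Sum>j\<in>J. real (card {i\<in>J. i < j})) \<le> (\<Sum>j\<in>J. quot_count b c (take j w))"
  proof (rule sum_mono)
    fix j assume "j \<in> J"
    have "{i\<in>J. i < j} \<subseteq> good_idx b c (take j w)" by (auto simp: J_def good_idx_def)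
    then show "real (card {i\<in>J. i < j}) \<le> quot_count b c (take j w)"
      unfolding quot_count_def by (intro of_nat_mono card_mono) auto
  qed
  then have "(\<Sum>j\<in>J. real (card {i\<in>J. i < j})) \<le> split_sum b c {1..Q} (quot_count b c) w"
    by (simp add: split_sum_alt J_def)
  then show ?thesis unfolding 1 card_square_pairs[OF fin] by simp
qed

text \<open>Each canonical list is paired with its \<open>twin\<close>. Their arguments of
  \<open>gap_fun\<close> are \<open>y\<close> and \<open>1 - y\<close>, and their counts differ by
  at most 2, so a common weight can be taken out and the symmetrized estimate applies. The case
  \<open>q = 1\<close> is separate, as the empty list has no twin.\<close>

lemma quot_count_gap_sum_le:
  assumes bc: "1 \<le> b" "b \<le> c" and q: "q \<ge> 1"
  shows "(\<Sum>u\<in>cf_lists q. quot_count b c u * gap_fun b c (real (cont_bl u) / real q))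
    \<le> (2 * gap_int b c + 1 / real b ^ 3) * (\<Sum>w\<in>canon_lists q. quot_count b c w) + 2 * real (totient q) / real b"
proof (cases "q = 1")
  case True
  have g: "gap_fun b c 1 \<le> 1 / real b" using gap_fun_bounds(2)[OF bc] by simp
  have "(\<Sum>u\<in>cf_lists 1. quot_count b c u * gap_fun b c (real (cont_bl u) / real 1)) = quot_count b c [1] * gap_fun b c (real (cont_bl [1]))"
    unfolding sum_cf_lists_split canon_lists_1 noncanon_lists_1 by simp
  also have "\<dots> \<le> 1 * (1 / real b)"
    using g gap_fun_bounds(1)[OF bc, of 1] by (intro mult_mono) (auto simp: quot_count_Cons cont_bl_def)
  also have "\<dots> \<le> 2 * 1 / real b" by (simp add: divide_right_mono)
  finally show ?thesis using canon_lists_1 unfolding True by simp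
next
  case False
  then have q2: "q \<ge> 2" using q by simp
  let ?g = "\<lambda>u. gap_fun b c (real (cont_bl u) / real q)"
  have "(\<Sum>u\<in>noncanon_lists q. quot_count b c u * ?g u) = (\<Sum>w\<in>canon_lists q. quot_count b c (twin w) * ?g (twin w))"
    by (rule sum.reindex_bij_betw[OF bij_betw_twin[OF q2], symmetric])
  then have "(\<Sum>u\<in>cf_lists q. quot_count b c u * ?g u) = (\<Sum>w\<in>canon_lists q. quot_count b c w * ?g w + quot_count b c (twin w) * ?g (twin w))"
    unfolding sum_cf_lists_split by (simp add: sum.distrib)
  also have "\<dots> \<le> (\<Sum>w\<in>canon_lists q. (2 * gap_int b c + 1 / real b ^ 3) * quot_count b c w + 2 / real b)"
  proof (rule sum_mono)
    fix w assume w: "w \<in> canon_lists q"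
    define y where "y = real (cont_bl w) / real q"
    have pw: "poslist w" "cont w = q" using w by (auto simp: canon_lists_def cf_lists_def)
    have y: "0 \<le> y" "y \<le> 1" using cont_bl_le[OF pw(1)] pw(2) q by (auto simp: y_def)
    have "real (cont_bl (twin w)) + real (cont_bl w) = real q" using cont_bl_twin[OF w q2] by linarith
    then have ty: "real (cont_bl (twin w)) / real q = 1 - y"
      using q by (simp add: y_def field_simps)
    have g: "0 \<le> gap_fun b c (1 - y)" "gap_fun b c (1 - y) \<le> 1 / real b" using gap_fun_bounds[OF bc, of "1 - y"] y by auto
    have "1 / real b \<le> 1" using bc by simp
    then have "quot_count b c (twin w) \<le> quot_count b c w + 2"
    proof -
      have "(if b \<le> last w then 1 else 0) \<le> (1::real)" by simp
      then have "\<bar>quot_count b c (twin w) - quot_count b c w\<bar> \<le> 2"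
        using quot_count_twin(1)[OF w q2 bc(1), of c] \<open>1 / real b \<le> 1\<close> by linarith
      then show ?thesis by linarith
    qed
    then have "quot_count b c (twin w) * gap_fun b c (1 - y) \<le> (quot_count b c w + 2) * gap_fun b c (1 - y)"
      using g by (intro mult_right_mono) auto
    also have "\<dots> = quot_count b c w * gap_fun b c (1 - y) + 2 * gap_fun b c (1 - y)" by (simp add: distrib_right)
    also have "2 * gap_fun b c (1 - y) \<le> 2 / real b" using g by simp
    finally have 1: "quot_count b c (twin w) * gap_fun b c (1 - y) \<le> quot_count b c w * gap_fun b c (1 - y) + 2 / real b" by simp
    have "quot_count b c w * (gap_fun b c y + gap_fun b c (1 - y)) \<le> quot_count b c w * (2 * gap_int b c + 1 / real b ^ 3)"
      using gap_fun_symmetrized_le[OF bc y] quot_count_nonneg by (intro mult_left_mono) auto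
    then show "quot_count b c w * ?g w + quot_count b c (twin w) * ?g (twin w) \<le> (2 * gap_int b c + 1 / real b ^ 3) * quot_count b c w + 2 / real b"
      using 1 unfolding ty y_def[symmetric] by (simp add: distrib_left mult.commute)
  qed
  also have "\<dots> = (2 * gap_int b c + 1 / real b ^ 3) * (\<Sum>w\<in>canon_lists q. quot_count b c w) + 2 * real (totient q) / real b"
    using q by (simp add: sum.distrib sum_distrib_left card_canon_lists)
  finally show ?thesis .
qed

lemma sum_totient_squares_le_harm: "(\<Sum>q=1..Q. real (totient q) / real q ^ 2) \<le> harm Q"
proof -
  have "(\<Sum>q=1..Q. real (totient q) / real q ^ 2) \<le> (\<Sum>q=1..Q. inverse (real q))"
  proof (rule sum_mono)
    fix q assume "q \<in> {1..Q}"
    then have "real (totient q) / real q ^ 2 \<le> real q / real q ^ 2" by (intro divide_right_mono) (auto simp: totient_le)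
    also have "\<dots> = inverse (real q)" using \<open>q \<in> {1..Q}\<close> by (simp add: power2_eq_square inverse_eq_divide)
    finally show "real (totient q) / real q ^ 2 \<le> inverse (real q)" .
  qed
  then show ?thesis by (simp add: harm_def)
qed

context large_denominator
begin

text \<open>Absorbs the error inherited from the first moment over denominators \<open>q\<close>
  into the two terms of the theorem. If \<open>l ^ 2 <= b\<close>, two powers of \<open>l\<close>
  cancel one \<open>b\<close>; otherwise \<open>l ^ 3 * b ^ 2\<close> is at most
  \<open>l ^ 7 <= 7! * x\<close>, whence 5040.\<close>

lemma l_cube_aux:
  assumes b: "b \<ge> (1::real)"
  shows "x * l ^ 3 / b ^ 2 \<le> 5040 * (x ^ 2 / b ^ 4 + x * l / b)"
proof (cases "l ^ 2 \<le> b")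
  case True
  have "x * l ^ 3 / b ^ 2 = (x * l / b ^ 2) * l ^ 2" by (simp add: power2_eq_square power3_eq_cube)
  also have "\<dots> \<le> (x * l / b ^ 2) * b" using True x1 l1 by (intro mult_left_mono) auto
  also have "\<dots> = x * l / b" using b by (simp add: power2_eq_square)
  also have "\<dots> \<le> 5040 * (x ^ 2 / b ^ 4 + x * l / b)"
  proof -
    have "0 \<le> x ^ 2 / b ^ 4" "0 \<le> x * l / b" using x1 l1 b by auto
    moreover have "t \<le> 5040 * (s + t)" if "0 \<le> s" "0 \<le> t" for s t :: real using that by simp
    ultimately show ?thesis by blast
  qed
  finally show ?thesis .
next
  case False
  have "b ^ 2 \<le> (l ^ 2) ^ 2" using False b by (intro power_mono) auto
  then have "l ^ 3 * b ^ 2 \<le> l ^ 3 * (l ^ 2) ^ 2" using l1 by (intro mult_left_mono) auto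
  also have "\<dots> = l ^ 7" by (simp flip: power_mult power_add)
  also have "\<dots> \<le> 5040 * x" using l_power_le[of 7] by (simp add: fact_numeral)
  finally have "x * (l ^ 3 * b ^ 2) / b ^ 4 \<le> x * (5040 * x) / b ^ 4" using x1 b by (intro divide_right_mono mult_left_mono) auto
  moreover have "x * (l ^ 3 * b ^ 2) / b ^ 4 = x * l ^ 3 / b ^ 2" using b by (simp add: power2_eq_square power4_eq_xxxx)
  moreover have "x * (5040 * x) / b ^ 4 = 5040 * (x ^ 2 / b ^ 4)" by (simp add: power2_eq_square)
  ultimately have "x * l ^ 3 / b ^ 2 \<le> 5040 * (x ^ 2 / b ^ 4)" by simp
  also have "\<dots> \<le> 5040 * (x ^ 2 / b ^ 4 + x * l / b)" using x1 l1 b by (intro mult_left_mono) auto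
  finally show ?thesis .
qed

text \<open>If \<open>b\<close> exceeds \<open>(ln q) powr (2 * C)\<close>, then \<open>ln q \<le> sqrt x\<close>: on this short range of \<open>ln q\<close> the trivial
  bound suffices.\<close>

lemma sum_canon_lists_pointwise:
  assumes FM: "\<And>n. n \<ge> N1 \<Longrightarrow> real b \<le> ln (real n) powr (2 * C) \<Longrightarrow>
      \<bar>(\<Sum>w\<in>canon_lists n. quot_count b c w) - real (totient n) * cfrac_mu b c * ln (real n)\<bar> \<le> K1 * (real (totient n) * ln (ln (real n)) ^ 3 / real b)"
    and K1: "K1 \<ge> 0" and N1: "N1 \<ge> 3" and bc: "1 \<le> b" "b \<le> c" "real b \<le> x powr C"
    and q: "1 \<le> q" "q \<le> Q" and y0: "y0 = ln (real N1) + sqrt x"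
  shows "(\<Sum>w\<in>canon_lists q. quot_count b c w) \<le> real (totient q) * (cfrac_mu b c * ln (real q) + K1 * l ^ 3 / real b
    + (if ln (real q) \<le> y0 then 4 * (y0 + 2) else 0))"
proof -
  have mu: "0 \<le> cfrac_mu b c * ln (real q)" using cfrac_mu_bounds(1)[OF bc(1,2)] q by simp
  have y0p: "y0 \<ge> 0" using N1 x1 by (simp add: y0)
  have Kp: "0 \<le> K1 * l ^ 3 / real b" using K1 l1 by simp
  show ?thesis
  proof (cases "N1 \<le> q \<and> real b \<le> ln (real q) powr (2 * C)")
    case True
    have q3: "q \<ge> 3" using True N1 by simp
    have lq: "1 \<le> ln (real q)" using q3 exp_le by (subst ln_ge_iff) auto
    have "real Q ^ 2 \<le> real N" by (rule Q_sq_le)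
    moreover have "real Q * 1 \<le> real Q ^ 2" using Q_bounds(1) unfolding power2_eq_square by (intro mult_left_mono) auto
    ultimately have "real q \<le> real N" using q by linarith
    then have "ln (real q) \<le> x" unfolding x using q by (subst ln_le_cancel_iff) auto
    then have "ln (ln (real q)) \<le> l" unfolding l using lq by (subst ln_le_cancel_iff) auto
    then have "ln (ln (real q)) ^ 3 \<le> l ^ 3" using lq by (intro power_mono) auto
    then have "K1 * (real (totient q) * ln (ln (real q)) ^ 3 / real b) \<le> K1 * (real (totient q) * l ^ 3 / real b)"
      using K1 by (intro mult_left_mono divide_right_mono) auto
    then have "(\<Sum>w\<in>canon_lists q. quot_count b c w) \<le> real (totient q) * cfrac_mu b c * ln (real q) + K1 * (real (totient q) * l ^ 3 / real b)"
      using FM[of q] True by linarith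
    also have "\<dots> = real (totient q) * (cfrac_mu b c * ln (real q) + K1 * l ^ 3 / real b)" by (simp add: algebra_simps)
    also have "\<dots> \<le> real (totient q) * (cfrac_mu b c * ln (real q) + K1 * l ^ 3 / real b + (if ln (real q) \<le> y0 then 4 * (y0 + 2) else 0))"
      using y0p by (intro mult_left_mono) auto
    finally show ?thesis .
  next
    case False
    have le: "ln (real q) \<le> y0"
    proof (cases "q < N1")
      case True
      then have "ln (real q) \<le> ln (real N1)" using q by (subst ln_le_cancel_iff) auto
      moreover have "sqrt x \<ge> 0" using x1 by simp
      ultimately show ?thesis unfolding y0 by linarith
    next
      case F: False
      have "ln (real q) \<le> sqrt x"
      proof (rule ccontr)
        assume "\<not> ln (real q) \<le> sqrt x"
        then have "sqrt x powr (2 * C) < ln (real q) powr (2 * C)" using C x1 by (intro powr_less_mono2) auto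
        also have "ln (real q) powr (2 * C) < real b" using False F by simp
        also have "real b \<le> x powr C" by (rule bc)
        also have "x powr C = sqrt x powr (2 * C)" using x1 by (simp add: powr_half_sqrt[symmetric] powr_powr)
        finally show False by simp
      qed
      moreover have "ln (real N1) \<ge> 0" using N1 by simp
      ultimately show ?thesis unfolding y0 by linarith
    qed
    have "(\<Sum>w\<in>canon_lists q. quot_count b c w) \<le> (\<Sum>w\<in>canon_lists q. 4 * (y0 + 2))"
    proof (rule sum_mono)
      fix w assume "w \<in> canon_lists q"
      then have "w \<in> cf_lists q" by (simp add: canon_lists_def)
      then have "quot_count b c w \<le> 4 * ln (real (max q 3))" by (rule quot_count_le_ln) auto
      moreover have "ln (real (max q 3)) \<le> y0 + 2"
      proof (cases "q \<ge> 3")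
        case True
        then show ?thesis using le by (simp add: max_def)
      next
        case False
        have "ln (3::real) \<le> 3 - 1" by (rule ln_le_minus_one) simp
        then show ?thesis using False y0p by (simp add: max_def)
      qed
      then have "4 * ln (real (max q 3)) \<le> 4 * (y0 + 2)" by (rule mult_left_mono) simp
      ultimately show "quot_count b c w \<le> 4 * (y0 + 2)" by (rule order.trans)
    qed
    also have "\<dots> = real (totient q) * (4 * (y0 + 2))" using q by (simp add: card_canon_lists)
    also have "\<dots> \<le> real (totient q) * (cfrac_mu b c * ln (real q) + K1 * l ^ 3 / real b + 4 * (y0 + 2))"
      using mu Kp by (intro mult_left_mono) auto
    finally show ?thesis using le by simp
  qed
qed

text \<open>The weighted main term is half the square of the unweighted one, up to admissible
  errors. The term \<open>x ^ 2 / b ^ 4\<close> is the symmetrization error \<open>1 / b ^ 3\<close>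
  multiplied by the density \<open>cfrac_mu b c <= 2 / b\<close>. In the constants, 132 = 2 + 126 +
  4 and 30240 = 6 * 5040.\<close>

lemma main_sum_quot_count_le:
  assumes FM: "\<And>n. n \<ge> N1 \<Longrightarrow> real b \<le> ln (real n) powr (2 * C) \<Longrightarrow>
      \<bar>(\<Sum>w\<in>canon_lists n. quot_count b c w) - real (totient n) * cfrac_mu b c * ln (real n)\<bar> \<le> K1 * (real (totient n) * ln (ln (real n)) ^ 3 / real b)"
    and K1: "K1 \<ge> 0" and N1: "N1 \<ge> 3" and bc: "1 \<le> b" "b \<le> c" "real b \<le> x powr C"
  shows "main_sum b c {1..Q} (quot_count b c) \<le> (cfrac_mu b c * ln (real Q)) ^ 2 / 2
    + (132 + 30240 * K1 + 12 * (ln (real N1) + 3) ^ 2) * (x ^ 2 / real b ^ 4 + x * l / real b)"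
proof -
  define y0 where "y0 = ln (real N1) + sqrt x"
  define \<mu> where "\<mu> = cfrac_mu b c"
  define \<gamma> where "\<gamma> = 2 * gap_int b c + 1 / real b ^ 3"
  define B where "B = real b"
  define k where "k = ln (real N1) + 3"
  define h where "h = K1 * l ^ 3 / B"
  define a where "a q = real (totient q) / real q ^ 2" for q
  define I where "I q = (if ln (real q) \<le> y0 then 4 * (y0 + 2) else 0)" for q :: nat
  have B: "B \<ge> 1" using bc by (simp add: B_def)
  have mu: "0 \<le> \<mu>" "\<mu> \<le> 2 / B" using cfrac_mu_bounds[OF bc(1,2)] by (auto simp: \<mu>_def B_def)
  have g: "0 \<le> \<gamma>" "\<gamma> \<le> 3 / B"
  proof -
    show "0 \<le> \<gamma>" using gap_int_bounds(1)[OF bc(1,2)] by (simp add: \<gamma>_def)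
    have "1 / B ^ 3 \<le> 1 / B" using B self_le_power[OF B, of 3] by (intro divide_left_mono) auto
    then show "\<gamma> \<le> 3 / B" using gap_int_bounds(2)[OF bc(1,2)] unfolding \<gamma>_def B_def[symmetric] by simp
  qed
  have sx: "sqrt x \<ge> 1" "sqrt x * sqrt x = x" using x1 by auto
  have y0p: "y0 \<ge> 0" using N1 x1 by (simp add: y0_def)
  have a0: "a q \<ge> 0" for q by (simp add: a_def)
  have "main_sum b c {1..Q} (quot_count b c) = (\<Sum>q=1..Q. (\<Sum>u\<in>cf_lists q. quot_count b c u * gap_fun b c (real (cont_bl u) / real q)) / real q ^ 2)"
    by (simp add: main_sum_def sum_divide_distrib)
  also have "\<dots> \<le> (\<Sum>q=1..Q. \<gamma> * (\<mu> * (a q * ln (real q)) + h * a q + a q * I q) + 2 / B * a q)"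
  proof (rule sum_mono)
    fix q assume "q \<in> {1..Q}"
    then have q: "1 \<le> q" "q \<le> Q" by auto
    have "(\<Sum>u\<in>cf_lists q. quot_count b c u * gap_fun b c (real (cont_bl u) / real q)) \<le> \<gamma> * (\<Sum>w\<in>canon_lists q. quot_count b c w) + 2 * real (totient q) / B"
      unfolding \<gamma>_def B_def by (rule quot_count_gap_sum_le[OF bc(1,2) q(1)])
    also have "\<dots> \<le> \<gamma> * (real (totient q) * (\<mu> * ln (real q) + h + I q)) + 2 * real (totient q) / B"
      unfolding \<mu>_def h_def I_def B_def
      using g by (intro add_mono order.refl mult_left_mono sum_canon_lists_pointwise[OF FM K1 N1 bc q y0_def]) auto
    finally have "(\<Sum>u\<in>cf_lists q. quot_count b c u * gap_fun b c (real (cont_bl u) / real q)) / real q ^ 2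
       \<le> (\<gamma> * (real (totient q) * (\<mu> * ln (real q) + h + I q)) + 2 * real (totient q) / B) / real q ^ 2"
      by (rule divide_right_mono) simp
    also have "\<dots> = \<gamma> * (\<mu> * (a q * ln (real q)) + h * a q + a q * I q) + 2 / B * a q"
      by (simp add: a_def add_divide_distrib distrib_left mult_ac)
    finally show "(\<Sum>u\<in>cf_lists q. quot_count b c u * gap_fun b c (real (cont_bl u) / real q)) / real q ^ 2
       \<le> \<gamma> * (\<mu> * (a q * ln (real q)) + h * a q + a q * I q) + 2 / B * a q" .
  qed
  also have "\<dots> = \<gamma> * (\<mu> * (\<Sum>q=1..Q. a q * ln (real q)) + h * (\<Sum>q=1..Q. a q) + (\<Sum>q=1..Q. a q * I q)) + 2 / B * (\<Sum>q=1..Q. a q)"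
    by (simp only: sum.distrib sum_distrib_left[symmetric])
  also have "\<dots> \<le> \<gamma> * (\<mu> * (3 / pi\<^sup>2 * ln (real Q) ^ 2 + 21 * x) + h * (2 * x) + 4 * k ^ 2 * x) + 2 / B * (2 * x)"
  proof -
    have 1: "(\<Sum>q=1..Q. a q * ln (real q)) \<le> 3 / pi\<^sup>2 * ln (real Q) ^ 2 + 21 * x"
      using sum_totient_ln_le[OF Q_bounds(1)] lnQ(2) x1 unfolding a_def by linarith
    have 2: "(\<Sum>q=1..Q. a q) \<le> 2 * x"
      using sum_totient_squares_le_harm[of Q] harm_bounds(2)[OF Q_bounds(1)] lnQ(2) x1 unfolding a_def by linarith
    \<comment> \<open>Both the sum of \<open>a q\<close> over \<open>ln q <= y0\<close> and the
      factor \<open>I q\<close> are linear in \<open>y0\<close>, so a cutoff \<open>y0\<close> of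
      order \<open>sqrt x\<close> costs only O(x).\<close>
    have 3: "(\<Sum>q=1..Q. a q * I q) \<le> 4 * k ^ 2 * x"
    proof -
      define Y where "Y = nat \<lfloor>exp y0\<rfloor>"
      have Y1: "Y \<ge> 1" using y0p by (simp add: Y_def le_nat_floor)
      have "real Y \<le> exp y0" unfolding Y_def by (simp add: of_nat_floor)
      then have "ln (real Y) \<le> ln (exp y0)" using Y1 by (subst ln_le_cancel_iff) auto
      then have lnY: "ln (real Y) \<le> y0" by simp
      have "(\<Sum>q=1..Q. a q * I q) = (\<Sum>q\<in>{q\<in>{1..Q}. ln (real q) \<le> y0}. a q * (4 * (y0 + 2)))"
        unfolding I_def sum.inter_filter[OF finite_atLeastAtMost] by (intro sum.cong) auto
      also have "\<dots> \<le> (\<Sum>q=1..Y. a q * (4 * (y0 + 2)))"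
      proof (rule sum_mono2)
        show "{q\<in>{1..Q}. ln (real q) \<le> y0} \<subseteq> {1..Y}"
        proof
          fix q assume q: "q \<in> {q\<in>{1..Q}. ln (real q) \<le> y0}"
          then have "real q = exp (ln (real q))" by simp
          also have "\<dots> \<le> exp y0" using q by (subst exp_le_cancel_iff) blast
          finally have "real q \<le> exp y0" .
          then show "q \<in> {1..Y}" using q by (simp add: Y_def le_nat_floor)
        qed
      qed (use a0 y0p in auto)
      also have "\<dots> = (\<Sum>q=1..Y. a q) * (4 * (y0 + 2))" by (rule sum_distrib_right[symmetric])
      also have "\<dots> \<le> (1 + y0) * (4 * (y0 + 2))"
      proof (rule mult_right_mono)
        show "(\<Sum>q=1..Y. a q) \<le> 1 + y0"
          using sum_totient_squares_le_harm[of Y] harm_bounds(2)[OF Y1] lnY unfolding a_def by linarith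
      qed (use y0p in simp)
      also have "\<dots> \<le> (k * sqrt x) * (4 * (k * sqrt x))"
      proof -
        have k0: "k - 3 \<ge> 0" using N1 by (simp add: k_def)
        have "(k - 1) * 1 \<le> (k - 1) * sqrt x" using k0 sx by (intro mult_left_mono) auto
        then have "y0 + 2 \<le> k * sqrt x" unfolding y0_def k_def by (simp add: algebra_simps)
        then show ?thesis using y0p by (intro mult_mono) auto
      qed
      also have "\<dots> = 4 * k ^ 2 * (sqrt x * sqrt x)" by (simp add: power2_eq_square)
      finally show ?thesis unfolding sx(2) .
    qed
    have h0: "h \<ge> 0" using K1 l1 B by (simp add: h_def)
    show ?thesis using 1 2 3 g mu h0 B
      by (intro add_mono mult_left_mono) auto
  qed
  also have "\<dots> = \<gamma> * (\<mu> * (3 / pi\<^sup>2 * ln (real Q) ^ 2)) + \<gamma> * (\<mu> * (21 * x)) + \<gamma> * (h * (2 * x)) + \<gamma> * (4 * k ^ 2 * x) + 2 / B * (2 * x)"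
    by (simp add: algebra_simps)
  also have "\<dots> \<le> ((\<mu> * ln (real Q)) ^ 2 / 2 + 2 * (x ^ 2 / B ^ 4)) + 126 * (x * l / B) + 30240 * K1 * (x ^ 2 / B ^ 4 + x * l / B) + 12 * k ^ 2 * (x * l / B) + 4 * (x * l / B)"
  proof (intro add_mono)
    have xl: "x / B \<le> x * l / B" using l1 x1 B by (intro divide_right_mono) auto
    have "\<gamma> * (\<mu> * (3 / pi\<^sup>2 * ln (real Q) ^ 2)) = 2 * gap_int b c * \<mu> * (3 / pi\<^sup>2) * ln (real Q) ^ 2 + 1 / B ^ 3 * (\<mu> * (3 / pi\<^sup>2 * ln (real Q) ^ 2))"
      unfolding \<gamma>_def B_def distrib_right by (simp only: mult.assoc)
    \<comment> \<open>The mean is 12 / pi^2 times \<open>gap_int\<close>, so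
      \<open>2 * gap_int\<close> times 3 / pi^2 is exactly half of it.\<close>
    also have "2 * gap_int b c * \<mu> * (3 / pi\<^sup>2) * ln (real Q) ^ 2 = (\<mu> * ln (real Q)) ^ 2 / 2"
      unfolding \<mu>_def cfrac_mu_eq[OF bc(1,2)] by (simp add: power2_eq_square)
    also have "1 / B ^ 3 * (\<mu> * (3 / pi\<^sup>2 * ln (real Q) ^ 2)) \<le> 1 / B ^ 3 * (2 / B * (1 * x ^ 2))"
    proof (intro mult_left_mono mult_mono mu)
      have "pi\<^sup>2 / 6 \<ge> 1" using zeta2_partial(1)[of 1] by simp
      then show "3 / pi\<^sup>2 \<le> 1" by (simp add: divide_le_eq)
      show "ln (real Q) ^ 2 \<le> x ^ 2" using lnQ x1 by (intro power_mono) auto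
    qed (use B in auto)
    also have "1 / B ^ 3 * (2 / B * (1 * x ^ 2)) = 2 * (x ^ 2 / B ^ 4)" by (simp add: power3_eq_cube power4_eq_xxxx)
    finally show "\<gamma> * (\<mu> * (3 / pi\<^sup>2 * ln (real Q) ^ 2)) \<le> (\<mu> * ln (real Q)) ^ 2 / 2 + 2 * (x ^ 2 / B ^ 4)" by simp
    have "\<mu> \<le> 2"
    proof -
      have "2 / B \<le> 2 / 1" using B by (intro divide_left_mono) auto
      then show ?thesis using mu by simp
    qed
    then have "\<gamma> * (\<mu> * (21 * x)) \<le> 3 / B * (2 * (21 * x))" using g mu x1 B by (intro mult_mono) auto
    also have "\<dots> = 126 * (x / B)" by simp
    finally show "\<gamma> * (\<mu> * (21 * x)) \<le> 126 * (x * l / B)" using xl by linarith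
    have "\<gamma> * (h * (2 * x)) \<le> 3 / B * (h * (2 * x))" using g K1 l1 x1 B by (intro mult_right_mono) (auto simp: h_def)
    also have "\<dots> = 6 * K1 * (x * l ^ 3 / B ^ 2)" by (simp add: h_def power2_eq_square)
    also have "\<dots> \<le> 6 * K1 * (5040 * (x ^ 2 / B ^ 4 + x * l / B))" using K1 by (intro mult_left_mono l_cube_aux B) auto
    also have "6 * K1 * (5040 * t) = 30240 * K1 * t" for t by simp
    finally show "\<gamma> * (h * (2 * x)) \<le> 30240 * K1 * (x ^ 2 / B ^ 4 + x * l / B)" .
    have "\<gamma> * (4 * k ^ 2 * x) \<le> 3 / B * (4 * k ^ 2 * x)" using g x1 by (intro mult_right_mono) auto
    also have "\<dots> = 12 * k ^ 2 * (x / B)" by simp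
    also have "\<dots> \<le> 12 * k ^ 2 * (x * l / B)" using xl by (intro mult_left_mono) auto
    finally show "\<gamma> * (4 * k ^ 2 * x) \<le> 12 * k ^ 2 * (x * l / B)" .
    show "2 / B * (2 * x) \<le> 4 * (x * l / B)" using xl by simp
  qed
  also have "\<dots> \<le> (\<mu> * ln (real Q)) ^ 2 / 2 + (132 + 30240 * K1 + 12 * k ^ 2) * (x ^ 2 / B ^ 4 + x * l / B)"
  proof -
    define u where "u = x ^ 2 / B ^ 4"
    define v where "v = x * l / B"
    have "0 \<le> u" "0 \<le> v" using x1 l1 B by (auto simp: u_def v_def)
    moreover have "0 \<le> k ^ 2 * u" using \<open>0 \<le> u\<close> by simp
    ultimately show ?thesis unfolding u_def[symmetric] v_def[symmetric] by (simp add: algebra_simps)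
  qed
  finally show ?thesis by (simp only: \<mu>_def k_def B_def)
qed

text \<open>Each half is centred at \<open>M\<close>, half the mean, and the square of
  \<open>(L1 w - M) + (L1 (rev w) - M) + mid - both\<close> is at most 4 times the sum of the four
  squares. By reversal the two centred halves have the same second moment \<open>H\<close>, so no
  product of the two halves is ever evaluated. Squares being nonnegative, the sum may be extended
  from the canonical lists to both expansions.\<close>

lemma second_moment_canon_lists:
  assumes bc: "1 \<le> b" "b \<le> c" "real b \<le> x powr C" and K2: "K2 \<ge> 0"
    and S2: "main_sum b c {1..Q} (quot_count b c) \<le> (cfrac_mu b c * ln (real Q)) ^ 2 / 2 + K2 * (x ^ 2 / real b ^ 4 + x * l / real b)"
  shows "(\<Sum>w\<in>canon_lists N. (quot_count b c w - cfrac_mu b c * x) ^ 2)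
    \<le> 4 * (2 * (4 * K2 + 338 + 48 * (A + 1) ^ 2 + 5 * ((48 + 23424 * exp 18) * (4 * exp 4))) + 15360 * exp 4 * (6 * A + 8) * (A + 1) + 448 * exp 4)
      * (real (totient N) * (x ^ 2 / real b ^ 4 + x * l / real b))"
proof -
  define B where "B = real b"
  define \<phi> where "\<phi> = real (totient N)"
  define \<mu> where "\<mu> = cfrac_mu b c"
  define M where "M = \<mu> * x / 2"
  define M' where "M' = \<mu> * ln (real Q)"
  define v where "v = x * l / B"
  define U where "U = \<phi> * (x ^ 2 / B ^ 4 + v)"
  define E where "E = \<phi> / (B * x)"
  define \<kappa> where "\<kappa> = (48 + 23424 * exp (18::real)) * (4 * exp 4)"
  define L1 where "L1 = split_sum b c {1..Q} (\<lambda>_. 1)"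
  define P where "P = (\<Sum>w\<in>cf_lists N. L1 w)"
  define R where "R = (\<Sum>w\<in>cf_lists N. split_sum b c {1..Q} (quot_count b c) w)"
  define S1 where "S1 = main_sum b c {1..Q} (\<lambda>_. 1)"
  define S2 where "S2 = main_sum b c {1..Q} (quot_count b c)"
  have B: "B \<ge> 1" using bc by (simp add: B_def)
  have f0: "\<phi> \<ge> 0" by (simp add: \<phi>_def)
  have A0: "A \<ge> 0" using C A by simp
  have mu: "0 \<le> \<mu>" "\<mu> \<le> 2 / B" using cfrac_mu_bounds[OF bc(1,2)] by (auto simp: \<mu>_def B_def)
  have v0: "0 \<le> v" using x1 l1 B by (simp add: v_def)
  have vU: "\<phi> * v \<le> U" unfolding U_def using f0 by (intro mult_left_mono) auto
  have xv: "x / B \<le> v" unfolding v_def using l1 x1 B by (intro divide_right_mono) auto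
  have \<kappa>0: "\<kappa> \<ge> 0" by (simp add: \<kappa>_def add_nonneg_nonneg)
  have M0: "0 \<le> M" "M \<le> x / B" "M \<le> x"
  proof -
    show "0 \<le> M" using mu x1 by (simp add: M_def)
    have "\<mu> * x \<le> 2 / B * x" using mu x1 by (intro mult_right_mono) auto
    then show "M \<le> x / B" by (simp add: M_def mult.commute)
    moreover have "x / B \<le> x / 1" using B x1 by (intro divide_left_mono) auto
    ultimately show "M \<le> x" by simp
  qed
  have QN: "Q \<le> N"
  proof -
    have "real Q * 1 \<le> real Q * real Q" using Q_bounds(1) by (intro mult_left_mono) auto
    then show ?thesis using Q_sq_le(2) by (simp add: power2_eq_square)
  qed
  have P: "\<bar>P - 2 * \<phi> * S1\<bar> \<le> \<kappa> * E"
    unfolding P_def L1_def \<phi>_def S1_def \<kappa>_def E_def B_def using x1 by (intro split_sum_error bc) auto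
  have R: "\<bar>R - 2 * \<phi> * S2\<bar> \<le> \<kappa> * E"
  proof -
    \<comment> \<open>\<open>split_sum_error\<close> asks for a weight bounded on all positive
      lists, while \<open>quot_count\<close> is at most \<open>4 * x\<close> only on lists of
      bounded continuant. Only prefixes with continuant up to \<open>Q\<close> enter, and there the
      truncation changes nothing.\<close>
    define wt where "wt u = min (quot_count b c u) (4 * x)" for u
    have wt: "wt u = quot_count b c u" if "poslist u" "cont u \<le> Q" for u
    proof -
      have "u \<in> cf_lists (cont u)" using that by (simp add: cf_lists_def)
      then have "quot_count b c u \<le> 4 * x" unfolding x using that QN N3 by (intro quot_count_le_ln[of u "cont u"]) auto
      then show ?thesis by (simp add: wt_def)
    qed
    have "R = (\<Sum>w\<in>cf_lists N. split_sum b c {1..Q} wt w)" unfolding R_def split_sum_def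
    proof (intro sum.cong refl)
      fix w j assume w: "w \<in> cf_lists N" and j: "j \<in> {j. j < length w \<and> b \<le> w ! j \<and> w ! j \<le> c \<and> cont (take j w) \<in> {1..Q}}"
      have "poslist (take j w)" using w by (auto simp: cf_lists_def poslist_def dest: in_set_takeD)
      then show "quot_count b c (take j w) = wt (take j w)" using j by (simp add: wt)
    qed
    moreover have "S2 = main_sum b c {1..Q} wt" unfolding S2_def main_sum_def
      by (intro sum.cong refl) (auto simp: cf_lists_def wt)
    ultimately show ?thesis unfolding \<phi>_def \<kappa>_def E_def B_def using x1
      by (simp only:) (intro split_sum_error bc, auto simp: wt_def quot_count_nonneg)
  qed
  have S1: "\<bar>S1 - M'\<bar> \<le> 56 / B"
    unfolding S1_def M'_def \<mu>_def B_def by (intro main_sum_one bc Q_bounds)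
  have MM: "0 \<le> M - M'" "M - M' \<le> 2 / B * ((A + 1) * l ^ 2)"
  proof -
    have e: "M - M' = \<mu> * (x / 2 - ln (real Q))" by (simp add: M_def M'_def algebra_simps)
    show "0 \<le> M - M'" unfolding e using mu lnQ by simp
    show "M - M' \<le> 2 / B * ((A + 1) * l ^ 2)" unfolding e using mu lnQ B by (intro mult_mono) auto
  qed
  define H where "H = (\<Sum>w\<in>cf_lists N. (L1 w - M) ^ 2)"
  have N1: "N \<ge> 1" using N3 by simp
  have "H \<le> (\<Sum>w\<in>cf_lists N. 2 * split_sum b c {1..Q} (quot_count b c) w + L1 w - 2 * M * L1 w + M ^ 2)"
    unfolding H_def
  proof (rule sum_mono)
    fix w
    have "(L1 w - M) ^ 2 = L1 w ^ 2 - 2 * M * L1 w + M ^ 2" by (simp add: power2_eq_square algebra_simps)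
    then show "(L1 w - M) ^ 2 \<le> 2 * split_sum b c {1..Q} (quot_count b c) w + L1 w - 2 * M * L1 w + M ^ 2"
      using split_sum_one_square_le[of b c Q w] unfolding L1_def by linarith
  qed
  also have "\<dots> = 2 * R + P - 2 * M * P + 2 * \<phi> * M ^ 2"
    by (simp add: sum.distrib sum_subtractf sum_distrib_left[symmetric] R_def P_def card_cf_lists[OF N1] \<phi>_def)
  also have "\<dots> \<le> 2 * (2 * \<phi> * S2 + \<kappa> * E) + (2 * \<phi> * S1 + \<kappa> * E) - 2 * M * (2 * \<phi> * S1 - \<kappa> * E) + 2 * \<phi> * M ^ 2"
  proof -
    have "R \<le> 2 * \<phi> * S2 + \<kappa> * E" using abs_le_D1[OF R] by simp
    moreover have "P \<le> 2 * \<phi> * S1 + \<kappa> * E" using abs_le_D1[OF P] by simp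
    moreover have "2 * \<phi> * S1 - \<kappa> * E \<le> P" using abs_le_D2[OF P] by simp
    then have "2 * M * (2 * \<phi> * S1 - \<kappa> * E) \<le> 2 * M * P" using M0 by (intro mult_left_mono) auto
    moreover have "2 * R + P - z + t \<le> 2 * r + p - y + t" if "R \<le> r" "P \<le> p" "y \<le> z" for r p y z t :: real
      using that by linarith
    ultimately show ?thesis by blast
  qed
  \<comment> \<open>This regrouping isolates the cancellation: \<open>2 * S2\<close> and
    \<open>M' ^ 2\<close> can each be as large as the squared mean, but their difference is bounded
    by the hypothesis on the weighted main term.\<close>
  also have "\<dots> = 2 * \<phi> * ((2 * S2 - M' ^ 2) + S1 + 2 * M * (M' - S1) + (M - M') ^ 2) + (3 + 2 * M) * (\<kappa> * E)"
    by (simp add: power2_eq_square algebra_simps)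
  also have "\<dots> \<le> 2 * \<phi> * (2 * K2 * (x ^ 2 / B ^ 4 + v) + 57 * v + 112 * v + 24 * (A + 1) ^ 2 * v) + 5 * \<kappa> * (\<phi> * v)"
  proof (intro add_mono mult_left_mono)
    have "2 * s - m \<le> 2 * K2 * t" if "s \<le> m / 2 + K2 * t" for s m t
      using that by simp
    from this[OF assms(5)] show "2 * S2 - M' ^ 2 \<le> 2 * K2 * (x ^ 2 / B ^ 4 + v)"
      unfolding S2_def M'_def \<mu>_def B_def v_def .
    have M'le: "M' \<le> x / B" using MM(1) M0(2) by linarith
    have "56 / B \<le> 56 * x / B" using x1 B by (intro divide_right_mono) auto
    then show "S1 \<le> 57 * v" using abs_le_D1[OF S1] M'le xv by simp
    have "2 * M * (M' - S1) \<le> 2 * x * (56 / B)"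
    proof -
      have "2 * M * (M' - S1) \<le> 2 * M * (56 / B)" using abs_le_D2[OF S1] M0 by (intro mult_left_mono) auto
      also have "\<dots> \<le> 2 * x * (56 / B)" using M0 B by (intro mult_right_mono) auto
      finally show ?thesis .
    qed
    also have "\<dots> = 112 * (x / B)" by simp
    finally show "2 * M * (M' - S1) \<le> 112 * v" using xv by linarith
    have "(M - M') ^ 2 \<le> (2 / B * ((A + 1) * l ^ 2)) ^ 2" using MM by (intro power_mono) auto
    also have "\<dots> = 4 * (A + 1) ^ 2 * (l ^ 3 * l / (B * B))" by (simp add: power2_eq_square power3_eq_cube)
    also have "\<dots> \<le> 4 * (A + 1) ^ 2 * (6 * x * l / (B * 1))"
    proof (intro mult_left_mono frac_le mult_right_mono)
      show "l ^ 3 \<le> 6 * x" using l_power_le[of 3] by (simp add: fact_numeral)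
    qed (use l1 x1 B in auto)
    also have "\<dots> = 24 * (A + 1) ^ 2 * v" by (simp add: v_def)
    finally show "(M - M') ^ 2 \<le> 24 * (A + 1) ^ 2 * v" .
    have "(3 + 2 * M) * (\<kappa> * E) \<le> (5 * x) * (\<kappa> * E)"
      using M0 x1 \<kappa>0 f0 B by (intro mult_right_mono) (auto simp: E_def)
    also have "\<dots> = 5 * \<kappa> * (\<phi> * (1 / B))" using x1 by (simp add: E_def)
    also have "\<dots> \<le> 5 * \<kappa> * (\<phi> * v)"
    proof (intro mult_left_mono)
      have "1 / B \<le> x / B" using x1 B by (intro divide_right_mono) auto
      then show "1 / B \<le> v" using xv by linarith
    qed (use f0 \<kappa>0 in auto)
    finally show "(3 + 2 * M) * (\<kappa> * E) \<le> 5 * \<kappa> * (\<phi> * v)" .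
  qed (use f0 in auto)
  also have "\<dots> = 4 * K2 * U + (338 + 48 * (A + 1) ^ 2 + 5 * \<kappa>) * (\<phi> * v)" by (simp add: U_def algebra_simps)
  also have "\<dots> \<le> 4 * K2 * U + (338 + 48 * (A + 1) ^ 2 + 5 * \<kappa>) * U"
    using vU \<kappa>0 by (intro add_left_mono mult_left_mono) auto
  finally have H: "H \<le> (4 * K2 + 338 + 48 * (A + 1) ^ 2 + 5 * \<kappa>) * U" by (simp add: algebra_simps)
  have Hr: "(\<Sum>w\<in>cf_lists N. (L1 (rev w) - M) ^ 2) = H" unfolding H_def by (rule sum_cf_lists_rev[of "\<lambda>w. (L1 w - M) ^ 2"])
  \<comment> \<open>The pointwise bound of order \<open>l ^ 2\<close> is multiplied by the mean
    bound of order \<open>l ^ 3 / b\<close>; the resulting \<open>l ^ 5\<close> is absorbed by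
    \<open>l ^ 5 <= 5! * x\<close>, and 15360 = 128 * 120.\<close>
  have Lm: "(\<Sum>w\<in>cf_lists N. mid_count b c Q w ^ 2) \<le> 15360 * exp 4 * (6 * A + 8) * (A + 1) * U"
  proof -
    have "(\<Sum>w\<in>cf_lists N. mid_count b c Q w ^ 2) \<le> (\<Sum>w\<in>cf_lists N. (6 * A + 8) * l ^ 2 * mid_count b c Q w)"
      unfolding power2_eq_square[of "mid_count b c Q _"]
      by (intro sum_mono mult_right_mono mid_count_bound bc) (auto simp: mid_count_def)
    also have "\<dots> = (6 * A + 8) * l ^ 2 * (\<Sum>w\<in>cf_lists N. mid_count b c Q w)" by (rule sum_distrib_left[symmetric])
    also have "\<dots> \<le> (6 * A + 8) * l ^ 2 * (128 * exp 4 * (A + 1) * (\<phi> * l ^ 3 / B))"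
      unfolding \<phi>_def B_def using A0 by (intro mult_left_mono sum_mid_count bc) auto
    also have "\<dots> = 128 * exp 4 * (6 * A + 8) * (A + 1) * (\<phi> * (l ^ 5 / B))"
      by (simp add: power_add[of l 2 3, symmetric, simplified] mult_ac flip: power_add)
    also have "\<dots> \<le> 128 * exp 4 * (6 * A + 8) * (A + 1) * (\<phi> * (120 * v))"
    proof (intro mult_left_mono)
      have "l ^ 5 \<le> 120 * x" using l_power_le[of 5] by (simp add: fact_numeral)
      also have "\<dots> \<le> 120 * (x * l)" using x1 l1 by simp
      finally have "l ^ 5 / B \<le> 120 * (x * l) / B" using B by (intro divide_right_mono) auto
      then show "l ^ 5 / B \<le> 120 * v" by (simp add: v_def)
    qed (use f0 A0 in auto)
    also have "\<dots> = 15360 * exp 4 * (6 * A + 8) * (A + 1) * (\<phi> * v)" by simp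
    also have "\<dots> \<le> 15360 * exp 4 * (6 * A + 8) * (A + 1) * U" using vU A0 by (intro mult_left_mono) auto
    finally show ?thesis .
  qed
  have Lb: "(\<Sum>w\<in>cf_lists N. both_count b c Q w ^ 2) \<le> 448 * exp 4 * U"
  proof -
    have "(\<Sum>w\<in>cf_lists N. both_count b c Q w ^ 2) \<le> (\<Sum>w\<in>cf_lists N. 4 * x * both_count b c Q w)"
      unfolding power2_eq_square[of "both_count b c Q _"]
    proof (intro sum_mono mult_right_mono)
      fix w assume w: "w \<in> cf_lists N"
      have "card {j\<in>good_idx b c w. cont (take j w) \<le> Q \<and> cont (drop (Suc j) w) \<le> Q} \<le> card (good_idx b c w)"
        by (intro card_mono) auto
      then have "both_count b c Q w \<le> quot_count b c w" by (simp add: both_count_def quot_count_def)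
      also have "\<dots> \<le> 4 * x" unfolding x using N3 by (intro quot_count_le_ln[OF w]) auto
      finally show "both_count b c Q w \<le> 4 * x" .
    qed (simp add: both_count_def)
    also have "\<dots> = 4 * x * (\<Sum>w\<in>cf_lists N. both_count b c Q w)" by (rule sum_distrib_left[symmetric])
    also have "\<dots> \<le> 4 * x * (112 * exp 4 * (\<phi> / (B * x)))"
      unfolding \<phi>_def B_def using x1 by (intro mult_left_mono sum_both_count bc) auto
    also have "\<dots> = 448 * exp 4 * (\<phi> * (1 / B))" using x1 by simp
    also have "\<dots> \<le> 448 * exp 4 * (\<phi> * v)"
    proof (intro mult_left_mono)
      have "1 / B \<le> x / B" using x1 B by (intro divide_right_mono) auto
      then show "1 / B \<le> v" using xv by linarith
    qed (use f0 in auto)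
    also have "\<dots> \<le> 448 * exp 4 * U" using vU by (intro mult_left_mono) auto
    finally show ?thesis .
  qed
  have sq4: "(p + q + r - s) ^ 2 \<le> 4 * (p ^ 2 + q ^ 2 + r ^ 2 + s ^ 2)" for p q r s :: real
  proof -
    have "0 \<le> (p - q) ^ 2 + (p - r) ^ 2 + (p + s) ^ 2 + (q - r) ^ 2 + (q + s) ^ 2 + (r + s) ^ 2" by simp
    then show ?thesis by (simp add: power2_eq_square algebra_simps)
  qed
  have "(\<Sum>w\<in>canon_lists N. (quot_count b c w - \<mu> * x) ^ 2) \<le> (\<Sum>w\<in>cf_lists N. (quot_count b c w - \<mu> * x) ^ 2)"
    by (rule sum_mono2) (auto simp: canon_lists_def)
  also have "\<dots> \<le> (\<Sum>w\<in>cf_lists N. 4 * ((L1 w - M) ^ 2 + (L1 (rev w) - M) ^ 2 + mid_count b c Q w ^ 2 + both_count b c Q w ^ 2))"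
  proof (rule sum_mono)
    fix w assume "w \<in> cf_lists N"
    then have "poslist w" by (simp add: cf_lists_def)
    from quot_count_decomp[OF this, of b c Q] have "quot_count b c w - \<mu> * x = (L1 w - M) + (L1 (rev w) - M) + mid_count b c Q w - both_count b c Q w"
      unfolding L1_def M_def by simp
    then show "(quot_count b c w - \<mu> * x) ^ 2 \<le> 4 * ((L1 w - M) ^ 2 + (L1 (rev w) - M) ^ 2 + mid_count b c Q w ^ 2 + both_count b c Q w ^ 2)"
      by (simp only: sq4)
  qed
  also have "\<dots> = 4 * (2 * H + (\<Sum>w\<in>cf_lists N. mid_count b c Q w ^ 2) + (\<Sum>w\<in>cf_lists N. both_count b c Q w ^ 2))"
    unfolding sum_distrib_left[symmetric] sum.distrib Hr by (simp add: H_def)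
  also have "\<dots> \<le> 4 * (2 * ((4 * K2 + 338 + 48 * (A + 1) ^ 2 + 5 * \<kappa>) * U) + 15360 * exp 4 * (6 * A + 8) * (A + 1) * U + 448 * exp 4 * U)"
    using H Lm Lb by (intro mult_left_mono add_mono) auto
  also have "\<dots> = 4 * (2 * (4 * K2 + 338 + 48 * (A + 1) ^ 2 + 5 * \<kappa>) + 15360 * exp 4 * (6 * A + 8) * (A + 1) + 448 * exp 4) * U"
    by (simp add: distrib_right distrib_left)
  finally show ?thesis by (simp only: \<mu>_def \<kappa>_def U_def \<phi>_def B_def v_def)
qed

end

lemma second_moment_large:
  fixes C :: real
  assumes "C > 0"
  shows "\<exists>K N0. K \<ge> 0 \<and> N0 \<ge> 3 \<and> (\<forall>N\<ge>N0. \<forall>b c. 1 \<le> b \<longrightarrow> b \<le> c \<longrightarrow> real b \<le> ln (real N) powr C \<longrightarrow>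
    (\<Sum>w\<in>canon_lists N. (quot_count b c w - cfrac_mu b c * ln (real N)) ^ 2)
      \<le> K * (real (totient N) * (ln (real N) ^ 2 / real b ^ 4 + ln (real N) * ln (ln (real N)) / real b)))"
proof -
  obtain N0 where N0: "N0 \<ge> 3" "\<And>N. N \<ge> N0 \<Longrightarrow> large_denominator C (C + 5) N (ln (real N)) (ln (ln (real N))) (exp ((C + 5) * ln (ln (real N)) ^ 2))
    (nat \<lfloor>sqrt (real N) / exp ((C + 5) * ln (ln (real N)) ^ 2)\<rfloor>)"
    using eventually_large_denominator[OF assms] by blast
  \<comment> \<open>The first moment is applied to denominators \<open>q <= Q\<close>, whose
    logarithm may be much smaller than \<open>ln N\<close>. The doubled exponent still admits
    \<open>b\<close> whenever \<open>ln q\<close> is at least \<open>sqrt (ln N)\<close>.\<close>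
  have "2 * C > 0" using assms by simp
  from first_moment_large[OF this] obtain K1 N1 where K1: "K1 \<ge> 0" "N1 \<ge> 3" and FM: "\<And>N b c. N \<ge> N1 \<Longrightarrow> 1 \<le> b \<Longrightarrow> b \<le> c \<Longrightarrow> real b \<le> ln (real N) powr (2 * C) \<Longrightarrow>
    \<bar>(\<Sum>w\<in>canon_lists N. quot_count b c w) - real (totient N) * cfrac_mu b c * ln (real N)\<bar> \<le> K1 * (real (totient N) * ln (ln (real N)) ^ 3 / real b)"
    by blast
  define K2 where "K2 = 132 + 30240 * K1 + 12 * (ln (real N1) + 3) ^ 2"
  have K2: "K2 \<ge> 0" using K1 by (simp add: K2_def)
  define K where "K = 4 * (2 * (4 * K2 + 338 + 48 * (C + 5 + 1) ^ 2 + 5 * ((48 + 23424 * exp 18) * (4 * exp 4))) + 15360 * exp 4 * (6 * (C + 5) + 8) * (C + 5 + 1) + 448 * exp (4::real))"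
  have "K \<ge> 0" using K2 assms by (simp add: K_def)
  moreover have "(\<Sum>w\<in>canon_lists N. (quot_count b c w - cfrac_mu b c * ln (real N)) ^ 2)
      \<le> K * (real (totient N) * (ln (real N) ^ 2 / real b ^ 4 + ln (real N) * ln (ln (real N)) / real b))"
    if "N \<ge> N0" "1 \<le> b" "b \<le> c" "real b \<le> ln (real N) powr C" for N b c
  proof -
    interpret large_denominator C "C + 5" N "ln (real N)" "ln (ln (real N))" "exp ((C + 5) * ln (ln (real N)) ^ 2)"
      "nat \<lfloor>sqrt (real N) / exp ((C + 5) * ln (ln (real N)) ^ 2)\<rfloor>" by (rule N0(2)[OF that(1)])
    show ?thesis unfolding K_def
      by (rule second_moment_canon_lists[OF that(2-4) K2]) (unfold K2_def, rule main_sum_quot_count_le[OF FM[OF _ that(2,3)] K1 that(2-4)])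
  qed
  ultimately show ?thesis using N0(1) by blast
qed

section \<open>Small denominators and the two estimates\<close>

lemma ln_3_gt_1: "ln (3::real) > 1"
proof -
  have "exp 1 < (3::real)" using exp_le e_less_272 by simp
  then have "ln (exp 1) < ln (3::real)" by (subst ln_less_cancel_iff) auto
  then show ?thesis by simp
qed

lemma quot_count_minus_mean_bound:
  assumes N: "N \<ge> 3" and bc: "1 \<le> b" "b \<le> c" and w: "w \<in> canon_lists N"
  shows "\<bar>quot_count b c w - cfrac_mu b c * ln (real N)\<bar> \<le> 6 * ln (real N)"
proof -
  have x: "ln (real N) \<ge> 1" using N exp_le by (subst ln_ge_iff) auto
  have L: "0 \<le> quot_count b c w" "quot_count b c w \<le> 4 * ln (real N)"
    using quot_count_nonneg quot_count_le_ln[of w N N b c] w N by (auto simp: canon_lists_def)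
  have "2 / real b \<le> 2 / 1" using bc by (intro divide_left_mono) auto
  then have "cfrac_mu b c \<le> 2" using cfrac_mu_bounds(2)[OF bc] by simp
  then have "cfrac_mu b c * ln (real N) \<le> 2 * ln (real N)" using x by (intro mult_right_mono) auto
  moreover have "0 \<le> cfrac_mu b c * ln (real N)" using cfrac_mu_bounds(1)[OF bc] x by simp
  ultimately show ?thesis using L by linarith
qed

text \<open>For the finitely many \<open>N\<close> below a threshold the right sides of the theorem
  must stay away from 0. This works because \<open>b\<close> is bounded there and
  \<open>ln (ln N)\<close> is at least \<open>ln (ln 3)\<close>, which is positive as 3 > e.\<close>

lemma small_denominator_bounds:
  assumes C: "C > 0" and N: "3 \<le> N" "N \<le> N0" and b: "real b \<le> ln (real N) powr C"
  shows "ln (real N) \<le> ln (real N0)" "real b \<le> ln (real N0) powr C" "ln (ln 3) \<le> ln (ln (real N))"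
proof -
  have x: "ln (real N) \<ge> ln 3" using N by (subst ln_le_cancel_iff) auto
  show 1: "ln (real N) \<le> ln (real N0)" using N by (subst ln_le_cancel_iff) auto
  have "ln (real N) powr C \<le> ln (real N0) powr C" using 1 x ln_3_gt_1 C by (intro powr_mono2) auto
  then show "real b \<le> ln (real N0) powr C" using b by linarith
  show "ln (ln 3) \<le> ln (ln (real N))" using x ln_3_gt_1 by (subst ln_le_cancel_iff) auto
qed

theorem theorem3:
  fixes C :: real
  assumes "C > 0"
  shows "(\<exists>K. \<forall>N b c :: nat. N \<ge> 3 \<longrightarrow> 1 \<le> b \<longrightarrow> b \<le> c \<longrightarrow> real b \<le> ln (real N) powr C \<longrightarrow>
            \<bar>1 / real (totient N) * (\<Sum>a\<in>totatives N. real (count_quotients b c (real a / real N)))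
               - cfrac_mu b c * ln (real N)\<bar>
            \<le> K * (ln (ln (real N)) ^ 3 / real b))
       \<and> (\<exists>K. \<forall>N b c :: nat. N \<ge> 3 \<longrightarrow> 1 \<le> b \<longrightarrow> b \<le> c \<longrightarrow> real b \<le> ln (real N) powr C \<longrightarrow>
            1 / real (totient N) *
              (\<Sum>a\<in>totatives N. (real (count_quotients b c (real a / real N))
                                   - cfrac_mu b c * ln (real N))\<^sup>2)
            \<le> K * (ln (real N) ^ 2 / real b ^ 4 + ln (real N) * ln (ln (real N)) / real b))"
proof (intro conjI)
  obtain K N0 where K: "K \<ge> 0" "N0 \<ge> 3" and FM: "\<And>N b c. N \<ge> N0 \<Longrightarrow> 1 \<le> b \<Longrightarrow> b \<le> c \<Longrightarrow> real b \<le> ln (real N) powr C \<Longrightarrow>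
      \<bar>(\<Sum>w\<in>canon_lists N. quot_count b c w) - real (totient N) * cfrac_mu b c * ln (real N)\<bar> \<le> K * (real (totient N) * ln (ln (real N)) ^ 3 / real b)"
    using first_moment_large[OF assms] by blast
  define x0 where "x0 = ln (real N0)"
  define t0 where "t0 = ln (ln (3::real))"
  \<comment> \<open>Chosen so that the trivial bound \<open>6 * x0\<close> equals \<open>K'\<close>
    times the smallest possible value \<open>t0 ^ 3 / x0 powr C\<close> of the right side.\<close>
  define K' where "K' = 6 * x0 * (x0 powr C / t0 ^ 3)"
  have t0: "t0 > 0" using ln_3_gt_1 by (simp add: t0_def)
  have x0: "x0 \<ge> 0" using K by (simp add: x0_def)
  have K': "K' \<ge> 0" using t0 x0 by (simp add: K'_def)
  show "\<exists>K. \<forall>N b c :: nat. N \<ge> 3 \<longrightarrow> 1 \<le> b \<longrightarrow> b \<le> c \<longrightarrow> real b \<le> ln (real N) powr C \<longrightarrow>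
            \<bar>1 / real (totient N) * (\<Sum>a\<in>totatives N. real (count_quotients b c (real a / real N)))
               - cfrac_mu b c * ln (real N)\<bar>
            \<le> K * (ln (ln (real N)) ^ 3 / real b)"
  proof (intro exI[of _ "K + K'"] allI impI)
    fix N b c :: nat
    assume N: "N \<ge> 3" and bc: "1 \<le> b" "b \<le> c" and b: "real b \<le> ln (real N) powr C"
    define \<phi> where "\<phi> = real (totient N)"
    define l where "l = ln (ln (real N))"
    define \<mu>x where "\<mu>x = cfrac_mu b c * ln (real N)"
    have f: "\<phi> > 0" using N by (simp add: \<phi>_def)
    have "ln 3 \<le> ln (real N)" using N by (subst ln_le_cancel_iff) auto
    then have l0: "l > 0" unfolding l_def using ln_3_gt_1 by simp
    have e: "(\<Sum>a\<in>totatives N. real (count_quotients b c (real a / real N))) = (\<Sum>w\<in>canon_lists N. quot_count b c w)"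
      unfolding count_quotients_eq using sum_totatives_canon_lists[of N "quot_count b c"] N by simp
    have main: "\<bar>(\<Sum>w\<in>canon_lists N. quot_count b c w) - \<phi> * \<mu>x\<bar> \<le> \<phi> * ((K + K') * (l ^ 3 / real b))"
    proof (cases "N \<ge> N0")
      case True
      have "\<bar>(\<Sum>w\<in>canon_lists N. quot_count b c w) - \<phi> * \<mu>x\<bar> \<le> \<phi> * (K * (l ^ 3 / real b))"
        using FM[OF True bc b] by (simp add: \<phi>_def \<mu>x_def l_def mult_ac)
      also have "\<dots> \<le> \<phi> * ((K + K') * (l ^ 3 / real b))"
        using f l0 K' by (intro mult_left_mono mult_right_mono) auto
      finally show ?thesis .
    next
      case False
      note s = small_denominator_bounds[OF assms N _ b, of N0, folded x0_def t0_def l_def]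
      have "(\<Sum>w\<in>canon_lists N. quot_count b c w) - \<phi> * \<mu>x = (\<Sum>w\<in>canon_lists N. quot_count b c w - \<mu>x)"
        using N by (simp add: sum_subtractf card_canon_lists \<phi>_def)
      also have "\<bar>\<dots>\<bar> \<le> (\<Sum>w\<in>canon_lists N. 6 * x0)"
      proof (rule order.trans[OF sum_abs sum_mono])
        fix w assume "w \<in> canon_lists N"
        from quot_count_minus_mean_bound[OF N bc this] s(1) False
        show "\<bar>quot_count b c w - \<mu>x\<bar> \<le> 6 * x0" unfolding \<mu>x_def by simp
      qed
      also have "\<dots> = \<phi> * (6 * x0)" using N by (simp add: card_canon_lists \<phi>_def)
      also have "\<dots> \<le> \<phi> * ((K + K') * (l ^ 3 / real b))"
      proof (rule mult_left_mono)
        have bx: "real b \<le> x0 powr C" "t0 \<le> l" using s False by auto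
        have b0: "real b > 0" using bc by simp
        then have "x0 powr C > 0" using bx by linarith
        then have "6 * x0 = K' * (t0 ^ 3 / x0 powr C)" using t0 by (simp add: K'_def)
        also have "\<dots> \<le> K' * (l ^ 3 / real b)"
          using bx t0 K' b0 by (intro mult_left_mono frac_le power_mono) auto
        also have "\<dots> \<le> (K + K') * (l ^ 3 / real b)" using K l0 by (intro mult_right_mono) auto
        finally show "6 * x0 \<le> (K + K') * (l ^ 3 / real b)" .
      qed (use f in simp)
      finally show ?thesis .
    qed
    have "1 / \<phi> * (\<Sum>w\<in>canon_lists N. quot_count b c w) - \<mu>x = ((\<Sum>w\<in>canon_lists N. quot_count b c w) - \<phi> * \<mu>x) / \<phi>"
      using f by (simp add: field_simps)
    then have "\<bar>1 / \<phi> * (\<Sum>w\<in>canon_lists N. quot_count b c w) - \<mu>x\<bar> = \<bar>(\<Sum>w\<in>canon_lists N. quot_count b c w) - \<phi> * \<mu>x\<bar> / \<phi>"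
      using f by (simp only: abs_divide)
    also have "\<dots> \<le> (K + K') * (l ^ 3 / real b)" using main f by (simp add: pos_divide_le_eq mult.commute)
    finally show "\<bar>1 / real (totient N) * (\<Sum>a\<in>totatives N. real (count_quotients b c (real a / real N)))
               - cfrac_mu b c * ln (real N)\<bar> \<le> (K + K') * (ln (ln (real N)) ^ 3 / real b)"
      unfolding e \<phi>_def \<mu>x_def l_def .
  qed
next
  obtain K N0 where K: "K \<ge> 0" "N0 \<ge> 3" and SM: "\<And>N b c. N \<ge> N0 \<Longrightarrow> 1 \<le> b \<Longrightarrow> b \<le> c \<Longrightarrow> real b \<le> ln (real N) powr C \<Longrightarrow>
      (\<Sum>w\<in>canon_lists N. (quot_count b c w - cfrac_mu b c * ln (real N)) ^ 2)
      \<le> K * (real (totient N) * (ln (real N) ^ 2 / real b ^ 4 + ln (real N) * ln (ln (real N)) / real b))"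
    using second_moment_large[OF assms] by blast
  \<comment> \<open>For small \<open>N\<close> the term \<open>x ^ 2 / b ^ 4\<close> alone suffices:
    multiplied by \<open>36 * b ^ 4\<close> it is the trivial bound \<open>(6 * x) ^ 2\<close>, and
    \<open>b\<close> is at most \<open>ln N0 powr C\<close>.\<close>
  define K' where "K' = 36 * (ln (real N0) powr C) ^ 4"
  have K': "K' \<ge> 0" by (simp add: K'_def)
  show "\<exists>K. \<forall>N b c :: nat. N \<ge> 3 \<longrightarrow> 1 \<le> b \<longrightarrow> b \<le> c \<longrightarrow> real b \<le> ln (real N) powr C \<longrightarrow>
            1 / real (totient N) *
              (\<Sum>a\<in>totatives N. (real (count_quotients b c (real a / real N))
                                   - cfrac_mu b c * ln (real N))\<^sup>2)
            \<le> K * (ln (real N) ^ 2 / real b ^ 4 + ln (real N) * ln (ln (real N)) / real b)"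
  proof (intro exI[of _ "K + K'"] allI impI)
    fix N b c :: nat
    assume N: "N \<ge> 3" and bc: "1 \<le> b" "b \<le> c" and b: "real b \<le> ln (real N) powr C"
    define \<phi> where "\<phi> = real (totient N)"
    define x where "x = ln (real N)"
    define l where "l = ln x"
    define u where "u = x ^ 2 / real b ^ 4"
    define v where "v = x * l / real b"
    define V where "V = (\<Sum>w\<in>canon_lists N. (quot_count b c w - cfrac_mu b c * x) ^ 2)"
    have f: "\<phi> > 0" using N by (simp add: \<phi>_def)
    have "ln 3 \<le> x" unfolding x_def using N by (subst ln_le_cancel_iff) auto
    then have x1: "x > 1" using ln_3_gt_1 by linarith
    then have l0: "l > 0" by (simp add: l_def)
    have uv: "0 \<le> u" "0 \<le> v" using x1 l0 by (auto simp: u_def v_def)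
    have e: "(\<Sum>a\<in>totatives N. (real (count_quotients b c (real a / real N)) - cfrac_mu b c * ln (real N))\<^sup>2) = V"
      unfolding count_quotients_eq V_def x_def
      using sum_totatives_canon_lists[of N "\<lambda>w. (quot_count b c w - cfrac_mu b c * ln (real N)) ^ 2"] N by simp
    have main: "V \<le> \<phi> * ((K + K') * (u + v))"
    proof (cases "N \<ge> N0")
      case True
      have "V \<le> \<phi> * (K * (u + v))"
        using SM[OF True bc b] by (simp add: \<phi>_def V_def u_def v_def l_def x_def mult_ac)
      also have "\<dots> \<le> \<phi> * ((K + K') * (u + v))"
        using f uv K' by (intro mult_left_mono mult_right_mono) auto
      finally show ?thesis .
    next
      case False
      have "V \<le> (\<Sum>w\<in>canon_lists N. (6 * x) ^ 2)" unfolding V_def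
      proof (rule sum_mono)
        fix w assume "w \<in> canon_lists N"
        from quot_count_minus_mean_bound[OF N bc this] have "\<bar>quot_count b c w - cfrac_mu b c * x\<bar> \<le> \<bar>6 * x\<bar>"
          using x1 by (simp add: x_def)
        then show "(quot_count b c w - cfrac_mu b c * x) ^ 2 \<le> (6 * x) ^ 2" by (rule abs_le_square_iff[THEN iffD1])
      qed
      also have "\<dots> = \<phi> * (36 * x ^ 2)" using N by (simp add: card_canon_lists \<phi>_def power_mult_distrib)
      also have "\<dots> \<le> \<phi> * ((K + K') * (u + v))"
      proof (rule mult_left_mono)
        have b0: "real b > 0" using bc by simp
        have "real b \<le> ln (real N0) powr C" using small_denominator_bounds(2)[OF assms N _ b, of N0] False by simp
        then have "real b ^ 4 \<le> (ln (real N0) powr C) ^ 4" by (intro power_mono) auto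
        then have "36 * real b ^ 4 * u \<le> K' * u" using uv by (intro mult_right_mono) (auto simp: K'_def)
        also have "\<dots> \<le> (K + K') * (u + v)" using K K' uv by (intro mult_mono) auto
        finally show "36 * x ^ 2 \<le> (K + K') * (u + v)" using b0 by (simp add: u_def)
      qed (use f in simp)
      finally show ?thesis .
    qed
    have "1 / \<phi> * V \<le> (K + K') * (u + v)" using main f by (simp add: pos_divide_le_eq mult.commute)
    then show "1 / real (totient N) *
              (\<Sum>a\<in>totatives N. (real (count_quotients b c (real a / real N)) - cfrac_mu b c * ln (real N))\<^sup>2)
            \<le> (K + K') * (ln (real N) ^ 2 / real b ^ 4 + ln (real N) * ln (ln (real N)) / real b)"
      unfolding e \<phi>_def u_def v_def l_def x_def .
  qed
qed

end
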